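(* The following are logically equivalent: (1) (Rosolini choice) for all $P,Q:\mathcal U$, $\operatorname{isRosolini}(P)\to\big(P\to\lVert\operatorname{rosoliniStructure}(Q)\rVert\big)\to\big\lVert P\to\operatorname{rosoliniStructure}(Q)\big\rVert$; (2) the Rosolini propositions form a dominance, i.e. the family $\operatorname{isRosolini}:\mathcal U\to\mathcal U$ is a dominance.
   Context: Type theory: Martin-Löf type theory with universe $\mathcal U$, function extensionality, proposition extensionality and propositional truncations $\lVert X\rVert$. A proposition is a type any two of whose elements are equal. For $\alpha:\mathbb N\to 2$ let $\langle\alpha\rangle:=\sum_{n:\mathbb N}(\alpha_n=1)$. The extended naturals are $\mathbb N_\infty:=\sum_{\alpha:\mathbb N\to 2}\operatorname{isProp}(\langle\alpha\rangle)$ (binary sequences with at most one $1$), and $\langle u\rangle$ for $u:\mathbb N_\infty$ means $\langle\alpha\rangle$ for its underlying sequence. A Rosolini structure on $P:\mathcal U$ is an element of $\operatorname{rosoliniStructure}(P):=\sum_{u:\mathbb N_\infty}(P=\langle u\rangle)$, and $\operatorname{isRosolini}(P):=\lVert\operatorname{rosoliniStructure}(P)\rVert$. A dominance is a family $\operatorname{d}:\mathcal U\to\mathcal U$ such that $\operatorname{isProp}(\operatorname{d}(X))$ for all $X$, $\operatorname{d}(X)\to\operatorname{isProp}(X)$ for all $X$, $\operatorname{d}(1)$ holds, and for all $P,Q:\mathcal U$, $\operatorname{d}(P)\to(P\to\operatorname{d}(Q))\to\operatorname{d}(P\times Q)$. *)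

theory Defs
  imports Main
begin

section \<open>Syntax\<close>

text \<open>
  In Isabelle/HOL itself the excluded middle and choice hold, so the type theory is given as an
  object language. Terms use de Bruijn indices; the only binders are the second arguments of
  \<open>Pi\<close>, \<open>Lam\<close> and \<open>Sig\<close>. Motives of eliminators are functions of the object language.

  \<open>J C c p\<close> is based path induction. \<open>TrI\<close>, \<open>TrP\<close> and \<open>TrE\<close> are the constructor of the
  propositional truncation, the witness that it is a proposition, and its recursor.
\<close>

datatype tm =
    Var nat
  | Univ nat
  | Pi tm tm | Lam tm tm | App tm tm
  | Sig tm tm | Pr tm tm | Fst tm | Snd tm
  | Eq tm tm tm | Refl tm | J tm tm tm
  | Empty | EmptyE tm tm
  | One | Star | OneE tm tm tm
  | Two | B0 | B1 | TwoE tm tm tm tm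
  | Plus tm tm | InL tm | InR tm | PlusE tm tm tm tm
  | NN | Zero | Succ tm | NatE tm tm tm tm
  | Trunc tm | TrI tm | TrP tm tm | TrE tm tm tm
  | FunExt tm
  | PropExt tm tm tm tm

definition upr :: "(nat \<Rightarrow> nat) \<Rightarrow> nat \<Rightarrow> nat" where
  "upr \<xi> = case_nat 0 (\<lambda>n. Suc (\<xi> n))"

primrec ren :: "(nat \<Rightarrow> nat) \<Rightarrow> tm \<Rightarrow> tm" where
  "ren \<xi> (Var n) = Var (\<xi> n)"
| "ren \<xi> (Univ i) = Univ i"
| "ren \<xi> (Pi A B) = Pi (ren \<xi> A) (ren (upr \<xi>) B)"
| "ren \<xi> (Lam A b) = Lam (ren \<xi> A) (ren (upr \<xi>) b)"
| "ren \<xi> (App f a) = App (ren \<xi> f) (ren \<xi> a)"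
| "ren \<xi> (Sig A B) = Sig (ren \<xi> A) (ren (upr \<xi>) B)"
| "ren \<xi> (Pr a b) = Pr (ren \<xi> a) (ren \<xi> b)"
| "ren \<xi> (Fst p) = Fst (ren \<xi> p)"
| "ren \<xi> (Snd p) = Snd (ren \<xi> p)"
| "ren \<xi> (Eq A a b) = Eq (ren \<xi> A) (ren \<xi> a) (ren \<xi> b)"
| "ren \<xi> (Refl a) = Refl (ren \<xi> a)"
| "ren \<xi> (J C c p) = J (ren \<xi> C) (ren \<xi> c) (ren \<xi> p)"
| "ren \<xi> Empty = Empty"
| "ren \<xi> (EmptyE C e) = EmptyE (ren \<xi> C) (ren \<xi> e)"
| "ren \<xi> One = One"
| "ren \<xi> Star = Star"
| "ren \<xi> (OneE C c t) = OneE (ren \<xi> C) (ren \<xi> c) (ren \<xi> t)"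
| "ren \<xi> Two = Two"
| "ren \<xi> B0 = B0"
| "ren \<xi> B1 = B1"
| "ren \<xi> (TwoE C c d t) = TwoE (ren \<xi> C) (ren \<xi> c) (ren \<xi> d) (ren \<xi> t)"
| "ren \<xi> (Plus A B) = Plus (ren \<xi> A) (ren \<xi> B)"
| "ren \<xi> (InL a) = InL (ren \<xi> a)"
| "ren \<xi> (InR a) = InR (ren \<xi> a)"
| "ren \<xi> (PlusE C l r t) = PlusE (ren \<xi> C) (ren \<xi> l) (ren \<xi> r) (ren \<xi> t)"
| "ren \<xi> NN = NN"
| "ren \<xi> Zero = Zero"
| "ren \<xi> (Succ n) = Succ (ren \<xi> n)"
| "ren \<xi> (NatE C z s n) = NatE (ren \<xi> C) (ren \<xi> z) (ren \<xi> s) (ren \<xi> n)"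
| "ren \<xi> (Trunc A) = Trunc (ren \<xi> A)"
| "ren \<xi> (TrI a) = TrI (ren \<xi> a)"
| "ren \<xi> (TrP s t) = TrP (ren \<xi> s) (ren \<xi> t)"
| "ren \<xi> (TrE h f t) = TrE (ren \<xi> h) (ren \<xi> f) (ren \<xi> t)"
| "ren \<xi> (FunExt h) = FunExt (ren \<xi> h)"
| "ren \<xi> (PropExt h k f g) = PropExt (ren \<xi> h) (ren \<xi> k) (ren \<xi> f) (ren \<xi> g)"

abbreviation wk :: "tm \<Rightarrow> tm" where
  "wk \<equiv> ren Suc"

definition ups :: "(nat \<Rightarrow> tm) \<Rightarrow> nat \<Rightarrow> tm" where
  "ups \<sigma> = case_nat (Var 0) (\<lambda>n. wk (\<sigma> n))"

primrec sub :: "(nat \<Rightarrow> tm) \<Rightarrow> tm \<Rightarrow> tm" where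
  "sub \<sigma> (Var n) = \<sigma> n"
| "sub \<sigma> (Univ i) = Univ i"
| "sub \<sigma> (Pi A B) = Pi (sub \<sigma> A) (sub (ups \<sigma>) B)"
| "sub \<sigma> (Lam A b) = Lam (sub \<sigma> A) (sub (ups \<sigma>) b)"
| "sub \<sigma> (App f a) = App (sub \<sigma> f) (sub \<sigma> a)"
| "sub \<sigma> (Sig A B) = Sig (sub \<sigma> A) (sub (ups \<sigma>) B)"
| "sub \<sigma> (Pr a b) = Pr (sub \<sigma> a) (sub \<sigma> b)"
| "sub \<sigma> (Fst p) = Fst (sub \<sigma> p)"
| "sub \<sigma> (Snd p) = Snd (sub \<sigma> p)"
| "sub \<sigma> (Eq A a b) = Eq (sub \<sigma> A) (sub \<sigma> a) (sub \<sigma> b)"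
| "sub \<sigma> (Refl a) = Refl (sub \<sigma> a)"
| "sub \<sigma> (J C c p) = J (sub \<sigma> C) (sub \<sigma> c) (sub \<sigma> p)"
| "sub \<sigma> Empty = Empty"
| "sub \<sigma> (EmptyE C e) = EmptyE (sub \<sigma> C) (sub \<sigma> e)"
| "sub \<sigma> One = One"
| "sub \<sigma> Star = Star"
| "sub \<sigma> (OneE C c t) = OneE (sub \<sigma> C) (sub \<sigma> c) (sub \<sigma> t)"
| "sub \<sigma> Two = Two"
| "sub \<sigma> B0 = B0"
| "sub \<sigma> B1 = B1"
| "sub \<sigma> (TwoE C c d t) = TwoE (sub \<sigma> C) (sub \<sigma> c) (sub \<sigma> d) (sub \<sigma> t)"
| "sub \<sigma> (Plus A B) = Plus (sub \<sigma> A) (sub \<sigma> B)"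
| "sub \<sigma> (InL a) = InL (sub \<sigma> a)"
| "sub \<sigma> (InR a) = InR (sub \<sigma> a)"
| "sub \<sigma> (PlusE C l r t) = PlusE (sub \<sigma> C) (sub \<sigma> l) (sub \<sigma> r) (sub \<sigma> t)"
| "sub \<sigma> NN = NN"
| "sub \<sigma> Zero = Zero"
| "sub \<sigma> (Succ n) = Succ (sub \<sigma> n)"
| "sub \<sigma> (NatE C z s n) = NatE (sub \<sigma> C) (sub \<sigma> z) (sub \<sigma> s) (sub \<sigma> n)"
| "sub \<sigma> (Trunc A) = Trunc (sub \<sigma> A)"
| "sub \<sigma> (TrI a) = TrI (sub \<sigma> a)"
| "sub \<sigma> (TrP s t) = TrP (sub \<sigma> s) (sub \<sigma> t)"
| "sub \<sigma> (TrE h f t) = TrE (sub \<sigma> h) (sub \<sigma> f) (sub \<sigma> t)"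
| "sub \<sigma> (FunExt h) = FunExt (sub \<sigma> h)"
| "sub \<sigma> (PropExt h k f g) = PropExt (sub \<sigma> h) (sub \<sigma> k) (sub \<sigma> f) (sub \<sigma> g)"

definition inst :: "tm \<Rightarrow> tm \<Rightarrow> tm" where
  "inst b a = sub (case_nat a Var) b"

definition arrow :: "tm \<Rightarrow> tm \<Rightarrow> tm" where
  "arrow A B = Pi A (wk B)"

definition times :: "tm \<Rightarrow> tm \<Rightarrow> tm" where
  "times A B = Sig A (wk B)"

definition isProp :: "tm \<Rightarrow> tm" where
  "isProp A = Pi A (Pi (wk A) (Eq (wk (wk A)) (Var 1) (Var 0)))"

section \<open>Intensional type theory\<close>

text \<open>
  Contexts are lists with the most recent variable first. Universes are cumulative and
  \<open>\<Gamma> \<turnstile> A \<Colon> Univ i\<close> for some \<open>i\<close> is the judgement that \<open>A\<close> is a type. The truncation recursor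
  has no computation rule, and function and proposition extensionality are constants without
  computation rules.
\<close>

inductive
  is_ctx :: "tm list \<Rightarrow> bool" and
  has_type :: "tm list \<Rightarrow> tm \<Rightarrow> tm \<Rightarrow> bool" ("(_ \<turnstile> _ \<Colon> _)" [51, 51, 51] 50) and
  def_eq :: "tm list \<Rightarrow> tm \<Rightarrow> tm \<Rightarrow> tm \<Rightarrow> bool" ("(_ \<turnstile> _ \<doteq> _ \<Colon> _)" [51, 51, 51, 51] 50)
where
  ctx_nil: "is_ctx []"
| ctx_cons: "\<Gamma> \<turnstile> A \<Colon> Univ i \<Longrightarrow> is_ctx (A # \<Gamma>)"

| t_var: "is_ctx \<Gamma> \<Longrightarrow> n < length \<Gamma> \<Longrightarrow> \<Gamma> \<turnstile> Var n \<Colon> ren (\<lambda>k. k + Suc n) (\<Gamma> ! n)"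
| t_conv: "\<Gamma> \<turnstile> t \<Colon> A \<Longrightarrow> \<Gamma> \<turnstile> A \<doteq> B \<Colon> Univ i \<Longrightarrow> \<Gamma> \<turnstile> t \<Colon> B"

| t_univ: "is_ctx \<Gamma> \<Longrightarrow> \<Gamma> \<turnstile> Univ i \<Colon> Univ (Suc i)"
| t_cumul: "\<Gamma> \<turnstile> A \<Colon> Univ i \<Longrightarrow> \<Gamma> \<turnstile> A \<Colon> Univ (Suc i)"

| t_pi: "\<Gamma> \<turnstile> A \<Colon> Univ i \<Longrightarrow> A # \<Gamma> \<turnstile> B \<Colon> Univ i \<Longrightarrow> \<Gamma> \<turnstile> Pi A B \<Colon> Univ i"
| t_lam: "\<Gamma> \<turnstile> A \<Colon> Univ i \<Longrightarrow> A # \<Gamma> \<turnstile> b \<Colon> B \<Longrightarrow> \<Gamma> \<turnstile> Lam A b \<Colon> Pi A B"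
| t_app: "\<Gamma> \<turnstile> f \<Colon> Pi A B \<Longrightarrow> \<Gamma> \<turnstile> a \<Colon> A \<Longrightarrow> \<Gamma> \<turnstile> App f a \<Colon> inst B a"

| t_sig: "\<Gamma> \<turnstile> A \<Colon> Univ i \<Longrightarrow> A # \<Gamma> \<turnstile> B \<Colon> Univ i \<Longrightarrow> \<Gamma> \<turnstile> Sig A B \<Colon> Univ i"
| t_pr: "A # \<Gamma> \<turnstile> B \<Colon> Univ i \<Longrightarrow> \<Gamma> \<turnstile> a \<Colon> A \<Longrightarrow> \<Gamma> \<turnstile> b \<Colon> inst B a \<Longrightarrow> \<Gamma> \<turnstile> Pr a b \<Colon> Sig A B"
| t_fst: "\<Gamma> \<turnstile> p \<Colon> Sig A B \<Longrightarrow> \<Gamma> \<turnstile> Fst p \<Colon> A"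
| t_snd: "\<Gamma> \<turnstile> p \<Colon> Sig A B \<Longrightarrow> \<Gamma> \<turnstile> Snd p \<Colon> inst B (Fst p)"

| t_eq: "\<Gamma> \<turnstile> A \<Colon> Univ i \<Longrightarrow> \<Gamma> \<turnstile> a \<Colon> A \<Longrightarrow> \<Gamma> \<turnstile> b \<Colon> A \<Longrightarrow> \<Gamma> \<turnstile> Eq A a b \<Colon> Univ i"
| t_refl: "\<Gamma> \<turnstile> a \<Colon> A \<Longrightarrow> \<Gamma> \<turnstile> Refl a \<Colon> Eq A a a"
| t_J: "\<Gamma> \<turnstile> C \<Colon> Pi A (Pi (Eq (wk A) (wk a) (Var 0)) (Univ i)) \<Longrightarrow>
    \<Gamma> \<turnstile> a \<Colon> A \<Longrightarrow> \<Gamma> \<turnstile> b \<Colon> A \<Longrightarrow>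
    \<Gamma> \<turnstile> c \<Colon> App (App C a) (Refl a) \<Longrightarrow> \<Gamma> \<turnstile> p \<Colon> Eq A a b \<Longrightarrow>
    \<Gamma> \<turnstile> J C c p \<Colon> App (App C b) p"

| t_empty: "is_ctx \<Gamma> \<Longrightarrow> \<Gamma> \<turnstile> Empty \<Colon> Univ 0"
| t_emptyE: "\<Gamma> \<turnstile> C \<Colon> Pi Empty (Univ i) \<Longrightarrow> \<Gamma> \<turnstile> e \<Colon> Empty \<Longrightarrow> \<Gamma> \<turnstile> EmptyE C e \<Colon> App C e"

| t_one: "is_ctx \<Gamma> \<Longrightarrow> \<Gamma> \<turnstile> One \<Colon> Univ 0"
| t_star: "is_ctx \<Gamma> \<Longrightarrow> \<Gamma> \<turnstile> Star \<Colon> One"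
| t_oneE: "\<Gamma> \<turnstile> C \<Colon> Pi One (Univ i) \<Longrightarrow> \<Gamma> \<turnstile> c \<Colon> App C Star \<Longrightarrow> \<Gamma> \<turnstile> t \<Colon> One \<Longrightarrow>
    \<Gamma> \<turnstile> OneE C c t \<Colon> App C t"

| t_two: "is_ctx \<Gamma> \<Longrightarrow> \<Gamma> \<turnstile> Two \<Colon> Univ 0"
| t_b0: "is_ctx \<Gamma> \<Longrightarrow> \<Gamma> \<turnstile> B0 \<Colon> Two"
| t_b1: "is_ctx \<Gamma> \<Longrightarrow> \<Gamma> \<turnstile> B1 \<Colon> Two"
| t_twoE: "\<Gamma> \<turnstile> C \<Colon> Pi Two (Univ i) \<Longrightarrow> \<Gamma> \<turnstile> c \<Colon> App C B0 \<Longrightarrow> \<Gamma> \<turnstile> d \<Colon> App C B1 \<Longrightarrow>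
    \<Gamma> \<turnstile> t \<Colon> Two \<Longrightarrow> \<Gamma> \<turnstile> TwoE C c d t \<Colon> App C t"

| t_plus: "\<Gamma> \<turnstile> A \<Colon> Univ i \<Longrightarrow> \<Gamma> \<turnstile> B \<Colon> Univ i \<Longrightarrow> \<Gamma> \<turnstile> Plus A B \<Colon> Univ i"
| t_inl: "\<Gamma> \<turnstile> B \<Colon> Univ i \<Longrightarrow> \<Gamma> \<turnstile> a \<Colon> A \<Longrightarrow> \<Gamma> \<turnstile> InL a \<Colon> Plus A B"
| t_inr: "\<Gamma> \<turnstile> A \<Colon> Univ i \<Longrightarrow> \<Gamma> \<turnstile> b \<Colon> B \<Longrightarrow> \<Gamma> \<turnstile> InR b \<Colon> Plus A B"
| t_plusE: "\<Gamma> \<turnstile> C \<Colon> Pi (Plus A B) (Univ i) \<Longrightarrow>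
    \<Gamma> \<turnstile> l \<Colon> Pi A (App (wk C) (InL (Var 0))) \<Longrightarrow>
    \<Gamma> \<turnstile> r \<Colon> Pi B (App (wk C) (InR (Var 0))) \<Longrightarrow>
    \<Gamma> \<turnstile> t \<Colon> Plus A B \<Longrightarrow> \<Gamma> \<turnstile> PlusE C l r t \<Colon> App C t"

| t_nat: "is_ctx \<Gamma> \<Longrightarrow> \<Gamma> \<turnstile> NN \<Colon> Univ 0"
| t_zero: "is_ctx \<Gamma> \<Longrightarrow> \<Gamma> \<turnstile> Zero \<Colon> NN"
| t_succ: "\<Gamma> \<turnstile> n \<Colon> NN \<Longrightarrow> \<Gamma> \<turnstile> Succ n \<Colon> NN"
| t_natE: "\<Gamma> \<turnstile> C \<Colon> Pi NN (Univ i) \<Longrightarrow> \<Gamma> \<turnstile> z \<Colon> App C Zero \<Longrightarrow>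
    \<Gamma> \<turnstile> s \<Colon> Pi NN (Pi (App (wk C) (Var 0)) (App (wk (wk C)) (Succ (Var 1)))) \<Longrightarrow>
    \<Gamma> \<turnstile> n \<Colon> NN \<Longrightarrow> \<Gamma> \<turnstile> NatE C z s n \<Colon> App C n"

| t_trunc: "\<Gamma> \<turnstile> A \<Colon> Univ i \<Longrightarrow> \<Gamma> \<turnstile> Trunc A \<Colon> Univ i"
| t_trI: "\<Gamma> \<turnstile> a \<Colon> A \<Longrightarrow> \<Gamma> \<turnstile> TrI a \<Colon> Trunc A"
| t_trP: "\<Gamma> \<turnstile> s \<Colon> Trunc A \<Longrightarrow> \<Gamma> \<turnstile> t \<Colon> Trunc A \<Longrightarrow> \<Gamma> \<turnstile> TrP s t \<Colon> Eq (Trunc A) s t"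
| t_trE: "\<Gamma> \<turnstile> P \<Colon> Univ i \<Longrightarrow> \<Gamma> \<turnstile> h \<Colon> isProp P \<Longrightarrow> \<Gamma> \<turnstile> f \<Colon> arrow A P \<Longrightarrow>
    \<Gamma> \<turnstile> t \<Colon> Trunc A \<Longrightarrow> \<Gamma> \<turnstile> TrE h f t \<Colon> P"

| t_funext: "\<Gamma> \<turnstile> f \<Colon> Pi A B \<Longrightarrow> \<Gamma> \<turnstile> g \<Colon> Pi A B \<Longrightarrow>
    \<Gamma> \<turnstile> h \<Colon> Pi A (Eq B (App (wk f) (Var 0)) (App (wk g) (Var 0))) \<Longrightarrow>
    \<Gamma> \<turnstile> FunExt h \<Colon> Eq (Pi A B) f g"
| t_propext: "\<Gamma> \<turnstile> P \<Colon> Univ i \<Longrightarrow> \<Gamma> \<turnstile> Q \<Colon> Univ i \<Longrightarrow>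
    \<Gamma> \<turnstile> h \<Colon> isProp P \<Longrightarrow> \<Gamma> \<turnstile> k \<Colon> isProp Q \<Longrightarrow>
    \<Gamma> \<turnstile> f \<Colon> arrow P Q \<Longrightarrow> \<Gamma> \<turnstile> g \<Colon> arrow Q P \<Longrightarrow>
    \<Gamma> \<turnstile> PropExt h k f g \<Colon> Eq (Univ i) P Q"

| e_refl: "\<Gamma> \<turnstile> t \<Colon> A \<Longrightarrow> \<Gamma> \<turnstile> t \<doteq> t \<Colon> A"
| e_sym: "\<Gamma> \<turnstile> t \<doteq> u \<Colon> A \<Longrightarrow> \<Gamma> \<turnstile> u \<doteq> t \<Colon> A"
| e_trans: "\<Gamma> \<turnstile> t \<doteq> u \<Colon> A \<Longrightarrow> \<Gamma> \<turnstile> u \<doteq> v \<Colon> A \<Longrightarrow> \<Gamma> \<turnstile> t \<doteq> v \<Colon> A"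
| e_conv: "\<Gamma> \<turnstile> t \<doteq> u \<Colon> A \<Longrightarrow> \<Gamma> \<turnstile> A \<doteq> B \<Colon> Univ i \<Longrightarrow> \<Gamma> \<turnstile> t \<doteq> u \<Colon> B"
| e_cumul: "\<Gamma> \<turnstile> A \<doteq> B \<Colon> Univ i \<Longrightarrow> \<Gamma> \<turnstile> A \<doteq> B \<Colon> Univ (Suc i)"

| beta_pi: "\<Gamma> \<turnstile> A \<Colon> Univ i \<Longrightarrow> A # \<Gamma> \<turnstile> b \<Colon> B \<Longrightarrow> \<Gamma> \<turnstile> a \<Colon> A \<Longrightarrow>
    \<Gamma> \<turnstile> App (Lam A b) a \<doteq> inst b a \<Colon> inst B a"
| eta_pi: "\<Gamma> \<turnstile> f \<Colon> Pi A B \<Longrightarrow> \<Gamma> \<turnstile> f \<doteq> Lam A (App (wk f) (Var 0)) \<Colon> Pi A B"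
| beta_fst: "A # \<Gamma> \<turnstile> B \<Colon> Univ i \<Longrightarrow> \<Gamma> \<turnstile> a \<Colon> A \<Longrightarrow> \<Gamma> \<turnstile> b \<Colon> inst B a \<Longrightarrow>
    \<Gamma> \<turnstile> Fst (Pr a b) \<doteq> a \<Colon> A"
| beta_snd: "A # \<Gamma> \<turnstile> B \<Colon> Univ i \<Longrightarrow> \<Gamma> \<turnstile> a \<Colon> A \<Longrightarrow> \<Gamma> \<turnstile> b \<Colon> inst B a \<Longrightarrow>
    \<Gamma> \<turnstile> Snd (Pr a b) \<doteq> b \<Colon> inst B a"
| eta_sig: "\<Gamma> \<turnstile> p \<Colon> Sig A B \<Longrightarrow> \<Gamma> \<turnstile> p \<doteq> Pr (Fst p) (Snd p) \<Colon> Sig A B"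
| beta_J: "\<Gamma> \<turnstile> C \<Colon> Pi A (Pi (Eq (wk A) (wk a) (Var 0)) (Univ i)) \<Longrightarrow>
    \<Gamma> \<turnstile> a \<Colon> A \<Longrightarrow> \<Gamma> \<turnstile> c \<Colon> App (App C a) (Refl a) \<Longrightarrow>
    \<Gamma> \<turnstile> J C c (Refl a) \<doteq> c \<Colon> App (App C a) (Refl a)"
| beta_one: "\<Gamma> \<turnstile> C \<Colon> Pi One (Univ i) \<Longrightarrow> \<Gamma> \<turnstile> c \<Colon> App C Star \<Longrightarrow>
    \<Gamma> \<turnstile> OneE C c Star \<doteq> c \<Colon> App C Star"
| beta_two0: "\<Gamma> \<turnstile> C \<Colon> Pi Two (Univ i) \<Longrightarrow> \<Gamma> \<turnstile> c \<Colon> App C B0 \<Longrightarrow> \<Gamma> \<turnstile> d \<Colon> App C B1 \<Longrightarrow>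
    \<Gamma> \<turnstile> TwoE C c d B0 \<doteq> c \<Colon> App C B0"
| beta_two1: "\<Gamma> \<turnstile> C \<Colon> Pi Two (Univ i) \<Longrightarrow> \<Gamma> \<turnstile> c \<Colon> App C B0 \<Longrightarrow> \<Gamma> \<turnstile> d \<Colon> App C B1 \<Longrightarrow>
    \<Gamma> \<turnstile> TwoE C c d B1 \<doteq> d \<Colon> App C B1"
| beta_inl: "\<Gamma> \<turnstile> C \<Colon> Pi (Plus A B) (Univ i) \<Longrightarrow>
    \<Gamma> \<turnstile> l \<Colon> Pi A (App (wk C) (InL (Var 0))) \<Longrightarrow>
    \<Gamma> \<turnstile> r \<Colon> Pi B (App (wk C) (InR (Var 0))) \<Longrightarrow>
    \<Gamma> \<turnstile> a \<Colon> A \<Longrightarrow> \<Gamma> \<turnstile> PlusE C l r (InL a) \<doteq> App l a \<Colon> App C (InL a)"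
| beta_inr: "\<Gamma> \<turnstile> C \<Colon> Pi (Plus A B) (Univ i) \<Longrightarrow>
    \<Gamma> \<turnstile> l \<Colon> Pi A (App (wk C) (InL (Var 0))) \<Longrightarrow>
    \<Gamma> \<turnstile> r \<Colon> Pi B (App (wk C) (InR (Var 0))) \<Longrightarrow>
    \<Gamma> \<turnstile> b \<Colon> B \<Longrightarrow> \<Gamma> \<turnstile> PlusE C l r (InR b) \<doteq> App r b \<Colon> App C (InR b)"
| beta_zero: "\<Gamma> \<turnstile> C \<Colon> Pi NN (Univ i) \<Longrightarrow> \<Gamma> \<turnstile> z \<Colon> App C Zero \<Longrightarrow>
    \<Gamma> \<turnstile> s \<Colon> Pi NN (Pi (App (wk C) (Var 0)) (App (wk (wk C)) (Succ (Var 1)))) \<Longrightarrow>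
    \<Gamma> \<turnstile> NatE C z s Zero \<doteq> z \<Colon> App C Zero"
| beta_succ: "\<Gamma> \<turnstile> C \<Colon> Pi NN (Univ i) \<Longrightarrow> \<Gamma> \<turnstile> z \<Colon> App C Zero \<Longrightarrow>
    \<Gamma> \<turnstile> s \<Colon> Pi NN (Pi (App (wk C) (Var 0)) (App (wk (wk C)) (Succ (Var 1)))) \<Longrightarrow>
    \<Gamma> \<turnstile> n \<Colon> NN \<Longrightarrow>
    \<Gamma> \<turnstile> NatE C z s (Succ n) \<doteq> App (App s n) (NatE C z s n) \<Colon> App C (Succ n)"

| c_pi: "\<Gamma> \<turnstile> A \<Colon> Univ i \<Longrightarrow> \<Gamma> \<turnstile> A \<doteq> A' \<Colon> Univ i \<Longrightarrow> A # \<Gamma> \<turnstile> B \<doteq> B' \<Colon> Univ i \<Longrightarrow>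
    \<Gamma> \<turnstile> Pi A B \<doteq> Pi A' B' \<Colon> Univ i"
| c_lam: "\<Gamma> \<turnstile> A \<Colon> Univ i \<Longrightarrow> \<Gamma> \<turnstile> A \<doteq> A' \<Colon> Univ i \<Longrightarrow> A # \<Gamma> \<turnstile> b \<doteq> b' \<Colon> B \<Longrightarrow>
    \<Gamma> \<turnstile> Lam A b \<doteq> Lam A' b' \<Colon> Pi A B"
| c_app: "\<Gamma> \<turnstile> f \<doteq> f' \<Colon> Pi A B \<Longrightarrow> \<Gamma> \<turnstile> a \<doteq> a' \<Colon> A \<Longrightarrow> \<Gamma> \<turnstile> App f a \<doteq> App f' a' \<Colon> inst B a"
| c_sig: "\<Gamma> \<turnstile> A \<Colon> Univ i \<Longrightarrow> \<Gamma> \<turnstile> A \<doteq> A' \<Colon> Univ i \<Longrightarrow> A # \<Gamma> \<turnstile> B \<doteq> B' \<Colon> Univ i \<Longrightarrow>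
    \<Gamma> \<turnstile> Sig A B \<doteq> Sig A' B' \<Colon> Univ i"
| c_pr: "A # \<Gamma> \<turnstile> B \<Colon> Univ i \<Longrightarrow> \<Gamma> \<turnstile> a \<doteq> a' \<Colon> A \<Longrightarrow> \<Gamma> \<turnstile> b \<doteq> b' \<Colon> inst B a \<Longrightarrow>
    \<Gamma> \<turnstile> Pr a b \<doteq> Pr a' b' \<Colon> Sig A B"
| c_fst: "\<Gamma> \<turnstile> p \<doteq> p' \<Colon> Sig A B \<Longrightarrow> \<Gamma> \<turnstile> Fst p \<doteq> Fst p' \<Colon> A"
| c_snd: "\<Gamma> \<turnstile> p \<doteq> p' \<Colon> Sig A B \<Longrightarrow> \<Gamma> \<turnstile> Snd p \<doteq> Snd p' \<Colon> inst B (Fst p)"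
| c_eq: "\<Gamma> \<turnstile> A \<doteq> A' \<Colon> Univ i \<Longrightarrow> \<Gamma> \<turnstile> a \<doteq> a' \<Colon> A \<Longrightarrow> \<Gamma> \<turnstile> b \<doteq> b' \<Colon> A \<Longrightarrow>
    \<Gamma> \<turnstile> Eq A a b \<doteq> Eq A' a' b' \<Colon> Univ i"
| c_refl: "\<Gamma> \<turnstile> a \<doteq> a' \<Colon> A \<Longrightarrow> \<Gamma> \<turnstile> Refl a \<doteq> Refl a' \<Colon> Eq A a a"
| c_J: "\<Gamma> \<turnstile> C \<doteq> C' \<Colon> Pi A (Pi (Eq (wk A) (wk a) (Var 0)) (Univ i)) \<Longrightarrow>
    \<Gamma> \<turnstile> a \<Colon> A \<Longrightarrow> \<Gamma> \<turnstile> b \<Colon> A \<Longrightarrow>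
    \<Gamma> \<turnstile> c \<doteq> c' \<Colon> App (App C a) (Refl a) \<Longrightarrow> \<Gamma> \<turnstile> p \<doteq> p' \<Colon> Eq A a b \<Longrightarrow>
    \<Gamma> \<turnstile> J C c p \<doteq> J C' c' p' \<Colon> App (App C b) p"
| c_emptyE: "\<Gamma> \<turnstile> C \<doteq> C' \<Colon> Pi Empty (Univ i) \<Longrightarrow> \<Gamma> \<turnstile> e \<doteq> e' \<Colon> Empty \<Longrightarrow>
    \<Gamma> \<turnstile> EmptyE C e \<doteq> EmptyE C' e' \<Colon> App C e"
| c_oneE: "\<Gamma> \<turnstile> C \<doteq> C' \<Colon> Pi One (Univ i) \<Longrightarrow> \<Gamma> \<turnstile> c \<doteq> c' \<Colon> App C Star \<Longrightarrow>
    \<Gamma> \<turnstile> t \<doteq> t' \<Colon> One \<Longrightarrow> \<Gamma> \<turnstile> OneE C c t \<doteq> OneE C' c' t' \<Colon> App C t"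
| c_twoE: "\<Gamma> \<turnstile> C \<doteq> C' \<Colon> Pi Two (Univ i) \<Longrightarrow> \<Gamma> \<turnstile> c \<doteq> c' \<Colon> App C B0 \<Longrightarrow>
    \<Gamma> \<turnstile> d \<doteq> d' \<Colon> App C B1 \<Longrightarrow> \<Gamma> \<turnstile> t \<doteq> t' \<Colon> Two \<Longrightarrow>
    \<Gamma> \<turnstile> TwoE C c d t \<doteq> TwoE C' c' d' t' \<Colon> App C t"
| c_plus: "\<Gamma> \<turnstile> A \<doteq> A' \<Colon> Univ i \<Longrightarrow> \<Gamma> \<turnstile> B \<doteq> B' \<Colon> Univ i \<Longrightarrow>
    \<Gamma> \<turnstile> Plus A B \<doteq> Plus A' B' \<Colon> Univ i"
| c_inl: "\<Gamma> \<turnstile> B \<Colon> Univ i \<Longrightarrow> \<Gamma> \<turnstile> a \<doteq> a' \<Colon> A \<Longrightarrow> \<Gamma> \<turnstile> InL a \<doteq> InL a' \<Colon> Plus A B"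
| c_inr: "\<Gamma> \<turnstile> A \<Colon> Univ i \<Longrightarrow> \<Gamma> \<turnstile> b \<doteq> b' \<Colon> B \<Longrightarrow> \<Gamma> \<turnstile> InR b \<doteq> InR b' \<Colon> Plus A B"
| c_plusE: "\<Gamma> \<turnstile> C \<doteq> C' \<Colon> Pi (Plus A B) (Univ i) \<Longrightarrow>
    \<Gamma> \<turnstile> l \<doteq> l' \<Colon> Pi A (App (wk C) (InL (Var 0))) \<Longrightarrow>
    \<Gamma> \<turnstile> r \<doteq> r' \<Colon> Pi B (App (wk C) (InR (Var 0))) \<Longrightarrow>
    \<Gamma> \<turnstile> t \<doteq> t' \<Colon> Plus A B \<Longrightarrow> \<Gamma> \<turnstile> PlusE C l r t \<doteq> PlusE C' l' r' t' \<Colon> App C t"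
| c_succ: "\<Gamma> \<turnstile> n \<doteq> n' \<Colon> NN \<Longrightarrow> \<Gamma> \<turnstile> Succ n \<doteq> Succ n' \<Colon> NN"
| c_natE: "\<Gamma> \<turnstile> C \<doteq> C' \<Colon> Pi NN (Univ i) \<Longrightarrow> \<Gamma> \<turnstile> z \<doteq> z' \<Colon> App C Zero \<Longrightarrow>
    \<Gamma> \<turnstile> s \<doteq> s' \<Colon> Pi NN (Pi (App (wk C) (Var 0)) (App (wk (wk C)) (Succ (Var 1)))) \<Longrightarrow>
    \<Gamma> \<turnstile> n \<doteq> n' \<Colon> NN \<Longrightarrow> \<Gamma> \<turnstile> NatE C z s n \<doteq> NatE C' z' s' n' \<Colon> App C n"
| c_trunc: "\<Gamma> \<turnstile> A \<doteq> A' \<Colon> Univ i \<Longrightarrow> \<Gamma> \<turnstile> Trunc A \<doteq> Trunc A' \<Colon> Univ i"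
| c_trI: "\<Gamma> \<turnstile> a \<doteq> a' \<Colon> A \<Longrightarrow> \<Gamma> \<turnstile> TrI a \<doteq> TrI a' \<Colon> Trunc A"
| c_trP: "\<Gamma> \<turnstile> s \<doteq> s' \<Colon> Trunc A \<Longrightarrow> \<Gamma> \<turnstile> t \<doteq> t' \<Colon> Trunc A \<Longrightarrow>
    \<Gamma> \<turnstile> TrP s t \<doteq> TrP s' t' \<Colon> Eq (Trunc A) s t"
| c_trE: "\<Gamma> \<turnstile> P \<Colon> Univ i \<Longrightarrow> \<Gamma> \<turnstile> h \<doteq> h' \<Colon> isProp P \<Longrightarrow> \<Gamma> \<turnstile> f \<doteq> f' \<Colon> arrow A P \<Longrightarrow>
    \<Gamma> \<turnstile> t \<doteq> t' \<Colon> Trunc A \<Longrightarrow> \<Gamma> \<turnstile> TrE h f t \<doteq> TrE h' f' t' \<Colon> P"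
| c_funext: "\<Gamma> \<turnstile> f \<Colon> Pi A B \<Longrightarrow> \<Gamma> \<turnstile> g \<Colon> Pi A B \<Longrightarrow>
    \<Gamma> \<turnstile> h \<doteq> h' \<Colon> Pi A (Eq B (App (wk f) (Var 0)) (App (wk g) (Var 0))) \<Longrightarrow>
    \<Gamma> \<turnstile> FunExt h \<doteq> FunExt h' \<Colon> Eq (Pi A B) f g"
| c_propext: "\<Gamma> \<turnstile> P \<Colon> Univ i \<Longrightarrow> \<Gamma> \<turnstile> Q \<Colon> Univ i \<Longrightarrow>
    \<Gamma> \<turnstile> h \<doteq> h' \<Colon> isProp P \<Longrightarrow> \<Gamma> \<turnstile> k \<doteq> k' \<Colon> isProp Q \<Longrightarrow>
    \<Gamma> \<turnstile> f \<doteq> f' \<Colon> arrow P Q \<Longrightarrow> \<Gamma> \<turnstile> g \<doteq> g' \<Colon> arrow Q P \<Longrightarrow>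
    \<Gamma> \<turnstile> PropExt h k f g \<doteq> PropExt h' k' f' g' \<Colon> Eq (Univ i) P Q"

definition inhabited :: "tm \<Rightarrow> bool" where
  "inhabited A \<longleftrightarrow> (\<exists>t. [] \<turnstile> t \<Colon> A)"

definition logEquiv :: "tm \<Rightarrow> tm \<Rightarrow> tm" where
  "logEquiv A B = times (arrow A B) (arrow B A)"

section \<open>Rosolini propositions and dominances\<close>

definition occ :: "tm \<Rightarrow> tm"  ("\<langle>_\<rangle>") where
  "\<langle>\<alpha>\<rangle> = Sig NN (Eq Two (App (wk \<alpha>) (Var 0)) B1)"

definition Ninf :: tm where
  "Ninf = Sig (arrow NN Two) (isProp \<langle>Var 0\<rangle>)"

text \<open>
  The identity type \<open>P = \<langle>u\<rangle>\<close> is formed in the universe \<open>Univ i\<close>, hence it, and with it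
  \<open>isRosolini i\<close>, takes values in \<open>Univ (Suc i)\<close>.
\<close>

definition rosoliniStructure :: "nat \<Rightarrow> tm \<Rightarrow> tm" where
  "rosoliniStructure i P = Sig Ninf (Eq (Univ i) (wk P) \<langle>Fst (Var 0)\<rangle>)"

definition isRosolini :: "nat \<Rightarrow> tm" where
  "isRosolini i = Lam (Univ i) (Trunc (rosoliniStructure i (Var 0)))"

definition rosoliniChoice :: "nat \<Rightarrow> tm" where
  "rosoliniChoice i =
    (let P = Var 1; Q = Var 0 in
     Pi (Univ i) (Pi (Univ i)
       (arrow (App (isRosolini i) P)
         (arrow (arrow P (Trunc (rosoliniStructure i Q)))
           (Trunc (arrow P (rosoliniStructure i Q)))))))"

text \<open>Here \<open>d\<close> is a family \<open>Univ i \<rightarrow> Univ j\<close>, for an arbitrary level \<open>j\<close>.\<close>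

definition isDominance :: "nat \<Rightarrow> tm \<Rightarrow> tm" where
  "isDominance i d =
    times (Pi (Univ i) (isProp (App (wk d) (Var 0))))
   (times (Pi (Univ i) (arrow (App (wk d) (Var 0)) (isProp (Var 0))))
   (times (App d One)
     (let P = Var 1; Q = Var 0; d' = wk (wk d) in
      Pi (Univ i) (Pi (Univ i)
        (arrow (App d' P) (arrow (arrow P (App d' Q)) (App d' (times P Q))))))))"

end

theory Submission
  imports Defs "HOL-Library.Monad_Syntax"
begin

text \<open>
  Dominance implies choice: if \<open>P \<times> Q = \<langle>u\<rangle>\<close> then, given \<open>p : P\<close>, the same \<open>u\<close> is a structure on the
  proposition \<open>Q\<close>; this maps structures on \<open>P \<times> Q\<close> to functions from \<open>P\<close> to structures on \<open>Q\<close>.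
  Choice implies dominance: the point is closure under products. Choice turns the hypothesis on
  \<open>Q\<close> into a function \<open>g\<close> from \<open>P = \<langle>\<alpha>\<rangle>\<close> to structures on \<open>Q\<close>. Join \<open>\<alpha>\<close> and \<open>g\<close> into the sequence
  that is \<open>0\<close> up to the \<open>1\<close> of \<open>\<alpha>\<close> and then runs through the sequence that \<open>g\<close> provides there. It
  has at most one \<open>1\<close>, and it has one if and only if \<open>P \<times> Q\<close> holds.

  The proof terms are accepted by a type checker for the object theory that is proved sound and is
  evaluated by the simplifier. It never relies on injectivity of \<open>Pi\<close> or on preservation of types
  under reduction: along with the type of a term it computes a reduct, and a reduct of a type is
  used only after it has been checked again.
\<close>

section \<open>Substitution preserves typing\<close>

text \<open>Choice is needed because a structure on \<open>Q\<close> is data: a truncation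
  eliminates only into propositions, and a binary sequence is not one, so structures that merely
  exist cannot be joined. The family \<open>g\<close> can be asked for a value only with a proof of
  \<open>\<alpha> n = 1\<close> at hand, and whether such an \<open>n\<close> exists is undecidable.
  The joined sequence is therefore a bounded search: entry \<open>k\<close> started at
  \<open>n\<close> tests \<open>\<alpha> n\<close>; at a 1 it is entry \<open>k\<close> of the
  sequence of \<open>g\<close> there, at a 0 it is 0 if \<open>k\<close> is zero and otherwise entry
  \<open>k - 1\<close> started at \<open>n + 1\<close>. Started at zero, it has its 1 at the sum of
  the position in \<open>\<alpha>\<close> and the position in the sequence of \<open>g\<close>, so
  no 1 is lost. On the formal side, injectivity of \<open>Pi\<close> up to conversion is usually
  obtained from confluence or a logical relation. The checker gets by with the injectivity of
  \<open>Pi\<close> as a datatype constructor, at the price of rejecting some typable terms.\<close>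

lemma upr_simps [simp]: "upr \<xi> 0 = 0" "upr \<xi> (Suc n) = Suc (\<xi> n)"
  by (simp_all add: upr_def)

lemma ups_simps [simp]: "ups \<sigma> 0 = Var 0" "ups \<sigma> (Suc n) = wk (\<sigma> n)"
  by (simp_all add: ups_def)

lemma upr_comp: "upr \<xi> \<circ> upr \<zeta> = upr (\<xi> \<circ> \<zeta>)"
  by (rule ext) (simp add: upr_def split: nat.split)

lemma ren_ren: "ren \<xi> (ren \<zeta> t) = ren (\<xi> \<circ> \<zeta>) t"
  by (induction t arbitrary: \<xi> \<zeta>) (simp_all add: upr_comp)

lemma ups_upr: "ups \<sigma> \<circ> upr \<xi> = ups (\<sigma> \<circ> \<xi>)"
  by (rule ext) (simp add: upr_def ups_def split: nat.split)

lemma sub_ren: "sub \<sigma> (ren \<xi> t) = sub (\<sigma> \<circ> \<xi>) t"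
  by (induction t arbitrary: \<sigma> \<xi>) (simp_all add: ups_upr)

lemma ren_upr_ups: "ren (upr \<xi>) \<circ> ups \<sigma> = ups (ren \<xi> \<circ> \<sigma>)"
  by (rule ext) (simp add: upr_def ups_def ren_ren comp_def split: nat.split)

lemma ren_sub: "ren \<xi> (sub \<sigma> t) = sub (ren \<xi> \<circ> \<sigma>) t"
  by (induction t arbitrary: \<sigma> \<xi>) (simp_all add: ren_upr_ups)

lemma sub_ups_ups: "sub (ups \<sigma>) \<circ> ups \<tau> = ups (sub \<sigma> \<circ> \<tau>)"
  by (rule ext) (simp add: ups_def sub_ren ren_sub comp_def split: nat.split)

lemma sub_sub: "sub \<sigma> (sub \<tau> t) = sub (sub \<sigma> \<circ> \<tau>) t"
  by (induction t arbitrary: \<sigma> \<tau>) (simp_all add: sub_ups_ups)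

lemma ups_Var: "ups Var = Var"
  by (rule ext) (simp add: ups_def split: nat.split)

lemma sub_Var: "sub Var t = t"
  by (induction t) (simp_all add: ups_Var)

lemma ups_Var_comp: "ups (Var \<circ> \<xi>) = Var \<circ> upr \<xi>"
  by (rule ext) (simp add: ups_def upr_def split: nat.split)

lemma ren_eq_sub: "ren \<xi> t = sub (Var \<circ> \<xi>) t"
  by (induction t arbitrary: \<xi>) (simp_all add: ups_Var_comp)

lemma sub_ups_wk: "sub (ups \<sigma>) (wk t) = wk (sub \<sigma> t)"
  by (simp add: sub_ren ren_sub comp_def)

lemma sub_inst: "sub \<sigma> (inst b a) = inst (sub (ups \<sigma>) b) (sub \<sigma> a)"
proof -
  have "sub \<sigma> \<circ> case_nat a Var = sub (case_nat (sub \<sigma> a) Var) \<circ> ups \<sigma>"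
    by (rule ext) (simp add: ups_def sub_ren comp_def sub_Var split: nat.split)
  then show ?thesis
    by (simp add: inst_def sub_sub)
qed

lemma inst_wk: "inst (wk t) a = t"
  by (simp add: inst_def sub_ren comp_def sub_Var)

lemma inst_ren_upr_Var: "inst (ren (upr Suc) t) (Var 0) = t"
proof -
  have "case_nat (Var 0) Var \<circ> upr Suc = Var"
    by (rule ext) (simp add: upr_def split: nat.split)
  then show ?thesis
    by (simp add: inst_def sub_ren sub_Var)
qed

lemma sub_arrow: "sub \<sigma> (arrow A B) = arrow (sub \<sigma> A) (sub \<sigma> B)"
  by (simp add: arrow_def sub_ups_wk)

text \<open>\<open>Var 1\<close> occurs below two binders in \<open>isProp\<close> and in the step
  type of \<open>NatE\<close>. The literal 1 is kept unexpanded so that this equation matches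
  there.\<close>

lemma ups_ups_1: "ups (ups \<sigma>) 1 = Var 1"
  by (simp add: ups_def)

lemma sub_isProp: "sub \<sigma> (isProp A) = isProp (sub \<sigma> A)"
  by (simp add: isProp_def sub_ups_wk ups_ups_1 del: One_nat_def)

lemmas sub_simps = sub_ups_wk sub_inst sub_arrow sub_isProp ups_ups_1

text \<open>The renaming lemma and the substitution lemma are two instances of one induction: a class of
  substitutions that is stable under going below a binder.\<close>

locale stable_class =
  fixes OK :: "tm list \<Rightarrow> (nat \<Rightarrow> tm) \<Rightarrow> tm list \<Rightarrow> bool"
  assumes ctx: "OK \<Delta> \<sigma> \<Gamma> \<Longrightarrow> is_ctx \<Delta>"
    and var: "OK \<Delta> \<sigma> \<Gamma> \<Longrightarrow> n < length \<Gamma> \<Longrightarrow> \<Delta> \<turnstile> \<sigma> n \<Colon> sub \<sigma> (ren (\<lambda>k. k + Suc n) (\<Gamma> ! n))"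
    and up: "OK \<Delta> \<sigma> \<Gamma> \<Longrightarrow> \<Delta> \<turnstile> sub \<sigma> A \<Colon> Univ i \<Longrightarrow> OK (sub \<sigma> A # \<Delta>) (ups \<sigma>) (A # \<Gamma>)"
begin

text \<open>The pair rules have a premise below a binder of type \<open>A\<close> but none saying
  that \<open>A\<close> is a type. That \<open>A\<close> stays a type under substitution must then
  come from the context of the premise, so the induction carries this fact for the head of the
  context.\<close>

definition cx :: "tm list \<Rightarrow> bool" where
  "cx \<Gamma> \<longleftrightarrow> (case \<Gamma> of [] \<Rightarrow> True | A # \<Gamma>' \<Rightarrow> \<forall>\<Delta> \<sigma>. OK \<Delta> \<sigma> \<Gamma>' \<longrightarrow> (\<exists>i. \<Delta> \<turnstile> sub \<sigma> A \<Colon> Univ i))"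

text \<open>The last conjunct is the shape in which a rule consumes a premise below a binder. By
  \<open>cx_tail\<close> it follows from the other two; stating it separately lets the cases apply
  their rule directly.\<close>

definition ty where
  "ty \<Gamma> t T \<longleftrightarrow> cx \<Gamma> \<and> (\<forall>\<Delta> \<sigma>. OK \<Delta> \<sigma> \<Gamma> \<longrightarrow> \<Delta> \<turnstile> sub \<sigma> t \<Colon> sub \<sigma> T) \<and>
    (\<forall>A \<Gamma>'. \<Gamma> = A # \<Gamma>' \<longrightarrow> (\<forall>\<Delta> \<sigma>. OK \<Delta> \<sigma> \<Gamma>' \<longrightarrow>
      sub \<sigma> A # \<Delta> \<turnstile> sub (ups \<sigma>) t \<Colon> sub (ups \<sigma>) T))"

definition te where
  "te \<Gamma> t u T \<longleftrightarrow> cx \<Gamma> \<and> (\<forall>\<Delta> \<sigma>. OK \<Delta> \<sigma> \<Gamma> \<longrightarrow> \<Delta> \<turnstile> sub \<sigma> t \<doteq> sub \<sigma> u \<Colon> sub \<sigma> T) \<and>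
    (\<forall>A \<Gamma>'. \<Gamma> = A # \<Gamma>' \<longrightarrow> (\<forall>\<Delta> \<sigma>. OK \<Delta> \<sigma> \<Gamma>' \<longrightarrow>
      sub \<sigma> A # \<Delta> \<turnstile> sub (ups \<sigma>) t \<doteq> sub (ups \<sigma>) u \<Colon> sub (ups \<sigma>) T))"

lemma cx_tail: "cx (A # \<Gamma>) \<Longrightarrow> OK \<Delta> \<sigma> \<Gamma> \<Longrightarrow> OK (sub \<sigma> A # \<Delta>) (ups \<sigma>) (A # \<Gamma>)"
  by (auto simp: cx_def intro: up)

lemma tyI: "cx \<Gamma> \<Longrightarrow> (\<And>\<Delta> \<sigma>. OK \<Delta> \<sigma> \<Gamma> \<Longrightarrow> \<Delta> \<turnstile> sub \<sigma> t \<Colon> sub \<sigma> T) \<Longrightarrow> ty \<Gamma> t T"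
  and teI: "cx \<Gamma> \<Longrightarrow> (\<And>\<Delta> \<sigma>. OK \<Delta> \<sigma> \<Gamma> \<Longrightarrow> \<Delta> \<turnstile> sub \<sigma> t \<doteq> sub \<sigma> u \<Colon> sub \<sigma> T) \<Longrightarrow> te \<Gamma> t u T"
  by (auto simp: ty_def te_def cx_tail)

text \<open>Every rule is closed under substitution because the operations on types in its
  conclusion commute with \<open>sub\<close>. Only the variable rule consults the class of
  substitutions itself.\<close>

theorem preserves:
  shows "is_ctx \<Gamma> \<Longrightarrow> cx \<Gamma>"
    and "\<Gamma> \<turnstile> t \<Colon> T \<Longrightarrow> ty \<Gamma> t T"
    and "\<Gamma> \<turnstile> t \<doteq> u \<Colon> T \<Longrightarrow> te \<Gamma> t u T"
  supply ty_def [simp] te_def [simp] sub_simps [simp] ctx [simp] One_nat_def [simp del] tyI [intro!] teI [intro!]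
proof (induction rule: is_ctx_has_type_def_eq.inducts)
  case ctx_nil then show ?case by (simp add: cx_def)
next
  case ctx_cons then show ?case by (auto simp: cx_def)
next
  case t_var then show ?case by (simp add: tyI var del: ty_def add_Suc_right)
next
  case t_conv then show ?case by (fastforce intro: is_ctx_has_type_def_eq.t_conv)
next
  case t_univ then show ?case by (fastforce intro: is_ctx_has_type_def_eq.t_univ)
next
  case t_cumul then show ?case by (fastforce intro: is_ctx_has_type_def_eq.t_cumul)
next
  case t_pi then show ?case by (fastforce intro: is_ctx_has_type_def_eq.t_pi)
next
  case t_lam then show ?case by (fastforce intro: is_ctx_has_type_def_eq.t_lam)
next
  case t_app then show ?case by (fastforce intro: is_ctx_has_type_def_eq.t_app)
next
  case t_sig then show ?case by (fastforce intro: is_ctx_has_type_def_eq.t_sig)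
next
  case t_pr then show ?case by (fastforce intro: is_ctx_has_type_def_eq.t_pr)
next
  case t_fst then show ?case by (fastforce intro: is_ctx_has_type_def_eq.t_fst)
next
  case t_snd then show ?case by (fastforce intro: is_ctx_has_type_def_eq.t_snd)
next
  case t_eq then show ?case by (fastforce intro: is_ctx_has_type_def_eq.t_eq)
next
  case t_refl then show ?case by (fastforce intro: is_ctx_has_type_def_eq.t_refl)
next
  case t_J then show ?case by (fastforce intro: is_ctx_has_type_def_eq.t_J)
next
  case t_empty then show ?case by (fastforce intro: is_ctx_has_type_def_eq.t_empty)
next
  case t_emptyE then show ?case by (fastforce intro: is_ctx_has_type_def_eq.t_emptyE)
next
  case t_one then show ?case by (fastforce intro: is_ctx_has_type_def_eq.t_one)
next
  case t_star then show ?case by (fastforce intro: is_ctx_has_type_def_eq.t_star)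
next
  case t_oneE then show ?case by (fastforce intro: is_ctx_has_type_def_eq.t_oneE)
next
  case t_two then show ?case by (fastforce intro: is_ctx_has_type_def_eq.t_two)
next
  case t_b0 then show ?case by (fastforce intro: is_ctx_has_type_def_eq.t_b0)
next
  case t_b1 then show ?case by (fastforce intro: is_ctx_has_type_def_eq.t_b1)
next
  case t_twoE then show ?case by (fastforce intro: is_ctx_has_type_def_eq.t_twoE)
next
  case t_plus then show ?case by (fastforce intro: is_ctx_has_type_def_eq.t_plus)
next
  case t_inl then show ?case by (fastforce intro: is_ctx_has_type_def_eq.t_inl)
next
  case t_inr then show ?case by (fastforce intro: is_ctx_has_type_def_eq.t_inr)
next
  case t_plusE then show ?case by (fastforce intro: is_ctx_has_type_def_eq.t_plusE)
next
  case t_nat then show ?case by (fastforce intro: is_ctx_has_type_def_eq.t_nat)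
next
  case t_zero then show ?case by (fastforce intro: is_ctx_has_type_def_eq.t_zero)
next
  case t_succ then show ?case by (fastforce intro: is_ctx_has_type_def_eq.t_succ)
next
  case t_natE then show ?case by (fastforce intro: is_ctx_has_type_def_eq.t_natE)
next
  case t_trunc then show ?case by (fastforce intro: is_ctx_has_type_def_eq.t_trunc)
next
  case t_trI then show ?case by (fastforce intro: is_ctx_has_type_def_eq.t_trI)
next
  case t_trP then show ?case by (fastforce intro: is_ctx_has_type_def_eq.t_trP)
next
  case t_trE then show ?case by (fastforce intro: is_ctx_has_type_def_eq.t_trE)
next
  case t_funext then show ?case by (fastforce intro: is_ctx_has_type_def_eq.t_funext)
next
  case t_propext then show ?case by (fastforce intro: is_ctx_has_type_def_eq.t_propext)
next
  case e_refl then show ?case by (fastforce intro: is_ctx_has_type_def_eq.e_refl)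
next
  case e_sym then show ?case by (fastforce intro: is_ctx_has_type_def_eq.e_sym)
next
  case e_trans then show ?case by (fastforce intro: is_ctx_has_type_def_eq.e_trans)
next
  case e_conv then show ?case by (fastforce intro: is_ctx_has_type_def_eq.e_conv)
next
  case e_cumul then show ?case by (fastforce intro: is_ctx_has_type_def_eq.e_cumul)
next
  case beta_pi then show ?case by (fastforce intro: is_ctx_has_type_def_eq.beta_pi)
next
  case eta_pi then show ?case by (fastforce intro: is_ctx_has_type_def_eq.eta_pi)
next
  case beta_fst then show ?case by (fastforce intro: is_ctx_has_type_def_eq.beta_fst)
next
  case beta_snd then show ?case by (fastforce intro: is_ctx_has_type_def_eq.beta_snd)
next
  case eta_sig then show ?case by (fastforce intro: is_ctx_has_type_def_eq.eta_sig)
next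
  case beta_J then show ?case by (fastforce intro: is_ctx_has_type_def_eq.beta_J)
next
  case beta_one then show ?case by (fastforce intro: is_ctx_has_type_def_eq.beta_one)
next
  case beta_two0 then show ?case by (fastforce intro: is_ctx_has_type_def_eq.beta_two0)
next
  case beta_two1 then show ?case by (fastforce intro: is_ctx_has_type_def_eq.beta_two1)
next
  case beta_inl then show ?case by (fastforce intro: is_ctx_has_type_def_eq.beta_inl)
next
  case beta_inr then show ?case by (fastforce intro: is_ctx_has_type_def_eq.beta_inr)
next
  case beta_zero then show ?case by (fastforce intro: is_ctx_has_type_def_eq.beta_zero)
next
  case beta_succ then show ?case by (fastforce intro: is_ctx_has_type_def_eq.beta_succ)
next
  case c_pi then show ?case by (fastforce intro: is_ctx_has_type_def_eq.c_pi)
next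
  case c_lam then show ?case by (fastforce intro: is_ctx_has_type_def_eq.c_lam)
next
  case c_app then show ?case by (fastforce intro: is_ctx_has_type_def_eq.c_app)
next
  case c_sig then show ?case by (fastforce intro: is_ctx_has_type_def_eq.c_sig)
next
  case c_pr then show ?case by (fastforce intro: is_ctx_has_type_def_eq.c_pr)
next
  case c_fst then show ?case by (fastforce intro: is_ctx_has_type_def_eq.c_fst)
next
  case c_snd then show ?case by (fastforce intro: is_ctx_has_type_def_eq.c_snd)
next
  case c_eq then show ?case by (fastforce intro: is_ctx_has_type_def_eq.c_eq)
next
  case c_refl then show ?case by (fastforce intro: is_ctx_has_type_def_eq.c_refl)
next
  case c_J then show ?case by (fastforce intro: is_ctx_has_type_def_eq.c_J)
next
  case c_emptyE then show ?case by (fastforce intro: is_ctx_has_type_def_eq.c_emptyE)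
next
  case c_oneE then show ?case by (fastforce intro: is_ctx_has_type_def_eq.c_oneE)
next
  case c_twoE then show ?case by (fastforce intro: is_ctx_has_type_def_eq.c_twoE)
next
  case c_plus then show ?case by (fastforce intro: is_ctx_has_type_def_eq.c_plus)
next
  case c_inl then show ?case by (fastforce intro: is_ctx_has_type_def_eq.c_inl)
next
  case c_inr then show ?case by (fastforce intro: is_ctx_has_type_def_eq.c_inr)
next
  case c_plusE then show ?case by (fastforce intro: is_ctx_has_type_def_eq.c_plusE)
next
  case c_succ then show ?case by (fastforce intro: is_ctx_has_type_def_eq.c_succ)
next
  case c_natE then show ?case by (fastforce intro: is_ctx_has_type_def_eq.c_natE)
next
  case c_trunc then show ?case by (fastforce intro: is_ctx_has_type_def_eq.c_trunc)
next
  case c_trI then show ?case by (fastforce intro: is_ctx_has_type_def_eq.c_trI)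
next
  case c_trP then show ?case by (fastforce intro: is_ctx_has_type_def_eq.c_trP)
next
  case c_trE then show ?case by (fastforce intro: is_ctx_has_type_def_eq.c_trE)
next
  case c_funext then show ?case by (fastforce intro: is_ctx_has_type_def_eq.c_funext)
next
  case c_propext then show ?case by (fastforce intro: is_ctx_has_type_def_eq.c_propext)
qed

lemma preserves_ty: "\<Gamma> \<turnstile> t \<Colon> T \<Longrightarrow> OK \<Delta> \<sigma> \<Gamma> \<Longrightarrow> \<Delta> \<turnstile> sub \<sigma> t \<Colon> sub \<sigma> T"
  using preserves(2) by (simp add: ty_def)

end

section \<open>Weakening, substitution and inversion for typing\<close>

lemma judgement_ctx: "\<Gamma> \<turnstile> t \<Colon> T \<Longrightarrow> is_ctx \<Gamma>" and "\<Gamma> \<turnstile> t \<doteq> u \<Colon> T \<Longrightarrow> is_ctx \<Gamma>"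
  by (induction rule: is_ctx_has_type_def_eq.inducts(2-3)[where ?P1.0 = "\<lambda>_. True"]) auto

text \<open>Renamings have to come before substitutions: pushing a substitution below a binder
  weakens its values, and that step is already an instance of renaming.\<close>

interpretation ren: stable_class "\<lambda>\<Delta> \<sigma> \<Gamma>. is_ctx \<Delta> \<and> (\<exists>\<xi>. \<sigma> = Var \<circ> \<xi> \<and> (\<forall>n<length \<Gamma>. \<xi> n < length \<Delta> \<and>
    ren (\<lambda>k. k + Suc (\<xi> n)) (\<Delta> ! \<xi> n) = ren \<xi> (ren (\<lambda>k. k + Suc n) (\<Gamma> ! n))))"
proof (standard, goal_cases)
  case (1 \<Delta> \<sigma> \<Gamma>)
  then show ?case by simp
next
  case (2 \<Delta> \<sigma> \<Gamma> n)
  then obtain \<xi> where \<xi>: "\<sigma> = Var \<circ> \<xi>" "\<xi> n < length \<Delta>" "is_ctx \<Delta>"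
      "ren (\<lambda>k. k + Suc (\<xi> n)) (\<Delta> ! \<xi> n) = ren \<xi> (ren (\<lambda>k. k + Suc n) (\<Gamma> ! n))"
    by blast
  have "\<Delta> \<turnstile> Var (\<xi> n) \<Colon> ren \<xi> (ren (\<lambda>k. k + Suc n) (\<Gamma> ! n))"
    using t_var[OF \<xi>(3,2)] unfolding \<xi>(4) .
  then show ?case
    by (simp add: \<xi>(1) ren_eq_sub[symmetric] del: add_Suc_right)
next
  case (3 \<Delta> \<sigma> \<Gamma> A i)
  then obtain \<xi> where \<xi>: "\<sigma> = Var \<circ> \<xi>" "\<And>n. n < length \<Gamma> \<Longrightarrow> \<xi> n < length \<Delta> \<and>
      ren (\<lambda>k. k + Suc (\<xi> n)) (\<Delta> ! \<xi> n) = ren \<xi> (ren (\<lambda>k. k + Suc n) (\<Gamma> ! n))"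
    by blast
  have "ren (\<lambda>k. k + Suc (upr \<xi> n)) ((sub \<sigma> A # \<Delta>) ! upr \<xi> n) =
      ren (upr \<xi>) (ren (\<lambda>k. k + Suc n) ((A # \<Gamma>) ! n))" if "n < length (A # \<Gamma>)" for n
  proof (cases n)
    case 0
    then show ?thesis by (simp add: \<xi>(1) ren_eq_sub sub_sub comp_def)
  next
    case (Suc m)
    then have "ren (\<lambda>k. k + Suc (\<xi> m)) (\<Delta> ! \<xi> m) = ren \<xi> (ren (\<lambda>k. k + Suc m) (\<Gamma> ! m))"
      using \<xi>(2) that by simp
    from arg_cong[where f = wk, OF this] show ?thesis
      by (simp add: Suc ren_ren comp_def)
  qed
  moreover have "upr \<xi> n < length (sub \<sigma> A # \<Delta>)" if "n < length (A # \<Gamma>)" for n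
    using that \<xi>(2) by (cases n) auto
  ultimately show ?case
    using 3 by (intro conjI exI[of _ "upr \<xi>"] allI impI)
      (auto simp: \<xi>(1) ups_Var_comp simp del: length_Cons intro: ctx_cons)
qed

lemma wk_OK:
  assumes "\<Gamma> \<turnstile> A \<Colon> Univ i"
  shows "is_ctx (A # \<Gamma>) \<and> (\<exists>\<xi>. Var \<circ> Suc = Var \<circ> \<xi> \<and> (\<forall>n<length \<Gamma>. \<xi> n < length (A # \<Gamma>) \<and>
    ren (\<lambda>k. k + Suc (\<xi> n)) ((A # \<Gamma>) ! \<xi> n) = ren \<xi> (ren (\<lambda>k. k + Suc n) (\<Gamma> ! n))))"
  using assms by (intro conjI exI[of _ Suc]) (auto simp: ren_ren comp_def intro: ctx_cons)

lemma weakening: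
  assumes "\<Gamma> \<turnstile> A \<Colon> Univ i"
  shows "\<Gamma> \<turnstile> t \<Colon> T \<Longrightarrow> A # \<Gamma> \<turnstile> wk t \<Colon> wk T"
  using ren.preserves_ty[OF _ wk_OK[OF assms]] unfolding ren_eq_sub .

lemma weakening_upr:
  assumes "\<Gamma> \<turnstile> A \<Colon> Univ i" "\<Gamma> \<turnstile> B \<Colon> Univ j" "B # \<Gamma> \<turnstile> t \<Colon> T"
  shows "wk B # A # \<Gamma> \<turnstile> ren (upr Suc) t \<Colon> ren (upr Suc) T"
proof -
  have "A # \<Gamma> \<turnstile> sub (Var \<circ> Suc) B \<Colon> Univ j"
    using weakening[OF assms(1,2)] by (simp add: ren_eq_sub)
  from ren.preserves_ty[OF assms(3) ren.up[OF wk_OK[OF assms(1)] this]] show ?thesis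
    by (simp only: ren_eq_sub ups_Var_comp)
qed

interpretation subst: stable_class "\<lambda>\<Delta> \<sigma> \<Gamma>. is_ctx \<Delta> \<and>
    (\<forall>n<length \<Gamma>. \<Delta> \<turnstile> \<sigma> n \<Colon> sub \<sigma> (ren (\<lambda>k. k + Suc n) (\<Gamma> ! n)))"
proof (standard, goal_cases)
  case (1 \<Delta> \<sigma> \<Gamma>)
  then show ?case by simp
next
  case (2 \<Delta> \<sigma> \<Gamma> n)
  then show ?case by blast
next
  case (3 \<Delta> \<sigma> \<Gamma> A i)
  then have c: "is_ctx (sub \<sigma> A # \<Delta>)" by (blast intro: ctx_cons)
  have "sub \<sigma> A # \<Delta> \<turnstile> ups \<sigma> n \<Colon> sub (ups \<sigma>) (ren (\<lambda>k. k + Suc n) ((A # \<Gamma>) ! n))"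
    if "n < length (A # \<Gamma>)" for n
  proof (cases n)
    case 0
    have "sub \<sigma> A # \<Delta> \<turnstile> Var 0 \<Colon> wk (sub \<sigma> A)"
      using t_var[OF c, of 0] by simp
    then show ?thesis by (simp add: 0 sub_ups_wk)
  next
    case (Suc m)
    then have "\<Delta> \<turnstile> \<sigma> m \<Colon> sub \<sigma> (ren (\<lambda>k. k + Suc m) (\<Gamma> ! m))"
      using 3 that by simp
    then have "sub \<sigma> A # \<Delta> \<turnstile> wk (\<sigma> m) \<Colon> sub (ups \<sigma>) (wk (ren (\<lambda>k. k + Suc m) (\<Gamma> ! m)))"
      unfolding sub_ups_wk by (rule weakening[OF 3(2)])
    then show ?thesis by (simp add: Suc ren_ren comp_def)
  qed
  with c show ?case by blast
qed

lemma inst_OK: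
  assumes "\<Gamma> \<turnstile> a \<Colon> A" "n < length (A # \<Gamma>)"
  shows "\<Gamma> \<turnstile> case_nat a Var n \<Colon> sub (case_nat a Var) (ren (\<lambda>k. k + Suc n) ((A # \<Gamma>) ! n))"
proof (cases n)
  case 0
  then show ?thesis using assms(1) inst_wk[of A a] by (simp add: inst_def)
next
  case (Suc m)
  have "sub (case_nat a Var) (ren (\<lambda>k. k + Suc n) B) = ren (\<lambda>k. k + Suc m) B" for B
    by (simp add: Suc sub_ren comp_def ren_eq_sub[of "\<lambda>k. Suc (k + m)"])
  then show ?thesis
    using assms t_var[OF judgement_ctx, of \<Gamma> a A m] by (simp add: Suc)
qed

lemma t_inst: "A # \<Gamma> \<turnstile> b \<Colon> B \<Longrightarrow> \<Gamma> \<turnstile> a \<Colon> A \<Longrightarrow> \<Gamma> \<turnstile> inst b a \<Colon> inst B a"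
  unfolding inst_def by (rule subst.preserves_ty) (use inst_OK judgement_ctx in blast)+

text \<open>Serves the motive of \<open>J\<close>, which has two variables: the outer one, the
  endpoint, is replaced below the inner one, the path.\<close>

lemma t_inst_ups:
  assumes "Q # A # \<Gamma> \<turnstile> b \<Colon> B" "\<Gamma> \<turnstile> a \<Colon> A" "\<Gamma> \<turnstile> inst Q a \<Colon> Univ i"
  shows "inst Q a # \<Gamma> \<turnstile> sub (ups (case_nat a Var)) b \<Colon> sub (ups (case_nat a Var)) B"
  using assms(3) unfolding inst_def
  by (intro subst.preserves_ty[OF assms(1) subst.up[where i = i]])
    (use assms(2) inst_OK judgement_ctx in blast)+

text \<open>Only conclusions that do not mention the type \<open>T\<close> are recorded. Conversion
  and cumulativity change nothing but \<open>T\<close>, so these conclusions pass through them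
  unchanged.\<close>

lemma inversion:
  "\<Gamma> \<turnstile> t \<Colon> T \<Longrightarrow> (case t of
      Pi A B \<Rightarrow> \<exists>i. \<Gamma> \<turnstile> A \<Colon> Univ i \<and> A # \<Gamma> \<turnstile> B \<Colon> Univ i
    | Sig A B \<Rightarrow> \<exists>i. \<Gamma> \<turnstile> A \<Colon> Univ i \<and> A # \<Gamma> \<turnstile> B \<Colon> Univ i
    | Eq A a b \<Rightarrow> \<exists>i. \<Gamma> \<turnstile> A \<Colon> Univ i \<and> \<Gamma> \<turnstile> a \<Colon> A \<and> \<Gamma> \<turnstile> b \<Colon> A
    | Trunc A \<Rightarrow> \<exists>i. \<Gamma> \<turnstile> A \<Colon> Univ i
    | Succ n \<Rightarrow> \<Gamma> \<turnstile> n \<Colon> NN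
    | _ \<Rightarrow> True)" and "\<Gamma> \<turnstile> t \<doteq> u \<Colon> T \<Longrightarrow> True"
  by (induction rule: is_ctx_has_type_def_eq.inducts(2-3)[where ?P1.0 = "\<lambda>_. True"]) auto

lemmas inv_Pi = inversion(1)[of _ "Pi _ _", simplified]
  and inv_Sig = inversion(1)[of _ "Sig _ _", simplified]
  and inv_Eq = inversion(1)[of _ "Eq _ _ _", simplified]
  and inv_Trunc = inversion(1)[of _ "Trunc _", simplified]
  and inv_Succ = inversion(1)[of _ "Succ _", simplified]

lemma cumul:
  assumes "i \<le> j"
  shows "\<Gamma> \<turnstile> A \<Colon> Univ i \<Longrightarrow> \<Gamma> \<turnstile> A \<Colon> Univ j" and "\<Gamma> \<turnstile> A \<doteq> B \<Colon> Univ i \<Longrightarrow> \<Gamma> \<turnstile> A \<doteq> B \<Colon> Univ j"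
  using assms by (induction rule: dec_induct) (auto intro: t_cumul e_cumul)

section \<open>A type checker\<close>

fun as_univ :: "tm \<Rightarrow> nat option" where
  "as_univ (Univ i) = Some i"
| "as_univ _ = None"

fun as_pi :: "tm \<Rightarrow> (tm \<times> tm) option" where
  "as_pi (Pi A B) = Some (A, B)"
| "as_pi _ = None"

fun as_sig :: "tm \<Rightarrow> (tm \<times> tm) option" where
  "as_sig (Sig A B) = Some (A, B)"
| "as_sig _ = None"

fun as_eq :: "tm \<Rightarrow> (tm \<times> tm \<times> tm) option" where
  "as_eq (Eq A a b) = Some (A, a, b)"
| "as_eq _ = None"

fun as_trunc :: "tm \<Rightarrow> tm option" where
  "as_trunc (Trunc A) = Some A"
| "as_trunc _ = None"

fun as_lam :: "tm \<Rightarrow> (tm \<times> tm) option" where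
  "as_lam (Lam A b) = Some (A, b)"
| "as_lam _ = None"

fun as_pr :: "tm \<Rightarrow> (tm \<times> tm) option" where
  "as_pr (Pr a b) = Some (a, b)"
| "as_pr _ = None"

fun as_succ :: "tm \<Rightarrow> tm option" where
  "as_succ (Succ n) = Some n"
| "as_succ _ = None"

type_synonym normalizer = "tm list \<Rightarrow> tm \<Rightarrow> tm option"

definition subty :: "tm \<Rightarrow> tm \<Rightarrow> bool" where
  "subty T U \<longleftrightarrow> T = U \<or> (case as_univ T of None \<Rightarrow> False | Some a \<Rightarrow>
     (case as_univ U of None \<Rightarrow> False | Some b \<Rightarrow> a \<le> b))"

text \<open>Literal comparison precedes normalization because the simplifier evaluates this function
  and normalizing is the expensive part.\<close>

definition fit :: "normalizer \<Rightarrow> tm list \<Rightarrow> tm \<Rightarrow> tm \<Rightarrow> tm option \<Rightarrow> (tm \<times> tm) option" where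
  "fit N \<Gamma> t T E = (case E of None \<Rightarrow> Some (t, T) | Some U \<Rightarrow>
     if subty T U then Some (t, U)
     else do { T' \<leftarrow> N \<Gamma> T; U' \<leftarrow> N \<Gamma> U; if subty T' U' then Some (t, U) else None })"

text \<open>A type that already has the wanted shape is returned untouched. The contraction of
  literal redexes is sound because of this: the type inferred for an abstraction or a pair is then
  the one that gets decomposed.\<close>

definition expose :: "(tm \<Rightarrow> 'a option) \<Rightarrow> normalizer \<Rightarrow> tm list \<Rightarrow> tm \<Rightarrow> 'a option" where
  "expose d N \<Gamma> T = (case d T of Some r \<Rightarrow> Some r | None \<Rightarrow> N \<Gamma> T \<bind> d)"

definition motive :: "tm \<Rightarrow> tm \<Rightarrow> tm \<Rightarrow> tm option" where
  "motive A C K = do { (A', D) \<leftarrow> as_lam C; (A'', V) \<leftarrow> as_pi K; _ \<leftarrow> as_univ V;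
     if A'' = A then Some D else None }"

text \<open>Given an expected type \<open>E\<close>, if any, \<open>elab N t \<Gamma> E\<close> returns a reduct of \<open>t\<close> and a type of \<open>t\<close>,
  which is the expected one. \<open>N\<close> normalizes types. Motives must be literal abstractions.\<close>

primrec elab :: "normalizer \<Rightarrow> tm \<Rightarrow> tm list \<Rightarrow> tm option \<Rightarrow> (tm \<times> tm) option" where
  "elab N (Var n) \<Gamma> E =
    (if n < length \<Gamma> then fit N \<Gamma> (Var n) (ren (\<lambda>k. k + Suc n) (\<Gamma> ! n)) E else None)"
| "elab N (Univ i) \<Gamma> E = fit N \<Gamma> (Univ i) (Univ (Suc i)) E"
| "elab N (Pi A B) \<Gamma> E = do {
    (A', U) \<leftarrow> elab N A \<Gamma> None; a \<leftarrow> expose as_univ N \<Gamma> U;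
    (B', V) \<leftarrow> elab N B (A # \<Gamma>) None; b \<leftarrow> expose as_univ N (A # \<Gamma>) V;
    fit N \<Gamma> (Pi A' B') (Univ (max a b)) E }"
| "elab N (Lam A b) \<Gamma> E = do {
    (A', U) \<leftarrow> elab N A \<Gamma> None; a \<leftarrow> expose as_univ N \<Gamma> U;
    (b', B) \<leftarrow> elab N b (A # \<Gamma>)
      (do { U \<leftarrow> E; (A2, B2) \<leftarrow> expose as_pi N \<Gamma> U; if A = A2 then Some B2 else None });
    fit N \<Gamma> (Lam A' b') (Pi A B) E }"
\<comment> \<open>A redex is contracted with the original \<open>b\<close> and \<open>a\<close>,
  whose typings are known. The reducts \<open>f'\<close> and \<open>a'\<close> come with an equation
  only.\<close>
| "elab N (App f a) \<Gamma> E = do {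
    (f', F) \<leftarrow> elab N f \<Gamma> None; (A, B) \<leftarrow> expose as_pi N \<Gamma> F; (a', _) \<leftarrow> elab N a \<Gamma> (Some A);
    fit N \<Gamma> (case as_lam f of None \<Rightarrow> App f' a' | Some (_, b) \<Rightarrow> inst b a) (inst B a) E }"
| "elab N (Sig A B) \<Gamma> E = do {
    (A', U) \<leftarrow> elab N A \<Gamma> None; a \<leftarrow> expose as_univ N \<Gamma> U;
    (B', V) \<leftarrow> elab N B (A # \<Gamma>) None; b \<leftarrow> expose as_univ N (A # \<Gamma>) V;
    fit N \<Gamma> (Sig A' B') (Univ (max a b)) E }"
\<comment> \<open>The dependency of the second type on the first component cannot be read off a
  pair, so without an expected type a non-dependent product is inferred.\<close>
| "elab N (Pr a b) \<Gamma> E = (case E of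
      None \<Rightarrow> do { (a', A) \<leftarrow> elab N a \<Gamma> None; (b', B) \<leftarrow> elab N b \<Gamma> None; Some (Pr a' b', Sig A (wk B)) }
    | Some U \<Rightarrow> do { (A, B) \<leftarrow> expose as_sig N \<Gamma> U; (a', _) \<leftarrow> elab N a \<Gamma> (Some A);
        (b', _) \<leftarrow> elab N b \<Gamma> (Some (inst B a)); fit N \<Gamma> (Pr a' b') (Sig A B) E })"
| "elab N (Fst p) \<Gamma> E = do {
    (p', S) \<leftarrow> elab N p \<Gamma> None; (A, B) \<leftarrow> expose as_sig N \<Gamma> S;
    fit N \<Gamma> (case as_pr p of None \<Rightarrow> Fst p' | Some (a, _) \<Rightarrow> a) A E }"
| "elab N (Snd p) \<Gamma> E = do {
    (p', S) \<leftarrow> elab N p \<Gamma> None; (A, B) \<leftarrow> expose as_sig N \<Gamma> S;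
    fit N \<Gamma> (case as_pr p of None \<Rightarrow> Snd p' | Some (_, b) \<Rightarrow> b) (inst B (Fst p)) E }"
| "elab N (Eq A a b) \<Gamma> E = do {
    (A', U) \<leftarrow> elab N A \<Gamma> None; i \<leftarrow> expose as_univ N \<Gamma> U;
    (a', _) \<leftarrow> elab N a \<Gamma> (Some A); (b', _) \<leftarrow> elab N b \<Gamma> (Some A);
    fit N \<Gamma> (Eq A' a' b') (Univ i) E }"
| "elab N (Refl a) \<Gamma> E = do {
    (a', A) \<leftarrow> elab N a \<Gamma> (do { U \<leftarrow> E; (A, _) \<leftarrow> expose as_eq N \<Gamma> U; Some A });
    fit N \<Gamma> (Refl a') (Eq A a a) E }"
| "elab N (J C c p) \<Gamma> E = do {
    (C', K) \<leftarrow> elab N C \<Gamma> None; (p', S) \<leftarrow> elab N p \<Gamma> None; (A, a, b) \<leftarrow> expose as_eq N \<Gamma> S;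
    (A1, C1) \<leftarrow> as_lam C; (A2, K1) \<leftarrow> as_pi K;
    D \<leftarrow> motive (Eq (wk A) (wk a) (Var 0)) C1 K1;
    _ \<leftarrow> (if A1 = A \<and> A2 = A then Some () else None);
    (c', _) \<leftarrow> elab N c \<Gamma> (Some (inst (sub (ups (case_nat a Var)) D) (Refl a)));
    fit N \<Gamma> (if p = Refl a \<and> b = a then c else J C c' p')
      (inst (sub (ups (case_nat b Var)) D) p) E }"
| "elab N Empty \<Gamma> E = fit N \<Gamma> Empty (Univ 0) E"
| "elab N (EmptyE C e) \<Gamma> E = do {
    (C', K) \<leftarrow> elab N C \<Gamma> None; D \<leftarrow> motive Empty C K; (e', _) \<leftarrow> elab N e \<Gamma> (Some Empty);
    fit N \<Gamma> (EmptyE C e) (inst D e) E }"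
| "elab N One \<Gamma> E = fit N \<Gamma> One (Univ 0) E"
| "elab N Star \<Gamma> E = fit N \<Gamma> Star One E"
| "elab N (OneE C c t) \<Gamma> E = do {
    (C', K) \<leftarrow> elab N C \<Gamma> None; D \<leftarrow> motive One C K; (c', _) \<leftarrow> elab N c \<Gamma> (Some (inst D Star));
    (t', _) \<leftarrow> elab N t \<Gamma> (Some One);
    fit N \<Gamma> (OneE C c t) (inst D t) E }"
| "elab N Two \<Gamma> E = fit N \<Gamma> Two (Univ 0) E"
| "elab N B0 \<Gamma> E = fit N \<Gamma> B0 Two E"
| "elab N B1 \<Gamma> E = fit N \<Gamma> B1 Two E"
| "elab N (TwoE C c d t) \<Gamma> E = do {
    (C', K) \<leftarrow> elab N C \<Gamma> None; D \<leftarrow> motive Two C K; (c', _) \<leftarrow> elab N c \<Gamma> (Some (inst D B0));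
    (d', _) \<leftarrow> elab N d \<Gamma> (Some (inst D B1)); (t', _) \<leftarrow> elab N t \<Gamma> (Some Two);
    fit N \<Gamma> (if t = B0 then c else if t = B1 then d else TwoE C c' d' t') (inst D t) E }"
| "elab N (Plus A B) \<Gamma> E = None"
| "elab N (InL a) \<Gamma> E = None"
| "elab N (InR a) \<Gamma> E = None"
| "elab N (PlusE C l r t) \<Gamma> E = None"
| "elab N NN \<Gamma> E = fit N \<Gamma> NN (Univ 0) E"
| "elab N Zero \<Gamma> E = fit N \<Gamma> Zero NN E"
| "elab N (Succ n) \<Gamma> E = do { (n', _) \<leftarrow> elab N n \<Gamma> (Some NN); fit N \<Gamma> (Succ n') NN E }"
\<comment> \<open>The type expected of \<open>s\<close> is the one in \<open>t_natE\<close> with the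
  motive already contracted: the variable of \<open>D\<close> becomes the successor of the number
  two binders out, and the other variables skip the induction hypothesis.\<close>
| "elab N (NatE C z s n) \<Gamma> E = do {
    (C', K) \<leftarrow> elab N C \<Gamma> None; D \<leftarrow> motive NN C K; (z', _) \<leftarrow> elab N z \<Gamma> (Some (inst D Zero));
    (s', _) \<leftarrow> elab N s \<Gamma> (Some (Pi NN (Pi D (sub (case_nat (Succ (Var 1)) (\<lambda>k. Var (k + 2))) D))));
    (n', _) \<leftarrow> elab N n \<Gamma> (Some NN);
    fit N \<Gamma> (if n = Zero then z else case as_succ n of
        Some m \<Rightarrow> App (App s m) (NatE C z s m) | None \<Rightarrow> NatE C z' s' n') (inst D n) E }"
| "elab N (Trunc A) \<Gamma> E = do {
    (A', U) \<leftarrow> elab N A \<Gamma> None; i \<leftarrow> expose as_univ N \<Gamma> U; fit N \<Gamma> (Trunc A') (Univ i) E }"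
| "elab N (TrI a) \<Gamma> E = do {
    (a', A) \<leftarrow> elab N a \<Gamma> (E \<bind> expose as_trunc N \<Gamma>); fit N \<Gamma> (TrI a) (Trunc A) E }"
| "elab N (TrP s t) \<Gamma> E = do {
    (s', S) \<leftarrow> elab N s \<Gamma> None; A \<leftarrow> expose as_trunc N \<Gamma> S; (t', _) \<leftarrow> elab N t \<Gamma> (Some (Trunc A));
    fit N \<Gamma> (TrP s t) (Eq (Trunc A) s t) E }"
| "elab N (TrE h f t) \<Gamma> E = do {
    P \<leftarrow> E; (h', _) \<leftarrow> elab N h \<Gamma> (Some (isProp P));
    (t', S) \<leftarrow> elab N t \<Gamma> None; A \<leftarrow> expose as_trunc N \<Gamma> S; (f', _) \<leftarrow> elab N f \<Gamma> (Some (arrow A P));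
    Some (TrE h f t, P) }"
| "elab N (FunExt h) \<Gamma> E = do {
    U \<leftarrow> E; (F, f, g) \<leftarrow> expose as_eq N \<Gamma> U; (A, B) \<leftarrow> as_pi F;
    (h', _) \<leftarrow> elab N h \<Gamma> (Some (Pi A (Eq B (App (wk f) (Var 0)) (App (wk g) (Var 0)))));
    fit N \<Gamma> (FunExt h) (Eq F f g) E }"
| "elab N (PropExt h k f g) \<Gamma> E = do {
    U \<leftarrow> E; (V, P, Q) \<leftarrow> expose as_eq N \<Gamma> U; i \<leftarrow> as_univ V;
    (h', _) \<leftarrow> elab N h \<Gamma> (Some (isProp P)); (k', _) \<leftarrow> elab N k \<Gamma> (Some (isProp Q));
    (f', _) \<leftarrow> elab N f \<Gamma> (Some (arrow P Q)); (g', _) \<leftarrow> elab N g \<Gamma> (Some (arrow Q P));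
    fit N \<Gamma> (PropExt h k f g) (Eq (Univ i) P Q) E }"

text \<open>One run of \<open>elab\<close> is a single pass of contractions, so passes are repeated
  until nothing changes, each reduct being checked anew by the next pass. The number is fuel: it
  bounds both the passes and the nesting of normalization inside checking, which makes the recursion
  primitive.\<close>

primrec nf :: "nat \<Rightarrow> tm list \<Rightarrow> tm \<Rightarrow> tm option" where
  "nf 0 \<Gamma> A = None"
| "nf (Suc n) \<Gamma> A = do { (A', U) \<leftarrow> elab (nf n) A \<Gamma> None; _ \<leftarrow> as_univ U;
     if A' = A then Some A else nf n \<Gamma> A' }"

definition checks :: "nat \<Rightarrow> tm \<Rightarrow> tm \<Rightarrow> bool" where
  "checks n t T \<longleftrightarrow> (case elab (nf n) T [] None of None \<Rightarrow> False | Some (_, U) \<Rightarrow>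
     as_univ U \<noteq> None \<and> elab (nf n) t [] (Some T) \<noteq> None)"

section \<open>Soundness of the type checker\<close>

definition is_type :: "tm list \<Rightarrow> tm \<Rightarrow> bool" where
  "is_type \<Gamma> T \<longleftrightarrow> (\<exists>i. \<Gamma> \<turnstile> T \<Colon> Univ i)"

definition conv :: "tm list \<Rightarrow> tm \<Rightarrow> tm \<Rightarrow> bool" where
  "conv \<Gamma> S T \<longleftrightarrow> (\<exists>i. \<Gamma> \<turnstile> S \<doteq> T \<Colon> Univ i)"

lemma conv_refl: "is_type \<Gamma> T \<Longrightarrow> conv \<Gamma> T T"
  by (auto simp: is_type_def conv_def intro: e_refl)

lemma conv_sym: "conv \<Gamma> S T \<Longrightarrow> conv \<Gamma> T S"
  by (auto simp: conv_def intro: e_sym)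

lemma conv_trans: "conv \<Gamma> S T \<Longrightarrow> conv \<Gamma> T U \<Longrightarrow> conv \<Gamma> S U"
  unfolding conv_def by (meson cumul(2) e_trans max.cobounded1 max.cobounded2)

lemma t_conv': "\<Gamma> \<turnstile> t \<Colon> S \<Longrightarrow> conv \<Gamma> S T \<Longrightarrow> \<Gamma> \<turnstile> t \<Colon> T"
  and e_conv': "\<Gamma> \<turnstile> t \<doteq> u \<Colon> S \<Longrightarrow> conv \<Gamma> S T \<Longrightarrow> \<Gamma> \<turnstile> t \<doteq> u \<Colon> T"
  by (auto simp: conv_def intro: t_conv e_conv)

lemma is_type_Pi: "is_type \<Gamma> A \<Longrightarrow> is_type (A # \<Gamma>) B \<Longrightarrow> is_type \<Gamma> (Pi A B)"
  and is_type_Sig: "is_type \<Gamma> A \<Longrightarrow> is_type (A # \<Gamma>) B \<Longrightarrow> is_type \<Gamma> (Sig A B)"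
  unfolding is_type_def by (meson cumul(1) t_pi t_sig max.cobounded1 max.cobounded2)+

lemma is_type_PiD: "is_type \<Gamma> (Pi A B) \<Longrightarrow> is_type \<Gamma> A \<and> is_type (A # \<Gamma>) B"
  and is_type_SigD: "is_type \<Gamma> (Sig A B) \<Longrightarrow> is_type \<Gamma> A \<and> is_type (A # \<Gamma>) B"
  and is_type_EqD: "is_type \<Gamma> (Eq A a b) \<Longrightarrow> is_type \<Gamma> A \<and> \<Gamma> \<turnstile> a \<Colon> A \<and> \<Gamma> \<turnstile> b \<Colon> A"
  and is_type_TruncD: "is_type \<Gamma> (Trunc A) \<Longrightarrow> is_type \<Gamma> A"
  unfolding is_type_def by (blast dest: inv_Pi inv_Sig inv_Eq inv_Trunc)+

lemma is_type_Eq: "is_type \<Gamma> A \<Longrightarrow> \<Gamma> \<turnstile> a \<Colon> A \<Longrightarrow> \<Gamma> \<turnstile> b \<Colon> A \<Longrightarrow> is_type \<Gamma> (Eq A a b)"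
  and is_type_Trunc: "is_type \<Gamma> A \<Longrightarrow> is_type \<Gamma> (Trunc A)"
  and is_type_Univ: "is_ctx \<Gamma> \<Longrightarrow> is_type \<Gamma> (Univ i)"
  unfolding is_type_def by (blast intro: t_eq t_trunc t_univ)+

lemma is_type_univ: "\<Gamma> \<turnstile> A \<Colon> Univ i \<Longrightarrow> is_type \<Gamma> A"
  by (auto simp: is_type_def)

lemma is_type_wk: "is_type \<Gamma> A \<Longrightarrow> is_type \<Gamma> B \<Longrightarrow> is_type (A # \<Gamma>) (wk B)"
  unfolding is_type_def using weakening[where T = "Univ _"] by force

lemma t_wk: "is_type \<Gamma> A \<Longrightarrow> \<Gamma> \<turnstile> t \<Colon> T \<Longrightarrow> A # \<Gamma> \<turnstile> wk t \<Colon> wk T"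
  unfolding is_type_def using weakening by blast

lemma inst_Univ [simp]: "inst (Univ i) a = Univ i"
  by (simp add: inst_def)

lemma is_type_inst: "is_type (A # \<Gamma>) B \<Longrightarrow> \<Gamma> \<turnstile> a \<Colon> A \<Longrightarrow> is_type \<Gamma> (inst B a)"
  unfolding is_type_def using t_inst[where B = "Univ _"] by force

lemma t_var0: "is_type \<Gamma> A \<Longrightarrow> A # \<Gamma> \<turnstile> Var 0 \<Colon> wk A"
  using t_var[of "A # \<Gamma>" 0] by (auto simp: is_type_def intro: ctx_cons)

lemma t_lam': "is_type \<Gamma> A \<Longrightarrow> A # \<Gamma> \<turnstile> b \<Colon> B \<Longrightarrow> \<Gamma> \<turnstile> Lam A b \<Colon> Pi A B"
  by (auto simp: is_type_def intro: t_lam)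

lemma is_type_arrow: "is_type \<Gamma> A \<Longrightarrow> is_type \<Gamma> B \<Longrightarrow> is_type \<Gamma> (arrow A B)"
  by (simp add: arrow_def is_type_Pi is_type_wk)

lemma is_type_isProp: assumes "is_type \<Gamma> A" shows "is_type \<Gamma> (isProp A)"
proof -
  have A1: "is_type (A # \<Gamma>) (wk A)" by (simp add: assms is_type_wk)
  have 0: "A # \<Gamma> \<turnstile> Var 0 \<Colon> wk A" by (simp add: assms t_var0)
  have 1: "wk A # A # \<Gamma> \<turnstile> Var 1 \<Colon> wk (wk A)" using t_wk[OF A1 0] by simp
  have 2: "wk A # A # \<Gamma> \<turnstile> Var 0 \<Colon> wk (wk A)" by (simp add: A1 t_var0)
  show ?thesis unfolding isProp_def
    by (intro is_type_Pi is_type_Eq is_type_wk assms A1 1 2)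
qed

text \<open>Without injectivity of \<open>Pi\<close> a well-typed redex need not be reducible at the types that
  \<open>beta_pi\<close> demands; an inferred type records enough to make it so.\<close>

fun good :: "tm \<Rightarrow> tm list \<Rightarrow> tm \<Rightarrow> bool" where
  "good (Lam A b) \<Gamma> T \<longleftrightarrow> (\<exists>B. T = Pi A B \<and> is_type \<Gamma> A \<and> A # \<Gamma> \<turnstile> b \<Colon> B \<and> good b (A # \<Gamma>) B)"
| "good (Pr a b) \<Gamma> T \<longleftrightarrow> (\<exists>A B. T = Sig A (wk B) \<and> \<Gamma> \<turnstile> a \<Colon> A \<and> \<Gamma> \<turnstile> b \<Colon> B \<and> is_type (A # \<Gamma>) (wk B))"
| "good t \<Gamma> T \<longleftrightarrow> True"

definition elaborates :: "tm list \<Rightarrow> tm \<Rightarrow> tm option \<Rightarrow> tm \<Rightarrow> tm \<Rightarrow> bool" where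
  "elaborates \<Gamma> t E t' T \<longleftrightarrow> \<Gamma> \<turnstile> t \<Colon> T \<and> \<Gamma> \<turnstile> t \<doteq> t' \<Colon> T \<and> is_type \<Gamma> T \<and>
     (case E of None \<Rightarrow> good t \<Gamma> T | Some U \<Rightarrow> T = U)"

definition sound :: "normalizer \<Rightarrow> bool" where
  "sound N \<longleftrightarrow> (\<forall>\<Gamma> A A'. is_ctx \<Gamma> \<longrightarrow> N \<Gamma> A = Some A' \<longrightarrow> is_type \<Gamma> A' \<and> conv \<Gamma> A A')"

definition is_type_opt :: "tm list \<Rightarrow> tm option \<Rightarrow> bool" where
  "is_type_opt \<Gamma> E \<longleftrightarrow> (case E of None \<Rightarrow> True | Some U \<Rightarrow> is_type \<Gamma> U)"

lemma as_simps:
  "as_univ T = Some i \<longleftrightarrow> T = Univ i" "as_pi T = Some (A, B) \<longleftrightarrow> T = Pi A B"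
  "as_sig T = Some (A, B) \<longleftrightarrow> T = Sig A B" "as_eq T = Some (A, a, b) \<longleftrightarrow> T = Eq A a b"
  "as_trunc T = Some A \<longleftrightarrow> T = Trunc A" "as_lam T = Some (A, b) \<longleftrightarrow> T = Lam A b"
  "as_pr T = Some (a, b) \<longleftrightarrow> T = Pr a b" "as_succ T = Some a \<longleftrightarrow> T = Succ a"
  by (cases T; auto)+

lemma subty_sound:
  assumes "subty T U" shows "\<Gamma> \<turnstile> t \<Colon> T \<Longrightarrow> \<Gamma> \<turnstile> t \<Colon> U" and "\<Gamma> \<turnstile> t \<doteq> t' \<Colon> T \<Longrightarrow> \<Gamma> \<turnstile> t \<doteq> t' \<Colon> U"
  using assms by (auto simp: subty_def as_simps intro: cumul split: option.splits)

lemma fit_sound: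
  assumes "fit N \<Gamma> t' T E = Some (r, R)" and "\<Gamma> \<turnstile> t \<Colon> T" "\<Gamma> \<turnstile> t \<doteq> t' \<Colon> T"
    and "sound N" "is_ctx \<Gamma>" "is_type_opt \<Gamma> E" "is_type \<Gamma> T" and "E = None \<Longrightarrow> good t \<Gamma> T"
  shows "elaborates \<Gamma> t E r R"
proof (cases E)
  case None
  then show ?thesis using assms by (auto simp: fit_def elaborates_def)
next
  case (Some U)
  with assms(6) have U: "is_type \<Gamma> U" by (simp add: is_type_opt_def)
  show ?thesis
  proof (cases "subty T U")
    case True
    then show ?thesis using assms(1-3) U Some by (auto simp: fit_def elaborates_def subty_sound)
  next
    case False
    then obtain T' U' where *: "N \<Gamma> T = Some T'" "N \<Gamma> U = Some U'" "subty T' U'" "r = t'" "R = U"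
      using assms(1) Some by (auto simp: fit_def bind_eq_Some_conv split: if_splits)
    then have c: "conv \<Gamma> T T'" "conv \<Gamma> U' U"
      using assms(4,5) by (auto simp: sound_def intro: conv_sym)
    show ?thesis
      unfolding elaborates_def *(4,5) Some
      using U assms(2,3) c by (auto intro: t_conv' e_conv' subty_sound[OF *(3)])
  qed
qed

lemma expose_sound:
  assumes "expose d N \<Gamma> T = Some r" "sound N" "is_ctx \<Gamma>" "is_type \<Gamma> T"
  obtains T' where "d T' = Some r" "is_type \<Gamma> T'" "conv \<Gamma> T T'" "\<And>r'. d T = Some r' \<Longrightarrow> T' = T"
proof (cases "d T")
  case None
  then obtain T' where "N \<Gamma> T = Some T'" "d T' = Some r"
    using assms(1) by (auto simp: expose_def bind_eq_Some_conv)
  then show ?thesis using that assms None by (auto simp: sound_def)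
next
  case (Some a)
  then show ?thesis using that[of T] assms by (auto simp: expose_def conv_refl)
qed

lemma motive_sound:
  assumes "motive A C K = Some D" "good C \<Gamma> K"
  obtains i where "C = Lam A D" "is_type \<Gamma> A" "A # \<Gamma> \<turnstile> D \<Colon> Univ i" "K = Pi A (Univ i)"
  using assms by (auto simp: motive_def bind_eq_Some_conv as_simps split: if_splits)

lemma beta_motive:
  assumes "is_type \<Gamma> A" "A # \<Gamma> \<turnstile> D \<Colon> Univ i" "\<Gamma> \<turnstile> a \<Colon> A"
  shows "\<Gamma> \<turnstile> App (Lam A D) a \<doteq> inst D a \<Colon> Univ i"
  using assms beta_pi[of \<Gamma> A _ D "Univ i" a] by (auto simp: is_type_def)

text \<open>Contracting the outer application leaves a literal abstraction over
  \<open>Eq A a x\<close>, so the second contraction again happens at a type that is known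
  literally.\<close>

lemma beta_motive2:
  assumes "is_type \<Gamma> A" "\<Gamma> \<turnstile> a \<Colon> A" "Eq (wk A) (wk a) (Var 0) # A # \<Gamma> \<turnstile> D \<Colon> Univ i"
    and x: "\<Gamma> \<turnstile> x \<Colon> A" "\<Gamma> \<turnstile> p \<Colon> Eq A a x"
  shows "\<Gamma> \<turnstile> App (App (Lam A (Lam (Eq (wk A) (wk a) (Var 0)) D)) x) p \<doteq>
      inst (sub (ups (case_nat x Var)) D) p \<Colon> Univ i" (is "\<Gamma> \<turnstile> App (App (Lam A (Lam ?Q D)) x) p \<doteq> inst ?D p \<Colon> _")
    and "is_type \<Gamma> (inst (sub (ups (case_nat x Var)) D) p)"
proof -
  have Q: "is_type (A # \<Gamma>) ?Q"
    by (intro is_type_Eq is_type_wk t_wk t_var0 assms)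
  have Qx: "inst ?Q x = Eq A a x"
    using inst_wk[of A x] inst_wk[of a x] by (simp add: inst_def)
  have E: "is_type \<Gamma> (Eq A a x)"
    by (intro is_type_Eq assms)
  then have D: "Eq A a x # \<Gamma> \<turnstile> ?D \<Colon> Univ i"
    using t_inst_ups[OF assms(3) x(1)] unfolding Qx is_type_def by auto
  have i: "inst (Pi ?Q (Univ i)) x = Pi (Eq A a x) (Univ i)" "inst (Lam ?Q D) x = Lam (Eq A a x) ?D"
    using Qx by (simp_all add: inst_def)
  have "\<Gamma> \<turnstile> App (Lam A (Lam ?Q D)) x \<doteq> Lam (Eq A a x) ?D \<Colon> Pi (Eq A a x) (Univ i)"
    using beta_pi[OF _ t_lam'[OF Q assms(3)] x(1)] assms(1) unfolding i is_type_def by blast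
  then have "\<Gamma> \<turnstile> App (App (Lam A (Lam ?Q D)) x) p \<doteq> App (Lam (Eq A a x) ?D) p \<Colon> Univ i"
    using c_app[OF _ e_refl[OF x(2)]] by force
  with beta_motive[OF E D x(2)] show "\<Gamma> \<turnstile> App (App (Lam A (Lam ?Q D)) x) p \<doteq> inst ?D p \<Colon> Univ i"
    by (rule e_trans[rotated])
  show "is_type \<Gamma> (inst ?D p)"
    using D x(2) by (blast intro: is_type_inst is_type_univ)
qed

text \<open>Relates the contracted step type that the checker expects to the one with applied
  motives in \<open>t_natE\<close>; the two differ by beta steps below binders.\<close>

lemma natE_step:
  assumes D: "NN # \<Gamma> \<turnstile> D \<Colon> Univ i" and c: "is_ctx \<Gamma>"
  defines "D' \<equiv> sub (case_nat (Succ (Var 1)) (\<lambda>k. Var (k + 2))) D"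
  shows "is_type \<Gamma> (Pi NN (Pi D D'))"
    and "conv \<Gamma> (Pi NN (Pi D D'))
      (Pi NN (Pi (App (wk (Lam NN D)) (Var 0)) (App (wk (wk (Lam NN D))) (Succ (Var 1)))))"
proof -
  have N: "is_type \<Delta> NN" if "is_ctx \<Delta>" for \<Delta> using that by (auto simp: is_type_def intro: t_nat)
  have c1: "is_ctx (NN # \<Gamma>)" and c2: "is_ctx (D # NN # \<Gamma>)"
    using D by (auto intro: ctx_cons judgement_ctx)
  have C: "\<Gamma> \<turnstile> Lam NN D \<Colon> Pi NN (Univ i)" using t_lam'[OF N[OF c] D] .
  have C1: "NN # \<Gamma> \<turnstile> wk (Lam NN D) \<Colon> Pi NN (Univ i)"
    using t_wk[OF N[OF c] C] by simp
  have C2: "D # NN # \<Gamma> \<turnstile> wk (wk (Lam NN D)) \<Colon> Pi NN (Univ i)"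
    using t_wk[OF is_type_univ[OF D] C1] by simp
  have v0: "NN # \<Gamma> \<turnstile> Var 0 \<Colon> NN" using t_var0[OF N[OF c]] by simp
  have v1: "D # NN # \<Gamma> \<turnstile> Succ (Var 1) \<Colon> NN"
    using t_succ[of "D # NN # \<Gamma>" "Var 1"] t_wk[OF is_type_univ[OF D] v0] by simp
  have D1: "NN # NN # \<Gamma> \<turnstile> ren (upr Suc) D \<Colon> Univ i"
    using weakening_upr[OF t_nat[OF c] t_nat[OF c] D] by simp
  have D2: "NN # D # NN # \<Gamma> \<turnstile> ren (upr Suc) (ren (upr Suc) D) \<Colon> Univ i"
    using weakening_upr[OF D t_nat[OF c1] D1] by simp
  have D1': "inst (ren (upr Suc) D) (Var 0) = D"
    by (rule inst_ren_upr_Var)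
  have "case_nat (Succ (Var 1)) Var \<circ> (upr Suc \<circ> upr Suc) = case_nat (Succ (Var 1)) (\<lambda>k. Var (k + 2))"
    by (rule ext) (simp add: upr_def split: nat.split)
  then have D2': "inst (ren (upr Suc) (ren (upr Suc) D)) (Succ (Var 1)) = D'"
    by (simp add: inst_def ren_ren sub_ren D'_def)
  have D'i: "D # NN # \<Gamma> \<turnstile> D' \<Colon> Univ i"
    using t_inst[OF D2 v1] unfolding D2' inst_Univ .
  show "is_type \<Gamma> (Pi NN (Pi D D'))"
    using D D'i by (blast intro: is_type_Pi is_type_univ N[OF c])
  have 1: "NN # \<Gamma> \<turnstile> D \<doteq> App (wk (Lam NN D)) (Var 0) \<Colon> Univ i"
    using beta_motive[OF N[OF c1] D1 v0, THEN e_sym] by (simp add: D1')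
  have 2: "D # NN # \<Gamma> \<turnstile> D' \<doteq> App (wk (wk (Lam NN D))) (Succ (Var 1)) \<Colon> Univ i"
    using beta_motive[OF N[OF c2] D2 v1, THEN e_sym] unfolding D2' by simp
  \<comment> \<open>\<open>c_pi\<close> works at one level, so \<open>NN\<close> is lifted from
    level 0 to the level of the motive.\<close>
  have "\<Gamma> \<turnstile> NN \<Colon> Univ i" using cumul(1)[OF le0 t_nat[OF c]] .
  then show "conv \<Gamma> (Pi NN (Pi D D'))
      (Pi NN (Pi (App (wk (Lam NN D)) (Var 0)) (App (wk (wk (Lam NN D))) (Succ (Var 1)))))"
    unfolding conv_def using D 1 2 by (blast intro: c_pi e_refl)
qed

lemma elaboratesD:
  "elaborates \<Gamma> t E t' T \<Longrightarrow> \<Gamma> \<turnstile> t \<Colon> T" "elaborates \<Gamma> t E t' T \<Longrightarrow> \<Gamma> \<turnstile> t \<doteq> t' \<Colon> T" "elaborates \<Gamma> t E t' T \<Longrightarrow> is_type \<Gamma> T"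
  "elaborates \<Gamma> t None t' T \<Longrightarrow> good t \<Gamma> T" "elaborates \<Gamma> t (Some U) t' T \<Longrightarrow> T = U"
  by (auto simp: elaborates_def)

lemma is_type_opt_simps [simp]: "is_type_opt \<Gamma> None" "is_type_opt \<Gamma> (Some U) = is_type \<Gamma> U"
  by (auto simp: is_type_opt_def)

lemma elaborates_SomeD: "elaborates \<Gamma> t (Some U) t' T \<Longrightarrow> \<Gamma> \<turnstile> t \<Colon> U \<and> \<Gamma> \<turnstile> t \<doteq> t' \<Colon> U"
  by (auto simp: elaborates_def)

lemma type_sound:
  assumes "elaborates \<Gamma> A None A' U" "expose as_univ N \<Gamma> U = Some i" "sound N" "is_ctx \<Gamma>"
  shows "\<Gamma> \<turnstile> A \<Colon> Univ i" "\<Gamma> \<turnstile> A \<doteq> A' \<Colon> Univ i"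
proof -
  obtain T' where "as_univ T' = Some i" "conv \<Gamma> U T'"
    using expose_sound[OF assms(2-4)] elaboratesD(3)[OF assms(1)] by blast
  then show "\<Gamma> \<turnstile> A \<Colon> Univ i" "\<Gamma> \<turnstile> A \<doteq> A' \<Colon> Univ i"
    using assms(1) by (auto simp: as_simps elaborates_def intro: t_conv' e_conv')
qed

lemma expose_elaborates:
  assumes "elaborates \<Gamma> t None t' T" "expose d N \<Gamma> T = Some r" "sound N" "is_ctx \<Gamma>"
  obtains T' where "d T' = Some r" "is_type \<Gamma> T'" "\<Gamma> \<turnstile> t \<Colon> T'" "\<Gamma> \<turnstile> t \<doteq> t' \<Colon> T'" "\<And>r'. d T = Some r' \<Longrightarrow> T' = T"
  using expose_sound[OF assms(2-4)] elaboratesD(1-3)[OF assms(1)] t_conv' e_conv' by metis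

inductive_cases is_ctx_ConsE: "is_ctx (A # \<Gamma>)"

lemma is_type_lookup: "is_ctx \<Gamma> \<Longrightarrow> n < length \<Gamma> \<Longrightarrow> is_type \<Gamma> (ren (\<lambda>k. k + Suc n) (\<Gamma> ! n))"
proof (induction \<Gamma> arbitrary: n)
  case (Cons A \<Gamma>)
  then obtain i where A: "\<Gamma> \<turnstile> A \<Colon> Univ i" by (auto elim: is_ctx_ConsE)
  show ?case
  proof (cases n)
    case 0
    then show ?thesis using is_type_wk[OF A[THEN is_type_univ] A[THEN is_type_univ]] by simp
  next
    case (Suc m)
    then have "is_type \<Gamma> (ren (\<lambda>k. k + Suc m) (\<Gamma> ! m))"
      using Cons A judgement_ctx by simp
    from is_type_wk[OF A[THEN is_type_univ] this] show ?thesis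
      by (simp add: Suc ren_ren comp_def)
  qed
qed simp

lemma c_pi_max:
  assumes "\<Gamma> \<turnstile> A \<Colon> Univ a" "\<Gamma> \<turnstile> A \<doteq> A' \<Colon> Univ a" "A # \<Gamma> \<turnstile> B \<Colon> Univ b" "A # \<Gamma> \<turnstile> B \<doteq> B' \<Colon> Univ b"
  shows "\<Gamma> \<turnstile> Pi A B \<Colon> Univ (max a b)" "\<Gamma> \<turnstile> Pi A B \<doteq> Pi A' B' \<Colon> Univ (max a b)"
    "\<Gamma> \<turnstile> Sig A B \<Colon> Univ (max a b)" "\<Gamma> \<turnstile> Sig A B \<doteq> Sig A' B' \<Colon> Univ (max a b)"
  using assms cumul[of a "max a b"] cumul[of b "max a b"]
  by (auto intro!: t_pi c_pi t_sig c_sig)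

lemma if_Some_conv: "(if P then Some a else None) = Some b \<longleftrightarrow> P \<and> a = b"
  by simp

text \<open>The induction follows the code: the typing comes from the rule for the head of the term,
  and the equation with the reduct comes from reflexivity, a congruence rule or, where a redex is
  contracted, a computation rule. In inference mode the extra information in \<open>good\<close> is
  what makes the computation rules for functions and pairs applicable.\<close>

theorem elab_sound:
  "elab N t \<Gamma> E = Some (t', T) \<Longrightarrow> sound N \<Longrightarrow> is_ctx \<Gamma> \<Longrightarrow> is_type_opt \<Gamma> E \<Longrightarrow> elaborates \<Gamma> t E t' T"
proof (induction t arbitrary: \<Gamma> E t' T)
  case (Var n)
  then have "n < length \<Gamma>" by (auto split: if_splits)
  with Var show ?case
    by (auto intro!: fit_sound[of N \<Gamma> "Var n"] e_refl t_var is_type_lookup simp del: add_Suc_right)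
next
  case (Univ i)
  then show ?case by (auto intro!: fit_sound[of N \<Gamma> "Univ i"] e_refl t_univ is_type_Univ)
next
  case (Pi A B)
  from Pi.prems(1) obtain A' U a B' V b where e: "elab N A \<Gamma> None = Some (A', U)"
      "expose as_univ N \<Gamma> U = Some a" "elab N B (A # \<Gamma>) None = Some (B', V)"
      "expose as_univ N (A # \<Gamma>) V = Some b" "fit N \<Gamma> (Pi A' B') (Univ (max a b)) E = Some (t', T)"
    by (auto simp: bind_eq_Some_conv)
  have A: "\<Gamma> \<turnstile> A \<Colon> Univ a" "\<Gamma> \<turnstile> A \<doteq> A' \<Colon> Univ a"
    using type_sound[OF Pi.IH(1)[OF e(1)] e(2)] Pi.prems by auto
  have B: "A # \<Gamma> \<turnstile> B \<Colon> Univ b" "A # \<Gamma> \<turnstile> B \<doteq> B' \<Colon> Univ b"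
    using type_sound[OF Pi.IH(2)[OF e(3)] e(4)] Pi.prems ctx_cons[OF A(1)] by auto
  show ?case
    by (rule fit_sound[OF e(5)]) (use c_pi_max[OF A B] Pi.prems in \<open>auto intro: is_type_Univ\<close>)
next
  case (Lam A b)
  from Lam.prems(1) obtain A' U a where e: "elab N A \<Gamma> None = Some (A', U)" "expose as_univ N \<Gamma> U = Some a"
    by (auto simp: bind_eq_Some_conv)
  have A: "\<Gamma> \<turnstile> A \<Colon> Univ a" "\<Gamma> \<turnstile> A \<doteq> A' \<Colon> Univ a"
    using type_sound[OF Lam.IH(1)[OF e(1)] e(2)] Lam.prems by auto
  let ?E = "do { U \<leftarrow> E; (A2, B2) \<leftarrow> expose as_pi N \<Gamma> U; if A = A2 then Some B2 else None }"
  from Lam.prems(1) e obtain b' B where e': "elab N b (A # \<Gamma>) ?E = Some (b', B)"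
      "fit N \<Gamma> (Lam A' b') (Pi A B) E = Some (t', T)"
    by (auto simp: bind_eq_Some_conv[of "elab _ _ _ _"])
  have "is_type_opt (A # \<Gamma>) ?E"
    using Lam.prems(2-4)
    by (auto simp: is_type_opt_def bind_eq_Some_conv as_simps split: option.split if_splits elim!: expose_sound dest: is_type_PiD)
  then have "elaborates (A # \<Gamma>) b ?E b' B" using Lam.IH(2)[OF e'(1)] Lam.prems ctx_cons[OF A(1)] by blast
  note b = this elaboratesD(1-3)[OF this]
  have "good b (A # \<Gamma>) B" if "E = None" using b(1) that by (simp add: elaborates_def)
  with b(2-4) A Lam.prems show ?case
    by (intro fit_sound[OF e'(2)]) (auto intro: t_lam' c_lam is_type_Pi is_type_univ)
next
  case (App f a)
  from App.prems(1) obtain f' F A B a' A2 where e: "elab N f \<Gamma> None = Some (f', F)"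
      "expose as_pi N \<Gamma> F = Some (A, B)" "elab N a \<Gamma> (Some A) = Some (a', A2)"
      "fit N \<Gamma> (case as_lam f of None \<Rightarrow> App f' a' | Some (_, b) \<Rightarrow> inst b a) (inst B a) E = Some (t', T)"
    by (auto simp: bind_eq_Some_conv)
  have rf: "elaborates \<Gamma> f None f' F" using App.IH(1)[OF e(1)] App.prems by simp
  obtain P where P: "as_pi P = Some (A, B)" "is_type \<Gamma> P" "\<Gamma> \<turnstile> f \<Colon> P" "\<Gamma> \<turnstile> f \<doteq> f' \<Colon> P"
      and P_eq: "\<And>r'. as_pi F = Some r' \<Longrightarrow> P = F"
    using expose_elaborates[OF rf e(2)] App.prems by metis
  have f: "\<Gamma> \<turnstile> f \<Colon> Pi A B" "\<Gamma> \<turnstile> f \<doteq> f' \<Colon> Pi A B" "is_type \<Gamma> A" "is_type (A # \<Gamma>) B"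
    using P by (auto simp: as_simps dest: is_type_PiD)
  have "elaborates \<Gamma> a (Some A) a' A2" using App.IH(2)[OF e(3)] App.prems f by simp
  note a = elaborates_SomeD[OF this]
  have "\<Gamma> \<turnstile> App f a \<doteq> (case as_lam f of None \<Rightarrow> App f' a' | Some (_, b) \<Rightarrow> inst b a) \<Colon> inst B a"
  proof (cases "as_lam f")
    case None
    then show ?thesis using f a by (auto intro: c_app)
  next
    case (Some q)
    then obtain A0 b where q: "f = Lam A0 b" "q = (A0, b)" by (cases q) (simp add: as_simps)
    then obtain B0 where B0: "F = Pi A0 B0" "is_type \<Gamma> A0" "A0 # \<Gamma> \<turnstile> b \<Colon> B0"
      using elaboratesD(4)[OF rf] by auto
    \<comment> \<open>For a literal abstraction \<open>expose\<close> leaves the inferred type as it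
      is, so this is injectivity of the datatype constructor \<open>Pi\<close>, not of
      \<open>Pi\<close> up to conversion.\<close>
    with P_eq P have "A0 = A" "B0 = B" by (auto simp: as_simps)
    with B0 a q Some show ?thesis by (auto simp: is_type_def intro: beta_pi)
  qed
  from fit_sound[OF e(4) _ this] f a App.prems show ?case
    by (auto intro: t_app is_type_inst)
next
  case (Sig A B)
  from Sig.prems(1) obtain A' U a B' V b where e: "elab N A \<Gamma> None = Some (A', U)"
      "expose as_univ N \<Gamma> U = Some a" "elab N B (A # \<Gamma>) None = Some (B', V)"
      "expose as_univ N (A # \<Gamma>) V = Some b" "fit N \<Gamma> (Sig A' B') (Univ (max a b)) E = Some (t', T)"
    by (auto simp: bind_eq_Some_conv)
  have A: "\<Gamma> \<turnstile> A \<Colon> Univ a" "\<Gamma> \<turnstile> A \<doteq> A' \<Colon> Univ a"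
    using type_sound[OF Sig.IH(1)[OF e(1)] e(2)] Sig.prems by auto
  have B: "A # \<Gamma> \<turnstile> B \<Colon> Univ b" "A # \<Gamma> \<turnstile> B \<doteq> B' \<Colon> Univ b"
    using type_sound[OF Sig.IH(2)[OF e(3)] e(4)] Sig.prems ctx_cons[OF A(1)] by auto
  show ?case
    by (rule fit_sound[OF e(5)]) (use c_pi_max[OF A B] Sig.prems in \<open>auto intro: is_type_Univ\<close>)
next
  case (Pr a b)
  show ?case
  proof (cases E)
    case None
    then obtain a' A b' B where e: "elab N a \<Gamma> None = Some (a', A)" "elab N b \<Gamma> None = Some (b', B)"
        "t' = Pr a' b'" "T = Sig A (wk B)"
      using Pr.prems(1) by (auto simp: bind_eq_Some_conv)
    have "elaborates \<Gamma> a None a' A" "elaborates \<Gamma> b None b' B" using Pr.IH(1)[OF e(1)] Pr.IH(2)[OF e(2)] Pr.prems by auto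
    note a = elaboratesD(1-4)[OF this(1)] and b = elaboratesD(1-4)[OF this(2)]
    have w: "is_type (A # \<Gamma>) (wk B)" using a b by (blast intro: is_type_wk)
    then show ?thesis
      using a b unfolding elaborates_def None e(3,4)
      by (auto simp: is_type_def inst_wk intro: t_pr c_pr is_type_Sig[unfolded is_type_def])
  next
    case (Some U)
    then obtain A B a' A2 b' B2 where e: "expose as_sig N \<Gamma> U = Some (A, B)" "elab N a \<Gamma> (Some A) = Some (a', A2)"
        "elab N b \<Gamma> (Some (inst B a)) = Some (b', B2)" "fit N \<Gamma> (Pr a' b') (Sig A B) E = Some (t', T)"
      using Pr.prems(1) by (auto simp: bind_eq_Some_conv)
    have w: "is_type \<Gamma> (Sig A B)"
      using expose_sound[OF e(1)] Pr.prems Some by (auto simp: as_simps)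
    then have "elaborates \<Gamma> a (Some A) a' A2" using Pr.IH(1)[OF e(2)] Pr.prems by (auto dest: is_type_SigD)
    note a = elaborates_SomeD[OF this]
    then have "elaborates \<Gamma> b (Some (inst B a)) b' B2" using Pr.IH(2)[OF e(3)] Pr.prems w by (auto dest: is_type_SigD intro: is_type_inst)
    note b = elaborates_SomeD[OF this]
    obtain i where "A # \<Gamma> \<turnstile> B \<Colon> Univ i" using is_type_SigD[OF w] by (auto simp: is_type_def)
    then show ?thesis
      using fit_sound[OF e(4)] a b w Pr.prems Some by (auto intro: t_pr c_pr)
  qed
next
  case (Fst p)
  from Fst.prems(1) obtain p' S A B where e: "elab N p \<Gamma> None = Some (p', S)"
      "expose as_sig N \<Gamma> S = Some (A, B)" "fit N \<Gamma> (case as_pr p of None \<Rightarrow> Fst p' | Some (a, _) \<Rightarrow> a) A E = Some (t', T)"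
    by (auto simp: bind_eq_Some_conv)
  have r: "elaborates \<Gamma> p None p' S" using Fst.IH[OF e(1)] Fst.prems by simp
  obtain P where P: "as_sig P = Some (A, B)" "is_type \<Gamma> P" "\<Gamma> \<turnstile> p \<Colon> P" "\<Gamma> \<turnstile> p \<doteq> p' \<Colon> P"
      and P_eq: "\<And>r'. as_sig S = Some r' \<Longrightarrow> P = S"
    using expose_elaborates[OF r e(2)] Fst.prems by metis
  have p: "\<Gamma> \<turnstile> p \<Colon> Sig A B" "\<Gamma> \<turnstile> p \<doteq> p' \<Colon> Sig A B" "is_type \<Gamma> A"
    using P by (auto simp: as_simps dest: is_type_SigD)
  have "\<Gamma> \<turnstile> Fst p \<doteq> (case as_pr p of None \<Rightarrow> Fst p' | Some (a, _) \<Rightarrow> a) \<Colon> A"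
  proof (cases "as_pr p")
    case None
    then show ?thesis using p by (auto intro: c_fst)
  next
    case (Some q)
    then obtain a b where q: "p = Pr a b" "q = (a, b)" by (cases q) (simp add: as_simps)
    then obtain A0 B0 where *: "S = Sig A0 (wk B0)" "\<Gamma> \<turnstile> a \<Colon> A0" "\<Gamma> \<turnstile> b \<Colon> B0" "is_type (A0 # \<Gamma>) (wk B0)"
      using elaboratesD(4)[OF r] by auto
    with P_eq P have "A0 = A" by (auto simp: as_simps)
    with * q Some show ?thesis by (auto simp: is_type_def inst_wk intro: beta_fst)
  qed
  from fit_sound[OF e(3) _ this] p Fst.prems show ?case by (auto intro: t_fst)
next
  case (Snd p)
  from Snd.prems(1) obtain p' S A B where e: "elab N p \<Gamma> None = Some (p', S)"
      "expose as_sig N \<Gamma> S = Some (A, B)"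
      "fit N \<Gamma> (case as_pr p of None \<Rightarrow> Snd p' | Some (_, b) \<Rightarrow> b) (inst B (Fst p)) E = Some (t', T)"
    by (auto simp: bind_eq_Some_conv)
  have r: "elaborates \<Gamma> p None p' S" using Snd.IH[OF e(1)] Snd.prems by simp
  obtain P where P: "as_sig P = Some (A, B)" "is_type \<Gamma> P" "\<Gamma> \<turnstile> p \<Colon> P" "\<Gamma> \<turnstile> p \<doteq> p' \<Colon> P"
      and P_eq: "\<And>r'. as_sig S = Some r' \<Longrightarrow> P = S"
    using expose_elaborates[OF r e(2)] Snd.prems by metis
  have p: "\<Gamma> \<turnstile> p \<Colon> Sig A B" "\<Gamma> \<turnstile> p \<doteq> p' \<Colon> Sig A B" "is_type (A # \<Gamma>) B"
    using P by (auto simp: as_simps dest: is_type_SigD)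
  have "\<Gamma> \<turnstile> Snd p \<doteq> (case as_pr p of None \<Rightarrow> Snd p' | Some (_, b) \<Rightarrow> b) \<Colon> inst B (Fst p)"
  proof (cases "as_pr p")
    case None
    then show ?thesis using p by (auto intro: c_snd)
  next
    case (Some q)
    then obtain a b where q: "p = Pr a b" "q = (a, b)" by (cases q) (simp add: as_simps)
    then obtain A0 B0 where *: "S = Sig A0 (wk B0)" "\<Gamma> \<turnstile> a \<Colon> A0" "\<Gamma> \<turnstile> b \<Colon> B0" "is_type (A0 # \<Gamma>) (wk B0)"
      using elaboratesD(4)[OF r] by auto
    with P_eq P have "B = wk B0" by (auto simp: as_simps)
    with * q Some show ?thesis using beta_snd[of A0 \<Gamma> "wk B0" _ a b] by (auto simp: is_type_def inst_wk)
  qed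
  from fit_sound[OF e(3) _ this] p Snd.prems show ?case by (auto intro: t_snd t_fst is_type_inst)
next
  case (Eq A a b)
  from Eq.prems(1) obtain A' U i a' A2 b' B2 where e: "elab N A \<Gamma> None = Some (A', U)"
      "expose as_univ N \<Gamma> U = Some i" "elab N a \<Gamma> (Some A) = Some (a', A2)" "elab N b \<Gamma> (Some A) = Some (b', B2)"
      "fit N \<Gamma> (Eq A' a' b') (Univ i) E = Some (t', T)"
    by (auto simp: bind_eq_Some_conv)
  have A: "\<Gamma> \<turnstile> A \<Colon> Univ i" "\<Gamma> \<turnstile> A \<doteq> A' \<Colon> Univ i"
    using type_sound[OF Eq.IH(1)[OF e(1)] e(2)] Eq.prems by auto
  then have "elaborates \<Gamma> a (Some A) a' A2" "elaborates \<Gamma> b (Some A) b' B2"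
    using Eq.IH(2)[OF e(3)] Eq.IH(3)[OF e(4)] Eq.prems by (auto intro: is_type_univ)
  note a = elaborates_SomeD[OF this(1)] and b = elaborates_SomeD[OF this(2)]
  show ?case
    by (rule fit_sound[OF e(5)]) (use A a b Eq.prems in \<open>auto intro: t_eq c_eq is_type_Univ\<close>)
next
  case (Refl a)
  let ?E = "do { U \<leftarrow> E; (A, _) \<leftarrow> expose as_eq N \<Gamma> U; Some A }"
  from Refl.prems(1) obtain a' A where e: "elab N a \<Gamma> ?E = Some (a', A)" "fit N \<Gamma> (Refl a') (Eq A a a) E = Some (t', T)"
    by (auto simp: bind_eq_Some_conv[of "elab _ _ _ _"])
  have "is_type_opt \<Gamma> ?E"
    using Refl.prems(2-4)
    by (auto simp: is_type_opt_def bind_eq_Some_conv as_simps split: option.split elim!: expose_sound dest: is_type_EqD)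
  then have "elaborates \<Gamma> a ?E a' A" using Refl.IH[OF e(1)] Refl.prems by blast
  note a = elaboratesD(1-3)[OF this]
  show ?case by (rule fit_sound[OF e(2)]) (use a Refl.prems in \<open>auto intro: t_refl c_refl is_type_Eq\<close>)
next
  case (J C c p)
  from J.prems(1) obtain C' K p' S A a b C1 K1 D c' A3 where e: "elab N C \<Gamma> None = Some (C', K)"
      "elab N p \<Gamma> None = Some (p', S)" "expose as_eq N \<Gamma> S = Some (A, a, b)" "as_lam C = Some (A, C1)" "as_pi K = Some (A, K1)"
      "motive (Eq (wk A) (wk a) (Var 0)) C1 K1 = Some D"
      "elab N c \<Gamma> (Some (inst (sub (ups (case_nat a Var)) D) (Refl a))) = Some (c', A3)"
      "fit N \<Gamma> (if p = Refl a \<and> b = a then c else J C c' p') (inst (sub (ups (case_nat b Var)) D) p) E = Some (t', T)"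
    by (auto simp: bind_eq_Some_conv if_Some_conv)
  note CK = e(4,5)[unfolded as_simps]
  have rp: "elaborates \<Gamma> p None p' S" using J.IH(3)[OF e(2)] J.prems by simp
  obtain P where P: "as_eq P = Some (A, a, b)" "is_type \<Gamma> P" "\<Gamma> \<turnstile> p \<Colon> P" "\<Gamma> \<turnstile> p \<doteq> p' \<Colon> P"
    using expose_elaborates[OF rp e(3)] J.prems by metis
  have p: "\<Gamma> \<turnstile> p \<Colon> Eq A a b" "\<Gamma> \<turnstile> p \<doteq> p' \<Colon> Eq A a b" "is_type \<Gamma> A" "\<Gamma> \<turnstile> a \<Colon> A" "\<Gamma> \<turnstile> b \<Colon> A"
    using P by (auto simp: as_simps dest: is_type_EqD)
  have rC: "elaborates \<Gamma> C None C' K" using J.IH(1)[OF e(1)] J.prems by simp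
  then have "good C1 (A # \<Gamma>) K1" using elaboratesD(4) CK by fastforce
  then obtain i where D: "C1 = Lam (Eq (wk A) (wk a) (Var 0)) D"
      "Eq (wk A) (wk a) (Var 0) # A # \<Gamma> \<turnstile> D \<Colon> Univ i" "K1 = Pi (Eq (wk A) (wk a) (Var 0)) (Univ i)"
    using motive_sound[OF e(6)] by metis
  have C: "C = Lam A (Lam (Eq (wk A) (wk a) (Var 0)) D)" using CK(1) D(1) by simp
  have Ct: "\<Gamma> \<turnstile> C \<Colon> Pi A (Pi (Eq (wk A) (wk a) (Var 0)) (Univ i))"
    using elaboratesD(1)[OF rC] CK(2) D(3) by simp
  \<comment> \<open>\<open>ba\<close> contracts the motive at \<open>a\<close> and
    \<open>Refl a\<close>, where the base case lives; \<open>bb\<close> contracts it at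
    \<open>b\<close> and \<open>p\<close>, where the result lives.\<close>
  note ba = beta_motive2[OF p(3,4) D(2) p(4) t_refl[OF p(4)], folded C]
  note bb = beta_motive2[OF p(3,4) D(2) p(5,1), folded C]
  have "elaborates \<Gamma> c (Some (inst (sub (ups (case_nat a Var)) D) (Refl a))) c' A3"
    using J.IH(2)[OF e(7)] J.prems ba(2) by simp
  note c = elaborates_SomeD[OF this]
  have c: "\<Gamma> \<turnstile> c \<Colon> App (App C a) (Refl a)" "\<Gamma> \<turnstile> c \<doteq> c' \<Colon> App (App C a) (Refl a)"
    using c ba(1) by (blast intro: t_conv e_conv e_sym)+
  have 1: "\<Gamma> \<turnstile> J C c p \<Colon> inst (sub (ups (case_nat b Var)) D) p"
    using t_J[OF Ct p(4,5) c(1) p(1)] bb(1) by (rule t_conv)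
  have 2: "\<Gamma> \<turnstile> J C c p \<doteq> (if p = Refl a \<and> b = a then c else J C c' p') \<Colon> inst (sub (ups (case_nat b Var)) D) p"
  proof (cases "p = Refl a \<and> b = a")
    case True
    then show ?thesis using beta_J[OF Ct p(4) c(1)] bb(1) by (auto intro: e_conv)
  next
    case False
    then show ?thesis using c_J[OF e_refl[OF Ct] p(4,5) c(2) p(2)] bb(1) by (auto intro: e_conv)
  qed
  show ?case
    by (rule fit_sound[OF e(8) 1 2]) (use J.prems bb(2) in auto)
next
  case Empty
  then show ?case by (auto intro!: fit_sound[of N \<Gamma> Empty] e_refl t_empty is_type_Univ)
next
  case (EmptyE C e)
  from EmptyE.prems(1) obtain C' K D e' A2 where e: "elab N C \<Gamma> None = Some (C', K)" "motive Empty C K = Some D"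
      "elab N e \<Gamma> (Some Empty) = Some (e', A2)" "fit N \<Gamma> (EmptyE C e) (inst D e) E = Some (t', T)"
    by (auto simp: bind_eq_Some_conv)
  have "elaborates \<Gamma> C None C' K" using EmptyE.IH(1)[OF e(1)] EmptyE.prems by simp
  note C = elaboratesD(1-4)[OF this]
  obtain i where D: "C = Lam Empty D" "is_type \<Gamma> Empty" "Empty # \<Gamma> \<turnstile> D \<Colon> Univ i" "K = Pi Empty (Univ i)"
    using motive_sound[OF e(2) C(4)] by metis
  have "elaborates \<Gamma> e (Some Empty) e' A2" using EmptyE.IH(2)[OF e(3)] EmptyE.prems D(2) by simp
  note t = elaborates_SomeD[OF this]
  have 1: "\<Gamma> \<turnstile> EmptyE C e \<Colon> inst D e"
    using t_emptyE[of \<Gamma> C i e] C(1) t beta_motive[OF D(2,3), of e] unfolding D(4) D(1)[symmetric]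
    by (blast intro: t_conv)
  show ?case
    by (rule fit_sound[OF e(4) 1 e_refl[OF 1]]) (use EmptyE.prems D t in \<open>auto intro: is_type_inst is_type_univ\<close>)
next
  case One
  then show ?case by (auto intro!: fit_sound[of N \<Gamma> One] e_refl t_one is_type_Univ)
next
  case Star
  then show ?case by (auto intro!: fit_sound[of N \<Gamma> Star] e_refl t_star intro: is_type_univ t_one)
next
  case (OneE C c t)
  from OneE.prems(1) obtain C' K D c' A2 u' A3 where e: "elab N C \<Gamma> None = Some (C', K)" "motive One C K = Some D"
      "elab N c \<Gamma> (Some (inst D Star)) = Some (c', A2)" "elab N t \<Gamma> (Some One) = Some (u', A3)"
      "fit N \<Gamma> (OneE C c t) (inst D t) E = Some (t', T)"
    by (auto simp: bind_eq_Some_conv)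
  have "elaborates \<Gamma> C None C' K" using OneE.IH(1)[OF e(1)] OneE.prems by simp
  note C = elaboratesD(1-4)[OF this]
  obtain i where D: "C = Lam One D" "is_type \<Gamma> One" "One # \<Gamma> \<turnstile> D \<Colon> Univ i" "K = Pi One (Univ i)"
    using motive_sound[OF e(2) C(4)] by metis
  note beta = beta_motive[OF D(2,3), folded D(1)] and s = t_star[OF OneE.prems(3)]
  have "elaborates \<Gamma> c (Some (inst D Star)) c' A2" "elaborates \<Gamma> t (Some One) u' A3"
    using OneE.IH(2)[OF e(3)] OneE.IH(3)[OF e(4)] OneE.prems D s by (auto intro: is_type_inst is_type_univ)
  note c = elaborates_SomeD[OF this(1)] and t = elaborates_SomeD[OF this(2)]
  have 1: "\<Gamma> \<turnstile> OneE C c t \<Colon> inst D t"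
    using t_oneE[of \<Gamma> C i c t] C(1) c t beta[OF s] beta[of t] unfolding D(4)
    by (blast intro: t_conv e_sym)
  show ?case
    by (rule fit_sound[OF e(5) 1 e_refl[OF 1]]) (use OneE.prems D t in \<open>auto intro: is_type_inst is_type_univ\<close>)
next
  case Two
  then show ?case by (auto intro!: fit_sound[of N \<Gamma> Two] e_refl t_two is_type_Univ)
next
  case B0
  then show ?case by (auto intro!: fit_sound[of N \<Gamma> B0] e_refl t_b0 intro: is_type_univ t_two)
next
  case B1
  then show ?case by (auto intro!: fit_sound[of N \<Gamma> B1] e_refl t_b1 intro: is_type_univ t_two)
next
  case (TwoE C c d t)
  from TwoE.prems(1) obtain C' K D c' A2 d' A4 u' A3 where e: "elab N C \<Gamma> None = Some (C', K)" "motive Two C K = Some D"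
      "elab N c \<Gamma> (Some (inst D B0)) = Some (c', A2)" "elab N d \<Gamma> (Some (inst D B1)) = Some (d', A4)"
      "elab N t \<Gamma> (Some Two) = Some (u', A3)"
      "fit N \<Gamma> (if t = B0 then c else if t = B1 then d else TwoE C c' d' u') (inst D t) E = Some (t', T)"
    by (auto simp: bind_eq_Some_conv)
  have "elaborates \<Gamma> C None C' K" using TwoE.IH(1)[OF e(1)] TwoE.prems by simp
  note C = elaboratesD(1-4)[OF this]
  obtain i where D: "C = Lam Two D" "is_type \<Gamma> Two" "Two # \<Gamma> \<turnstile> D \<Colon> Univ i" "K = Pi Two (Univ i)"
    using motive_sound[OF e(2) C(4)] by metis
  note beta = beta_motive[OF D(2,3), folded D(1)]
  note s0 = t_b0[OF TwoE.prems(3)] and s1 = t_b1[OF TwoE.prems(3)]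
  have "elaborates \<Gamma> c (Some (inst D B0)) c' A2" "elaborates \<Gamma> d (Some (inst D B1)) d' A4" "elaborates \<Gamma> t (Some Two) u' A3"
    using TwoE.IH(2)[OF e(3)] TwoE.IH(3)[OF e(4)] TwoE.IH(4)[OF e(5)] TwoE.prems D s0 s1
    by (auto intro: is_type_inst is_type_univ)
  note c = elaborates_SomeD[OF this(1)] and d = elaborates_SomeD[OF this(2)] and t = elaborates_SomeD[OF this(3)]
  have Ct: "\<Gamma> \<turnstile> C \<Colon> Pi Two (Univ i)" using C(1) D(4) by simp
  have c: "\<Gamma> \<turnstile> c \<Colon> App C B0" "\<Gamma> \<turnstile> c \<doteq> c' \<Colon> App C B0" and d: "\<Gamma> \<turnstile> d \<Colon> App C B1" "\<Gamma> \<turnstile> d \<doteq> d' \<Colon> App C B1"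
    using c d beta[OF s0] beta[OF s1] by (blast intro: t_conv e_conv e_sym)+
  have bt: "\<Gamma> \<turnstile> App C t \<doteq> inst D t \<Colon> Univ i" using beta t by blast
  have 1: "\<Gamma> \<turnstile> TwoE C c d t \<Colon> inst D t"
    using t_twoE[OF Ct c(1) d(1)] t bt by (blast intro: t_conv)
  have 2: "\<Gamma> \<turnstile> TwoE C c d t \<doteq> (if t = B0 then c else if t = B1 then d else TwoE C c' d' u') \<Colon> App C t"
    using beta_two0[OF Ct c(1) d(1)] beta_two1[OF Ct c(1) d(1)] c_twoE[OF e_refl[OF Ct] c(2) d(2)] t
    by simp
  show ?case
    by (rule fit_sound[OF e(6) 1 e_conv[OF 2 bt]]) (use TwoE.prems D t in \<open>auto intro: is_type_inst is_type_univ\<close>)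
next
  case NN
  then show ?case by (auto intro!: fit_sound[of N \<Gamma> NN] e_refl t_nat is_type_Univ)
next
  case Zero
  then show ?case by (auto intro!: fit_sound[of N \<Gamma> Zero] e_refl t_zero intro: is_type_univ t_nat)
next
  case (Succ n)
  from Succ.prems(1) obtain n' A2 where e: "elab N n \<Gamma> (Some NN) = Some (n', A2)" "fit N \<Gamma> (Succ n') NN E = Some (t', T)"
    by (auto simp: bind_eq_Some_conv)
  have w: "is_type \<Gamma> NN" using Succ.prems by (blast intro: is_type_univ t_nat)
  then have "elaborates \<Gamma> n (Some NN) n' A2" using Succ.IH[OF e(1)] Succ.prems by simp
  note n = elaborates_SomeD[OF this]
  show ?case by (rule fit_sound[OF e(2)]) (use n Succ.prems w in \<open>auto intro: t_succ c_succ\<close>)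
next
  case (NatE C z s n)
  let ?D' = "\<lambda>D. sub (case_nat (Succ (Var 1)) (\<lambda>k. Var (k + 2))) D"
  from NatE.prems(1) obtain C' K D z' A2 s' A4 n' A3 where e: "elab N C \<Gamma> None = Some (C', K)" "motive NN C K = Some D"
      "elab N z \<Gamma> (Some (inst D Zero)) = Some (z', A2)" "elab N s \<Gamma> (Some (Pi NN (Pi D (?D' D)))) = Some (s', A4)"
      "elab N n \<Gamma> (Some NN) = Some (n', A3)"
      "fit N \<Gamma> (if n = Zero then z else case as_succ n of
        Some m \<Rightarrow> App (App s m) (NatE C z s m) | None \<Rightarrow> NatE C z' s' n') (inst D n) E = Some (t', T)"
    unfolding elab.simps by (auto simp: bind_eq_Some_conv simp del: One_nat_def)
  have "elaborates \<Gamma> C None C' K" using NatE.IH(1)[OF e(1)] NatE.prems by simp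
  note C = elaboratesD(1-4)[OF this]
  obtain i where D: "C = Lam NN D" "is_type \<Gamma> NN" "NN # \<Gamma> \<turnstile> D \<Colon> Univ i" "K = Pi NN (Univ i)"
    using motive_sound[OF e(2) C(4)] by metis
  note beta = beta_motive[OF D(2,3), folded D(1)] and step = natE_step[OF D(3) NatE.prems(3), folded D(1)]
  note s0 = t_zero[OF NatE.prems(3)]
  have "elaborates \<Gamma> z (Some (inst D Zero)) z' A2" "elaborates \<Gamma> s (Some (Pi NN (Pi D (?D' D)))) s' A4" "elaborates \<Gamma> n (Some NN) n' A3"
    using NatE.IH(2)[OF e(3)] NatE.IH(3)[OF e(4)] NatE.IH(4)[OF e(5)] NatE.prems D s0 step(1)
    by (auto intro: is_type_inst is_type_univ)
  note z = elaborates_SomeD[OF this(1)] and s = elaborates_SomeD[OF this(2)] and n = elaborates_SomeD[OF this(3)]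
  have Ct: "\<Gamma> \<turnstile> C \<Colon> Pi NN (Univ i)" using C(1) D(4) by simp
  have z: "\<Gamma> \<turnstile> z \<Colon> App C Zero" "\<Gamma> \<turnstile> z \<doteq> z' \<Colon> App C Zero"
    using z beta[OF s0] by (blast intro: t_conv e_conv e_sym)+
  have s: "\<Gamma> \<turnstile> s \<Colon> Pi NN (Pi (App (wk C) (Var 0)) (App (wk (wk C)) (Succ (Var 1))))"
      "\<Gamma> \<turnstile> s \<doteq> s' \<Colon> Pi NN (Pi (App (wk C) (Var 0)) (App (wk (wk C)) (Succ (Var 1))))"
    using s step(2) by (blast intro: t_conv' e_conv')+
  have bn: "\<Gamma> \<turnstile> App C n \<doteq> inst D n \<Colon> Univ i" using beta n by blast
  have 1: "\<Gamma> \<turnstile> NatE C z s n \<Colon> inst D n"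
    using t_natE[OF Ct z(1) s(1)] n bn by (blast intro: t_conv)
  \<comment> \<open>\<open>beta_succ\<close> wants the predecessor typed, which inversion extracts
    from the typing of the successor.\<close>
  have "\<Gamma> \<turnstile> m \<Colon> NN" if "n = Succ m" for m
    using n that inv_Succ by blast
  then have 2: "\<Gamma> \<turnstile> NatE C z s n \<doteq> (if n = Zero then z else case as_succ n of
        Some m \<Rightarrow> App (App s m) (NatE C z s m) | None \<Rightarrow> NatE C z' s' n') \<Colon> App C n"
    using beta_zero[OF Ct z(1) s(1)] beta_succ[OF Ct z(1) s(1)] c_natE[OF e_refl[OF Ct] z(2) s(2)] n
    by (auto simp: as_simps split: option.split)
  show ?case
    by (rule fit_sound[OF e(6) 1 e_conv[OF 2 bn]]) (use NatE.prems D n in \<open>auto intro: is_type_inst is_type_univ\<close>)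
next
  case (Trunc A)
  from Trunc.prems(1) obtain A' U i where e: "elab N A \<Gamma> None = Some (A', U)"
      "expose as_univ N \<Gamma> U = Some i" "fit N \<Gamma> (Trunc A') (Univ i) E = Some (t', T)"
    by (auto simp: bind_eq_Some_conv)
  have A: "\<Gamma> \<turnstile> A \<Colon> Univ i" "\<Gamma> \<turnstile> A \<doteq> A' \<Colon> Univ i"
    using type_sound[OF Trunc.IH(1)[OF e(1)] e(2)] Trunc.prems by auto
  show ?case
    by (rule fit_sound[OF e(3)]) (use A Trunc.prems in \<open>auto intro: t_trunc c_trunc is_type_Univ\<close>)
next
  case (TrI a)
  from TrI.prems(1) obtain a' A where e: "elab N a \<Gamma> (E \<bind> expose as_trunc N \<Gamma>) = Some (a', A)"
      "fit N \<Gamma> (TrI a) (Trunc A) E = Some (t', T)"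
    by (auto simp: bind_eq_Some_conv[of "elab _ _ _ _"])
  have "is_type_opt \<Gamma> (E \<bind> expose as_trunc N \<Gamma>)"
    using TrI.prems(2-4)
    by (auto simp: is_type_opt_def bind_eq_Some_conv as_simps split: option.split elim!: expose_sound dest: is_type_TruncD)
  then have "elaborates \<Gamma> a (E \<bind> expose as_trunc N \<Gamma>) a' A" using TrI.IH[OF e(1)] TrI.prems by blast
  note a = elaboratesD(1,3)[OF this]
  show ?case by (rule fit_sound[OF e(2)]) (use a TrI.prems in \<open>auto intro: t_trI e_refl is_type_Trunc\<close>)
next
  case (TrP s t)
  from TrP.prems(1) obtain s' S A u' A2 where e: "elab N s \<Gamma> None = Some (s', S)" "expose as_trunc N \<Gamma> S = Some A"
      "elab N t \<Gamma> (Some (Trunc A)) = Some (u', A2)" "fit N \<Gamma> (TrP s t) (Eq (Trunc A) s t) E = Some (t', T)"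
    by (auto simp: bind_eq_Some_conv)
  have rs: "elaborates \<Gamma> s None s' S" using TrP.IH(1)[OF e(1)] TrP.prems by simp
  obtain P where "as_trunc P = Some A" "is_type \<Gamma> P" "\<Gamma> \<turnstile> s \<Colon> P"
    using expose_elaborates[OF rs e(2)] TrP.prems by metis
  then have s: "is_type \<Gamma> (Trunc A)" "\<Gamma> \<turnstile> s \<Colon> Trunc A" by (auto simp: as_simps)
  have "elaborates \<Gamma> t (Some (Trunc A)) u' A2" using TrP.IH(2)[OF e(3)] TrP.prems s by simp
  note t = elaborates_SomeD[OF this]
  show ?case by (rule fit_sound[OF e(4)]) (use s t TrP.prems in \<open>auto intro: t_trP e_refl is_type_Eq\<close>)
next
  case (TrE h f t)
  from TrE.prems(1) obtain P h' A2 u' S A f' A3 where e: "E = Some P" "elab N h \<Gamma> (Some (isProp P)) = Some (h', A2)"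
      "elab N t \<Gamma> None = Some (u', S)" "expose as_trunc N \<Gamma> S = Some A" "elab N f \<Gamma> (Some (arrow A P)) = Some (f', A3)"
      "t' = TrE h f t" "T = P"
    by (auto simp: bind_eq_Some_conv)
  have P: "is_type \<Gamma> P" using e(1) TrE.prems by simp
  then have "elaborates \<Gamma> h (Some (isProp P)) h' A2" using TrE.IH(1)[OF e(2)] TrE.prems by (simp add: is_type_isProp)
  note h = elaborates_SomeD[OF this]
  have rt: "elaborates \<Gamma> t None u' S" using TrE.IH(3)[OF e(3)] TrE.prems by simp
  obtain Q where "as_trunc Q = Some A" "is_type \<Gamma> Q" "\<Gamma> \<turnstile> t \<Colon> Q"
    using expose_elaborates[OF rt e(4)] TrE.prems by metis
  then have t: "is_type \<Gamma> A" "\<Gamma> \<turnstile> t \<Colon> Trunc A" by (auto simp: as_simps dest: is_type_TruncD)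
  then have "elaborates \<Gamma> f (Some (arrow A P)) f' A3" using TrE.IH(2)[OF e(5)] TrE.prems P by (simp add: is_type_arrow)
  note f = elaborates_SomeD[OF this]
  obtain i where "\<Gamma> \<turnstile> P \<Colon> Univ i" using P by (auto simp: is_type_def)
  then have "\<Gamma> \<turnstile> TrE h f t \<Colon> P" using h f t by (blast intro: t_trE)
  then show ?case unfolding elaborates_def e(1,6,7) using P by (auto intro: e_refl)
next
  case (FunExt h)
  from FunExt.prems(1) obtain U f g A B h' A2 where e: "E = Some U" "expose as_eq N \<Gamma> U = Some (Pi A B, f, g)"
      "elab N h \<Gamma> (Some (Pi A (Eq B (App (wk f) (Var 0)) (App (wk g) (Var 0))))) = Some (h', A2)"
      "fit N \<Gamma> (FunExt h) (Eq (Pi A B) f g) E = Some (t', T)"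
    by (auto simp: bind_eq_Some_conv as_simps)
  have w: "is_type \<Gamma> (Eq (Pi A B) f g)"
    using expose_sound[OF e(2)] FunExt.prems e(1) by (auto simp: as_simps)
  then have fg: "is_type \<Gamma> A" "is_type (A # \<Gamma>) B" "\<Gamma> \<turnstile> f \<Colon> Pi A B" "\<Gamma> \<turnstile> g \<Colon> Pi A B"
    by (auto dest!: is_type_EqD is_type_PiD)
  have "A # \<Gamma> \<turnstile> App (wk u) (Var 0) \<Colon> B" if "\<Gamma> \<turnstile> u \<Colon> Pi A B" for u
    using t_app[of "A # \<Gamma>" "wk u" "wk A" "ren (upr Suc) B" "Var 0"] t_wk[OF fg(1) that] t_var0[OF fg(1)]
    by (simp add: inst_ren_upr_Var)
  with fg have "is_type \<Gamma> (Pi A (Eq B (App (wk f) (Var 0)) (App (wk g) (Var 0))))"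
    by (auto intro: is_type_Pi is_type_Eq)
  then have "elaborates \<Gamma> h (Some (Pi A (Eq B (App (wk f) (Var 0)) (App (wk g) (Var 0))))) h' A2"
    using FunExt.IH[OF e(3)] FunExt.prems by simp
  note h = elaborates_SomeD[OF this]
  have 1: "\<Gamma> \<turnstile> FunExt h \<Colon> Eq (Pi A B) f g" using h fg by (blast intro: t_funext)
  show ?case by (rule fit_sound[OF e(4) 1 e_refl[OF 1]]) (use FunExt.prems w e(1) in auto)
next
  case (PropExt h k f g)
  from PropExt.prems(1) obtain U P Q i h' A1 k' A2 f' A3 g' A4 where e: "E = Some U"
      "expose as_eq N \<Gamma> U = Some (Univ i, P, Q)"
      "elab N h \<Gamma> (Some (isProp P)) = Some (h', A1)" "elab N k \<Gamma> (Some (isProp Q)) = Some (k', A2)"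
      "elab N f \<Gamma> (Some (arrow P Q)) = Some (f', A3)" "elab N g \<Gamma> (Some (arrow Q P)) = Some (g', A4)"
      "fit N \<Gamma> (PropExt h k f g) (Eq (Univ i) P Q) E = Some (t', T)"
    by (auto simp: bind_eq_Some_conv as_simps)
  have w: "is_type \<Gamma> (Eq (Univ i) P Q)"
    using expose_sound[OF e(2)] PropExt.prems e(1) by (auto simp: as_simps)
  then have PQ: "\<Gamma> \<turnstile> P \<Colon> Univ i" "\<Gamma> \<turnstile> Q \<Colon> Univ i" by (auto dest: is_type_EqD)
  note PQw = this[THEN is_type_univ]
  have "elaborates \<Gamma> h (Some (isProp P)) h' A1" "elaborates \<Gamma> k (Some (isProp Q)) k' A2"
      "elaborates \<Gamma> f (Some (arrow P Q)) f' A3" "elaborates \<Gamma> g (Some (arrow Q P)) g' A4"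
    using PropExt.IH(1)[OF e(3)] PropExt.IH(2)[OF e(4)] PropExt.IH(3)[OF e(5)] PropExt.IH(4)[OF e(6)]
      PropExt.prems PQw by (auto simp: is_type_isProp is_type_arrow)
  note x = this[THEN elaborates_SomeD]
  have 1: "\<Gamma> \<turnstile> PropExt h k f g \<Colon> Eq (Univ i) P Q" using x PQ by (blast intro: t_propext)
  show ?case by (rule fit_sound[OF e(7) 1 e_refl[OF 1]]) (use PropExt.prems w e(1) in auto)
qed auto

text \<open>\<open>elab_sound\<close> holds for every sound normalizer, so induction on the fuel
  resolves the circularity between checking and normalizing.\<close>

lemma nf_sound: "sound (nf n)"
proof (induction n)
  case 0
  then show ?case by (simp add: sound_def)
next
  case (Suc n)
  show ?case
    unfolding sound_def
  proof (intro allI impI)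
    fix \<Gamma> A B assume c: "is_ctx \<Gamma>" and "nf (Suc n) \<Gamma> A = Some B"
    then obtain A' U i where e: "elab (nf n) A \<Gamma> None = Some (A', U)" "U = Univ i"
        "(if A' = A then Some A else nf n \<Gamma> A') = Some B"
      by (auto simp: bind_eq_Some_conv as_simps)
    note r = elaboratesD(1,2)[OF elab_sound[OF e(1) Suc c], simplified, unfolded e(2)]
    show "is_type \<Gamma> B \<and> conv \<Gamma> A B"
    proof (cases "A' = A")
      case True
      then show ?thesis using r e by (auto intro: is_type_univ conv_refl)
    next
      case False
      then have "is_type \<Gamma> B" "conv \<Gamma> A' B" using e Suc c by (auto simp: sound_def)
      moreover have "conv \<Gamma> A A'" using r(2) by (auto simp: conv_def)
      ultimately show ?thesis by (blast intro: conv_trans)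
    qed
  qed
qed

theorem checks_sound:
  assumes "checks n t T"
  shows "[] \<turnstile> t \<Colon> T" and "is_type [] T"
proof -
  obtain T' U i t' V where e: "elab (nf n) T [] None = Some (T', U)" "U = Univ i"
      "elab (nf n) t [] (Some T) = Some (t', V)"
    using assms by (auto simp: checks_def as_simps split: option.splits)
  show T: "is_type [] T"
    using elaboratesD(1)[OF elab_sound[OF e(1) nf_sound ctx_nil]] e(2) by (auto intro: is_type_univ)
  then show "[] \<turnstile> t \<Colon> T"
    using elaborates_SomeD[OF elab_sound[OF e(3) nf_sound ctx_nil]] by simp
qed

section \<open>Named syntax\<close>

text \<open>A named term is a function of the number of enclosing binders: the variable bound below \<open>n\<close>
  binders has index \<open>m - Suc n\<close> below \<open>m\<close> binders.\<close>

type_synonym ntm = "nat \<Rightarrow> tm"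

named_theorems nm

definition nPi :: "ntm \<Rightarrow> (ntm \<Rightarrow> ntm) \<Rightarrow> ntm" where
  [nm]: "nPi A B n = Pi (A n) (B (\<lambda>m. Var (m - Suc n)) (Suc n))"

definition nLam :: "ntm \<Rightarrow> (ntm \<Rightarrow> ntm) \<Rightarrow> ntm" where
  [nm]: "nLam A B n = Lam (A n) (B (\<lambda>m. Var (m - Suc n)) (Suc n))"

definition nSig :: "ntm \<Rightarrow> (ntm \<Rightarrow> ntm) \<Rightarrow> ntm" where
  [nm]: "nSig A B n = Sig (A n) (B (\<lambda>m. Var (m - Suc n)) (Suc n))"

syntax
  "_nPi" :: "pttrn \<Rightarrow> ntm \<Rightarrow> ntm \<Rightarrow> ntm"  ("(3\<Pi> _\<in>_./ _)" [0, 51, 10] 10)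
  "_nLam" :: "pttrn \<Rightarrow> ntm \<Rightarrow> ntm \<Rightarrow> ntm"  ("(3\<Lambda> _\<in>_./ _)" [0, 51, 10] 10)
  "_nSig" :: "pttrn \<Rightarrow> ntm \<Rightarrow> ntm \<Rightarrow> ntm"  ("(3\<Sigma> _\<in>_./ _)" [0, 51, 10] 10)
translations
  "\<Pi> x\<in>A. B" \<rightleftharpoons> "CONST nPi A (\<lambda>x. B)"
  "\<Lambda> x\<in>A. B" \<rightleftharpoons> "CONST nLam A (\<lambda>x. B)"
  "\<Sigma> x\<in>A. B" \<rightleftharpoons> "CONST nSig A (\<lambda>x. B)"

definition nArr :: "ntm \<Rightarrow> ntm \<Rightarrow> ntm" (infixr "\<leadsto>" 55) where
  [nm]: "(A \<leadsto> B) = (\<Pi> x\<in>A. B)"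

definition nTimes :: "ntm \<Rightarrow> ntm \<Rightarrow> ntm" (infixr "\<otimes>" 56) where
  [nm]: "(A \<otimes> B) = (\<Sigma> x\<in>A. B)"

definition nApp :: "ntm \<Rightarrow> ntm \<Rightarrow> ntm" (infixl "\<cdot>" 90) where
  [nm]: "(f \<cdot> a) n = App (f n) (a n)"

definition nEq :: "ntm \<Rightarrow> ntm \<Rightarrow> ntm \<Rightarrow> ntm" ("(_ \<simeq>\<^bsub>_\<^esub>/ _)" [61, 0, 61] 60) where
  [nm]: "(a \<simeq>\<^bsub>A\<^esub> b) n = Eq (A n) (a n) (b n)"

definition nU :: "nat \<Rightarrow> ntm" where [nm]: "nU i n = Univ i"

definition nRefl :: "ntm \<Rightarrow> ntm" where [nm]: "nRefl a n = Refl (a n)"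

definition nJ :: "ntm \<Rightarrow> ntm \<Rightarrow> (ntm \<Rightarrow> ntm \<Rightarrow> ntm) \<Rightarrow> ntm \<Rightarrow> ntm \<Rightarrow> ntm" where
  [nm]: "nJ A a C c p n = J ((\<Lambda> x\<in>A. \<Lambda> q\<in>a \<simeq>\<^bsub>A\<^esub> x. C x q) n) (c n) (p n)"

definition nPr :: "ntm \<Rightarrow> ntm \<Rightarrow> ntm" ("\<lparr>_,/ _\<rparr>") where [nm]: "\<lparr>a, b\<rparr> n = Pr (a n) (b n)"

definition nFst :: "ntm \<Rightarrow> ntm" where [nm]: "nFst p n = Fst (p n)"

definition nSnd :: "ntm \<Rightarrow> ntm" where [nm]: "nSnd p n = Snd (p n)"

definition nEmpty :: ntm where [nm]: "nEmpty n = Empty"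

definition nEmptyE :: "ntm \<Rightarrow> ntm \<Rightarrow> ntm" where
  [nm]: "nEmptyE C e n = EmptyE ((\<Lambda> x\<in>nEmpty. C) n) (e n)"

definition nOne :: ntm where [nm]: "nOne n = One"

definition nStar :: ntm where [nm]: "nStar n = Star"

definition nOneE :: "(ntm \<Rightarrow> ntm) \<Rightarrow> ntm \<Rightarrow> ntm \<Rightarrow> ntm" where
  [nm]: "nOneE C c t n = OneE ((\<Lambda> x\<in>nOne. C x) n) (c n) (t n)"

definition nTwo :: ntm where [nm]: "nTwo n = Two"

definition n0 :: ntm where [nm]: "n0 n = B0"

definition n1 :: ntm where [nm]: "n1 n = B1"

definition nTwoE :: "(ntm \<Rightarrow> ntm) \<Rightarrow> ntm \<Rightarrow> ntm \<Rightarrow> ntm \<Rightarrow> ntm" where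
  [nm]: "nTwoE C c d t n = TwoE ((\<Lambda> x\<in>nTwo. C x) n) (c n) (d n) (t n)"

definition nNat :: ntm where [nm]: "nNat n = NN"

definition nZero :: ntm where [nm]: "nZero n = Zero"

definition nSucc :: "ntm \<Rightarrow> ntm" where [nm]: "nSucc t n = Succ (t n)"

definition nNatE :: "(ntm \<Rightarrow> ntm) \<Rightarrow> ntm \<Rightarrow> ntm \<Rightarrow> ntm \<Rightarrow> ntm" where
  [nm]: "nNatE C z s t n = NatE ((\<Lambda> x\<in>nNat. C x) n) (z n) (s n) (t n)"

definition nTr :: "ntm \<Rightarrow> ntm" where [nm]: "nTr A n = Trunc (A n)"

definition nTrI :: "ntm \<Rightarrow> ntm" where [nm]: "nTrI a n = TrI (a n)"

definition nTrP :: "ntm \<Rightarrow> ntm \<Rightarrow> ntm" where [nm]: "nTrP s t n = TrP (s n) (t n)"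

definition nTrE :: "ntm \<Rightarrow> ntm \<Rightarrow> ntm \<Rightarrow> ntm" where [nm]: "nTrE h f t n = TrE (h n) (f n) (t n)"

definition nFunExt :: "ntm \<Rightarrow> ntm" where [nm]: "nFunExt h n = FunExt (h n)"

definition nPropExt :: "ntm \<Rightarrow> ntm \<Rightarrow> ntm \<Rightarrow> ntm \<Rightarrow> ntm" where
  [nm]: "nPropExt h k f g n = PropExt (h n) (k n) (f n) (g n)"

definition nSym :: "ntm \<Rightarrow> ntm \<Rightarrow> ntm \<Rightarrow> ntm" where
  [nm]: "nSym A a p = nJ A a (\<lambda>x _. x \<simeq>\<^bsub>A\<^esub> a) (nRefl a) p"

definition nTrans :: "ntm \<Rightarrow> ntm \<Rightarrow> ntm \<Rightarrow> ntm \<Rightarrow> ntm \<Rightarrow> ntm" where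
  [nm]: "nTrans A a b p q = nJ A b (\<lambda>x _. a \<simeq>\<^bsub>A\<^esub> x) p q"

definition nIsProp :: "ntm \<Rightarrow> ntm" where
  [nm]: "nIsProp A = (\<Pi> x\<in>A. \<Pi> y\<in>A. x \<simeq>\<^bsub>A\<^esub> y)"

section \<open>Evaluating the checker on closed statements\<close>

definition frozen :: "tm list \<Rightarrow> tm list" where
  "frozen \<Gamma> = \<Gamma>"

text \<open>The simplifier evaluates the checker; the congruence rule for \<open>frozen\<close> keeps it from
  traversing the context again at every step.\<close>

lemma frozen_cong: "frozen \<Gamma> = frozen \<Gamma>"
  by (rule refl)

lemma bind_weak_cong: "m = m' \<Longrightarrow> Option.bind m f = Option.bind m' f"
  by simp

lemma frozen_simps:
  "A # frozen \<Gamma> = frozen (A # \<Gamma>)"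
  "length (frozen []) = 0" "length (frozen (A # \<Gamma>)) = Suc (length (frozen \<Gamma>))"
  "frozen (A # \<Gamma>) ! 0 = A" "frozen (A # \<Gamma>) ! Suc n = frozen \<Gamma> ! n"
  by (simp_all add: frozen_def)

lemma checks_frozen:
  "checks n t T \<longleftrightarrow> (case elab (nf n) T (frozen []) None of None \<Rightarrow> False | Some (_, U) \<Rightarrow>
     as_univ U \<noteq> None \<and> elab (nf n) t (frozen []) (Some T) \<noteq> None)"
  by (simp only: checks_def frozen_def)

text \<open>An established statement becomes a hypothesis in front of later ones and thus moves
  under binders. It has to be the same term at every binder depth and be fixed by renaming.\<close>

definition closed :: "ntm \<Rightarrow> bool" where
  "closed T \<longleftrightarrow> (\<forall>n. T n = T 0) \<and> (\<forall>\<xi>. ren \<xi> (T 0) = T 0)"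

definition holds :: "ntm \<Rightarrow> bool" where
  "holds T \<longleftrightarrow> closed T \<and> inhabited (T 0)"

lemma closed_arr: "closed H \<Longrightarrow> closed T \<Longrightarrow> closed (H \<leadsto> T)"
  by (simp add: closed_def nArr_def nPi_def) metis

lemma holds_mp:
  assumes "holds H" "holds (H \<leadsto> T)" "closed T"
  shows "holds T"
proof -
  obtain t h where t: "[] \<turnstile> t \<Colon> Pi (H 0) (T (Suc 0))" "[] \<turnstile> h \<Colon> H 0"
    using assms by (auto simp: holds_def inhabited_def nArr_def nPi_def)
  have "T (Suc 0) = wk (T 0)"
    using assms(3) by (simp add: closed_def)
  then have "[] \<turnstile> App t h \<Colon> T 0"
    using t_app[OF t] by (simp add: inst_wk)
  with assms(3) show ?thesis
    by (auto simp: holds_def inhabited_def)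
qed

text \<open>A result is checked as a function of the earlier results \<open>Hs\<close> that it uses.
  These are variables for the checker, so no earlier proof term is ever evaluated again. The fuel is
  spelled with \<open>Suc\<close> so that the equations of \<open>nf\<close> apply.\<close>

lemma holdsI:
  assumes "\<forall>H\<in>set Hs. holds H" "closed T"
    and "checks (Suc (Suc (Suc (Suc (Suc (Suc (Suc (Suc 0)))))))) (t 0) (foldr (\<leadsto>) Hs T 0)"
  shows "holds T"
proof -
  have "closed (foldr (\<leadsto>) Hs T)"
    using assms(1,2) by (induction Hs) (auto simp: holds_def closed_arr)
  then have "holds (foldr (\<leadsto>) Hs T)"
    using checks_sound(1)[OF assms(3)] by (auto simp: holds_def inhabited_def)
  then show ?thesis
    using assms(1,2)
  proof (induction Hs)
    case (Cons H Hs)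
    have "closed (foldr (\<leadsto>) Hs T)"
      using Cons.prems(2,3) by (induction Hs) (auto simp: holds_def closed_arr)
    with Cons show ?case
      by (auto intro: holds_mp)
  qed simp
qed

lemmas eval = Let_def closed_def checks_frozen frozen_simps fit_def expose_def subty_def motive_def
  inst_def isProp_def arrow_def

lemmas eval_cong = bind_weak_cong frozen_cong

section \<open>Propositions and sets\<close>

text \<open>The left side is the inverse of \<open>r\<close> followed by \<open>r\<close>, obtained
  by transporting \<open>r\<close> along itself in its left endpoint.\<close>

definition cancel_ty :: "nat \<Rightarrow> ntm" where
  [nm]: "cancel_ty i = (\<Pi> A\<in>nU i. \<Pi> a\<in>A. \<Pi> y\<in>A. \<Pi> r\<in>a \<simeq>\<^bsub>A\<^esub> y.
     nJ A a (\<lambda>z _. z \<simeq>\<^bsub>A\<^esub> y) r r \<simeq>\<^bsub>y \<simeq>\<^bsub>A\<^esub> y\<^esub> nRefl y)"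

lemma cancel: "holds (cancel_ty i)"
  by (rule holdsI[where Hs = "[]" and
      t = "\<Lambda> A\<in>nU i. \<Lambda> a\<in>A. \<Lambda> y\<in>A. \<Lambda> r\<in>a \<simeq>\<^bsub>A\<^esub> y.
     nJ A a (\<lambda>y r. nJ A a (\<lambda>z _. z \<simeq>\<^bsub>A\<^esub> y) r r \<simeq>\<^bsub>y \<simeq>\<^bsub>A\<^esub> y\<^esub> nRefl y) (nRefl (nRefl a)) r"],
    simp, simp_all add: nm eval cong: eval_cong)

text \<open>Hedberg's argument: \<open>p\<close> equals the inverse of \<open>k a refl\<close> followed by \<open>k x p\<close>, which does not
  depend on \<open>p\<close>.\<close>

definition hedberg_ty :: "nat \<Rightarrow> ntm" where
  [nm]: "hedberg_ty i = (\<Pi> A\<in>nU i. \<Pi> a\<in>A. \<Pi> k\<in>(\<Pi> x\<in>A. a \<simeq>\<^bsub>A\<^esub> x \<leadsto> a \<simeq>\<^bsub>A\<^esub> x).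
     (\<Pi> x\<in>A. \<Pi> p\<in>a \<simeq>\<^bsub>A\<^esub> x. \<Pi> q\<in>a \<simeq>\<^bsub>A\<^esub> x. k \<cdot> x \<cdot> p \<simeq>\<^bsub>a \<simeq>\<^bsub>A\<^esub> x\<^esub> k \<cdot> x \<cdot> q) \<leadsto>
     (\<Pi> x\<in>A. nIsProp (a \<simeq>\<^bsub>A\<^esub> x)))"

lemma hedberg: "holds (hedberg_ty i)"
  by (rule holdsI[where Hs = "[cancel_ty i]" and
      t = "\<Lambda> c\<in>cancel_ty i. \<Lambda> A\<in>nU i. \<Lambda> a\<in>A. \<Lambda> k\<in>(\<Pi> x\<in>A. a \<simeq>\<^bsub>A\<^esub> x \<leadsto> a \<simeq>\<^bsub>A\<^esub> x).
     \<Lambda> kc\<in>(\<Pi> x\<in>A. \<Pi> p\<in>a \<simeq>\<^bsub>A\<^esub> x. \<Pi> q\<in>a \<simeq>\<^bsub>A\<^esub> x. k \<cdot> x \<cdot> p \<simeq>\<^bsub>a \<simeq>\<^bsub>A\<^esub> x\<^esub> k \<cdot> x \<cdot> q).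
     \<Lambda> x\<in>A. \<Lambda> p\<in>a \<simeq>\<^bsub>A\<^esub> x. \<Lambda> q\<in>a \<simeq>\<^bsub>A\<^esub> x.
     (let r = k \<cdot> a \<cdot> nRefl a;
          L = (\<lambda>x s. nJ A a (\<lambda>z _. z \<simeq>\<^bsub>A\<^esub> x) s r);
          e = (\<lambda>x p. nJ A a (\<lambda>x p. L x (k \<cdot> x \<cdot> p) \<simeq>\<^bsub>a \<simeq>\<^bsub>A\<^esub> x\<^esub> p) (c \<cdot> A \<cdot> a \<cdot> a \<cdot> r) p);
          X = a \<simeq>\<^bsub>A\<^esub> x; lp = L x (k \<cdot> x \<cdot> p); lq = L x (k \<cdot> x \<cdot> q)
      in nTrans X p lp (nSym X lp (e x p))
           (nTrans X lp lq (nJ X (k \<cdot> x \<cdot> p) (\<lambda>w _. lp \<simeq>\<^bsub>X\<^esub> L x w) (nRefl lp) (kc \<cdot> x \<cdot> p \<cdot> q)) (e x q)))"],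
    simp add: cancel, simp_all add: nm eval cong: eval_cong)

definition isPropIsProp_ty :: "nat \<Rightarrow> ntm" where
  [nm]: "isPropIsProp_ty i = (\<Pi> X\<in>nU i. nIsProp (nIsProp X))"

text \<open>A proposition is a set: \<open>f \<cdot> x \<cdot> z\<close> ignores the given path, so
  it is the constant map on paths that Hedberg's argument asks for. Hence \<open>f\<close> and
  \<open>g\<close> agree pointwise, and function extensionality is applied once per
  argument.\<close>

lemma isPropIsProp: "holds (isPropIsProp_ty i)"
  by (rule holdsI[where Hs = "[hedberg_ty i]" and
      t = "\<Lambda> hb\<in>hedberg_ty i. \<Lambda> X\<in>nU i. \<Lambda> f\<in>nIsProp X. \<Lambda> g\<in>nIsProp X.
     nFunExt (\<Lambda> x\<in>X. nFunExt (\<Lambda> y\<in>X. hb \<cdot> X \<cdot> x \<cdot> (\<Lambda> z\<in>X. \<Lambda> _\<in>x \<simeq>\<^bsub>X\<^esub> z. f \<cdot> x \<cdot> z)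
       \<cdot> (\<Lambda> z\<in>X. \<Lambda> _\<in>x \<simeq>\<^bsub>X\<^esub> z. \<Lambda> _\<in>x \<simeq>\<^bsub>X\<^esub> z. nRefl (f \<cdot> x \<cdot> z)) \<cdot> y \<cdot> (f \<cdot> x \<cdot> y) \<cdot> (g \<cdot> x \<cdot> y)))"],
    simp add: hedberg, simp_all add: nm eval cong: eval_cong)

section \<open>The booleans form a set\<close>

definition no01_ty :: ntm where [nm]: "no01_ty = (n0 \<simeq>\<^bsub>nTwo\<^esub> n1 \<leadsto> nEmpty)"

text \<open>\<open>Star\<close> is transported along the path in the family that is
  \<open>One\<close> at \<open>n0\<close> and \<open>Empty\<close> at \<open>n1\<close>.\<close>

lemma no01: "holds no01_ty"
  by (rule holdsI[where Hs = "[]" and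
      t = "\<Lambda> p\<in>n0 \<simeq>\<^bsub>nTwo\<^esub> n1. nJ nTwo n0 (\<lambda>x _. nTwoE (\<lambda>_. nU 0) nOne nEmpty x) nStar p"],
    simp, simp_all add: nm eval cong: eval_cong)

definition twoK_ty :: ntm where
  [nm]: "twoK_ty = (\<Pi> a\<in>nTwo. \<Pi> x\<in>nTwo. \<Sigma> k\<in>(a \<simeq>\<^bsub>nTwo\<^esub> x \<leadsto> a \<simeq>\<^bsub>nTwo\<^esub> x).
     \<Pi> p\<in>a \<simeq>\<^bsub>nTwo\<^esub> x. \<Pi> q\<in>a \<simeq>\<^bsub>nTwo\<^esub> x. k \<cdot> p \<simeq>\<^bsub>a \<simeq>\<^bsub>nTwo\<^esub> x\<^esub> k \<cdot> q)"

text \<open>Both endpoints are split. If they coincide, the constant map at reflexivity works; if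
  they differ, there are no paths and the identity is constant vacuously.\<close>

lemma twoK: "holds twoK_ty"
  by (rule holdsI[where Hs = "[no01_ty]" and
      t = "\<Lambda> no\<in>no01_ty. \<Lambda> a\<in>nTwo. \<Lambda> x\<in>nTwo.
     (let C = (\<lambda>a x. \<Sigma> k\<in>(a \<simeq>\<^bsub>nTwo\<^esub> x \<leadsto> a \<simeq>\<^bsub>nTwo\<^esub> x).
            \<Pi> p\<in>a \<simeq>\<^bsub>nTwo\<^esub> x. \<Pi> q\<in>a \<simeq>\<^bsub>nTwo\<^esub> x. k \<cdot> p \<simeq>\<^bsub>a \<simeq>\<^bsub>nTwo\<^esub> x\<^esub> k \<cdot> q);
          same = (\<lambda>a. \<lparr>\<Lambda> p\<in>a \<simeq>\<^bsub>nTwo\<^esub> a. nRefl a,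
            \<Lambda> p\<in>a \<simeq>\<^bsub>nTwo\<^esub> a. \<Lambda> q\<in>a \<simeq>\<^bsub>nTwo\<^esub> a. nRefl (nRefl a)\<rparr>);
          diff = (\<lambda>a x h. \<lparr>\<Lambda> p\<in>a \<simeq>\<^bsub>nTwo\<^esub> x. p,
            \<Lambda> p\<in>a \<simeq>\<^bsub>nTwo\<^esub> x. \<Lambda> q\<in>a \<simeq>\<^bsub>nTwo\<^esub> x. nEmptyE (p \<simeq>\<^bsub>a \<simeq>\<^bsub>nTwo\<^esub> x\<^esub> q) (h p)\<rparr>)
      in nTwoE (\<lambda>a. C a x)
           (nTwoE (\<lambda>x. C n0 x) (same n0) (diff n0 n1 (\<lambda>p. no \<cdot> p)) x)
           (nTwoE (\<lambda>x. C n1 x) (diff n1 n0 (\<lambda>p. no \<cdot> nSym nTwo n1 p)) (same n1) x) a)"],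
    simp add: no01, simp_all add: nm eval cong: eval_cong)

definition twoSet_ty :: ntm where
  [nm]: "twoSet_ty = (\<Pi> a\<in>nTwo. \<Pi> x\<in>nTwo. nIsProp (a \<simeq>\<^bsub>nTwo\<^esub> x))"

lemma twoSet: "holds twoSet_ty"
  by (rule holdsI[where Hs = "[hedberg_ty 0, twoK_ty]" and
      t = "\<Lambda> hb\<in>hedberg_ty 0. \<Lambda> k\<in>twoK_ty. \<Lambda> a\<in>nTwo. \<Lambda> x\<in>nTwo.
     hb \<cdot> nTwo \<cdot> a \<cdot> (\<Lambda> y\<in>nTwo. nFst (k \<cdot> a \<cdot> y)) \<cdot> (\<Lambda> y\<in>nTwo. nSnd (k \<cdot> a \<cdot> y)) \<cdot> x"],
    simp add: hedberg twoK, simp_all add: nm eval cong: eval_cong)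

section \<open>Equality in dependent sums\<close>

definition sigEta_ty :: "nat \<Rightarrow> ntm" where
  [nm]: "sigEta_ty i = (\<Pi> A\<in>nU i. \<Pi> B\<in>A \<leadsto> nU i. \<Pi> x\<in>(\<Sigma> a\<in>A. B \<cdot> a).
     \<lparr>nFst x, nSnd x\<rparr> \<simeq>\<^bsub>\<Sigma> a\<in>A. B \<cdot> a\<^esub> x)"

lemma conv_Pi:
  assumes "is_type \<Gamma> A" "conv (A # \<Gamma>) B B'"
  shows "conv \<Gamma> (Pi A B) (Pi A B')"
proof -
  obtain i j where "\<Gamma> \<turnstile> A \<Colon> Univ i" "A # \<Gamma> \<turnstile> B \<doteq> B' \<Colon> Univ j"
    using assms by (auto simp: is_type_def conv_def)
  then have "\<Gamma> \<turnstile> A \<Colon> Univ (max i j)" "A # \<Gamma> \<turnstile> B \<doteq> B' \<Colon> Univ (max i j)"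
    using cumul(1)[of i "max i j"] cumul(2)[of j "max i j"] by auto
  then show ?thesis
    unfolding conv_def by (blast intro: c_pi e_refl)
qed

text \<open>The checker has no \<open>\<eta>\<close>-rule for pairs, so this one is derived by hand.\<close>

lemma sigEta: "holds (sigEta_ty i)"
proof -
  let ?A = "Univ i" and ?B = "Pi (Var 0) (Univ i)"
  let ?S = "Sig (Var (Suc 0)) (App (Var (Suc 0)) (Var 0))"
  let ?S' = "Sig (Var (Suc (Suc 0))) (App (Var (Suc (Suc 0))) (Var 0))"
  let ?x = "Var 0"
  let ?t = "Lam ?A (Lam ?B (Lam ?S (Refl ?x)))" and ?T = "Pi ?A (Pi ?B (Pi ?S (Eq ?S' ?x ?x)))"
  let ?T' = "Pi ?A (Pi ?B (Pi ?S (Eq ?S' (Pr (Fst ?x) (Snd ?x)) ?x)))"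
  have "checks (Suc (Suc 0)) ?t ?T"
    by (simp add: nm eval cong: eval_cong)
  note T = checks_sound[OF this]
  then have w: "is_type [] ?A" "is_type [?A] ?B" "is_type [?B, ?A] ?S" "is_type [?S, ?B, ?A] (Eq ?S' ?x ?x)"
    by (blast dest: is_type_PiD)+
  obtain j where x: "[?S, ?B, ?A] \<turnstile> ?x \<Colon> ?S'" "[?S, ?B, ?A] \<turnstile> ?S' \<Colon> Univ j"
    using is_type_EqD[OF w(4)] unfolding is_type_def by blast
  \<comment> \<open>Reflexivity was checked for \<open>?x\<close> on both sides; the eta rule
    expands the left occurrence, and congruence of \<open>Pi\<close> carries this conversion out of
    the three binders.\<close>
  have "conv [?S, ?B, ?A] (Eq ?S' ?x ?x) (Eq ?S' (Pr (Fst ?x) (Snd ?x)) ?x)"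
    unfolding conv_def using c_eq[OF e_refl[OF x(2)] eta_sig[OF x(1)] e_refl[OF x(1)]] by blast
  then have "conv [] ?T ?T'"
    by (intro conv_Pi w)
  with T(1) have "[] \<turnstile> ?t \<Colon> ?T'"
    by (rule t_conv')
  then have "inhabited ?T'"
    unfolding inhabited_def by blast
  then show ?thesis
    by (simp add: holds_def nm eval)
qed

text \<open>Base points are to be equal only where the fibres are inhabited. For \<open>nOcc\<close>
  the base is the type of natural numbers, and uniqueness of the 1 gives exactly this much.\<close>

definition sigProp_ty :: "nat \<Rightarrow> ntm" where
  [nm]: "sigProp_ty i = (\<Pi> A\<in>nU i. \<Pi> B\<in>A \<leadsto> nU i.
     (\<Pi> x\<in>A. \<Pi> y\<in>A. B \<cdot> x \<leadsto> B \<cdot> y \<leadsto> x \<simeq>\<^bsub>A\<^esub> y) \<leadsto> (\<Pi> x\<in>A. B \<cdot> x \<leadsto> nIsProp (B \<cdot> x)) \<leadsto>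
     nIsProp (\<Sigma> a\<in>A. B \<cdot> a))"

text \<open>Once \<open>x\<close> and \<open>y\<close> are replaced by literal pairs, the second
  component of \<open>y\<close> is generalized to \<open>v\<close>. This lets path induction act on
  the base first, after which \<open>v\<close> lies in the same fibre as \<open>nSnd x\<close> and a
  second path induction finishes.\<close>

lemma sigProp: "holds (sigProp_ty i)"
  by (rule holdsI[where Hs = "[sigEta_ty i]" and
      t = "\<Lambda> eta\<in>sigEta_ty i. \<Lambda> A\<in>nU i. \<Lambda> B\<in>A \<leadsto> nU i.
     \<Lambda> h\<in>(\<Pi> x\<in>A. \<Pi> y\<in>A. B \<cdot> x \<leadsto> B \<cdot> y \<leadsto> x \<simeq>\<^bsub>A\<^esub> y). \<Lambda> k\<in>(\<Pi> x\<in>A. B \<cdot> x \<leadsto> nIsProp (B \<cdot> x)).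
     \<Lambda> x\<in>(\<Sigma> a\<in>A. B \<cdot> a). \<Lambda> y\<in>(\<Sigma> a\<in>A. B \<cdot> a).
     (let S = (\<Sigma> a\<in>A. B \<cdot> a); a = nFst x; b = nFst y; x' = \<lparr>a, nSnd x\<rparr>; y' = \<lparr>b, nSnd y\<rparr>
      in nTrans S x x' (nSym S x' (eta \<cdot> A \<cdot> B \<cdot> x))
          (nTrans S x' y'
            (nJ A a (\<lambda>z _. \<Pi> v\<in>B \<cdot> z. x' \<simeq>\<^bsub>S\<^esub> \<lparr>z, v\<rparr>)
              (\<Lambda> v\<in>B \<cdot> a. nJ (B \<cdot> a) (nSnd x) (\<lambda>w _. x' \<simeq>\<^bsub>S\<^esub> \<lparr>a, w\<rparr>) (nRefl x') (k \<cdot> a \<cdot> nSnd x \<cdot> nSnd x \<cdot> v))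
              (h \<cdot> a \<cdot> b \<cdot> nSnd x \<cdot> nSnd y) \<cdot> nSnd y)
            (eta \<cdot> A \<cdot> B \<cdot> y)))"],
    simp add: sigEta, simp_all add: nm eval cong: eval_cong)

section \<open>Rosolini structures\<close>

definition nSeq :: ntm where [nm]: "nSeq = (nNat \<leadsto> nTwo)"

definition nOcc :: "ntm \<Rightarrow> ntm" where [nm]: "nOcc \<alpha> = (\<Sigma> n\<in>nNat. \<alpha> \<cdot> n \<simeq>\<^bsub>nTwo\<^esub> n1)"

definition nNinf :: ntm where [nm]: "nNinf = (\<Sigma> \<alpha>\<in>nSeq. nIsProp (nOcc \<alpha>))"

definition nRos :: "nat \<Rightarrow> ntm \<Rightarrow> ntm" where
  [nm]: "nRos i P = (\<Sigma> u\<in>nNinf. P \<simeq>\<^bsub>nU i\<^esub> nOcc (nFst u))"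

definition nIsRos :: "nat \<Rightarrow> ntm" where [nm]: "nIsRos i = (\<Lambda> X\<in>nU i. nTr (nRos i X))"

text \<open>The elementary form of \<open>nIsProp (nOcc \<alpha>)\<close>: it speaks of positions
  alone, and \<open>twoSet\<close> takes care of the proofs that the entries are 1.\<close>

definition nAmo :: "ntm \<Rightarrow> ntm" where
  [nm]: "nAmo \<alpha> = (\<Pi> n\<in>nNat. \<Pi> m\<in>nNat. \<alpha> \<cdot> n \<simeq>\<^bsub>nTwo\<^esub> n1 \<leadsto> \<alpha> \<cdot> m \<simeq>\<^bsub>nTwo\<^esub> n1 \<leadsto> n \<simeq>\<^bsub>nNat\<^esub> m)"

definition amoProp_ty :: ntm where
  [nm]: "amoProp_ty = (\<Pi> \<alpha>\<in>nSeq. nAmo \<alpha> \<leadsto> nIsProp (nOcc \<alpha>))"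

lemma amoProp: "holds amoProp_ty"
  by (rule holdsI[where Hs = "[sigProp_ty 0, twoSet_ty]" and
      t = "\<Lambda> sp\<in>sigProp_ty 0. \<Lambda> ts\<in>twoSet_ty. \<Lambda> \<alpha>\<in>nSeq. \<Lambda> m\<in>nAmo \<alpha>.
     sp \<cdot> nNat \<cdot> (\<Lambda> n\<in>nNat. \<alpha> \<cdot> n \<simeq>\<^bsub>nTwo\<^esub> n1) \<cdot> m \<cdot> (\<Lambda> n\<in>nNat. \<Lambda> e\<in>\<alpha> \<cdot> n \<simeq>\<^bsub>nTwo\<^esub> n1. ts \<cdot> (\<alpha> \<cdot> n) \<cdot> n1)"],
    simp add: sigProp twoSet, simp_all add: nm eval cong: eval_cong)

definition propAmo_ty :: ntm where
  [nm]: "propAmo_ty = (\<Pi> \<alpha>\<in>nSeq. nIsProp (nOcc \<alpha>) \<leadsto> nAmo \<alpha>)"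

lemma propAmo: "holds propAmo_ty"
  by (rule holdsI[where Hs = "[]" and
      t = "\<Lambda> \<alpha>\<in>nSeq. \<Lambda> h\<in>nIsProp (nOcc \<alpha>). \<Lambda> n\<in>nNat. \<Lambda> m\<in>nNat.
     \<Lambda> e\<in>\<alpha> \<cdot> n \<simeq>\<^bsub>nTwo\<^esub> n1. \<Lambda> d\<in>\<alpha> \<cdot> m \<simeq>\<^bsub>nTwo\<^esub> n1.
     nJ (nOcc \<alpha>) \<lparr>n, e\<rparr> (\<lambda>z _. n \<simeq>\<^bsub>nNat\<^esub> nFst z) (nRefl n) (h \<cdot> \<lparr>n, e\<rparr> \<cdot> \<lparr>m, d\<rparr>)"],
    simp, simp_all add: nm eval cong: eval_cong)

definition rosProp_ty :: "nat \<Rightarrow> ntm" where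
  [nm]: "rosProp_ty i = (\<Pi> X\<in>nU i. nRos i X \<leadsto> nIsProp X)"

text \<open>Path induction runs on the motive \<open>nIsProp Y \<leadsto> nIsProp X\<close>, so it
  transports propositionhood from the occurrence type back to \<open>X\<close> without inverting the
  path.\<close>

lemma rosProp: "holds (rosProp_ty i)"
  by (rule holdsI[where Hs = "[]" and
      t = "\<Lambda> X\<in>nU i. \<Lambda> s\<in>nRos i X.
     nJ (nU i) X (\<lambda>Y _. nIsProp Y \<leadsto> nIsProp X) (\<Lambda> h\<in>nIsProp X. h) (nSnd s) \<cdot> nSnd (nFst s)"],
    simp, simp_all add: nm eval cong: eval_cong)

definition ros_ty :: "nat \<Rightarrow> ntm" where
  [nm]: "ros_ty i = (\<Pi> X\<in>nU i. nIsProp X \<leadsto> (\<Pi> w\<in>nNinf.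
     (X \<leadsto> nOcc (nFst w)) \<leadsto> (nOcc (nFst w) \<leadsto> X) \<leadsto> nRos i X))"

lemma ros: "holds (ros_ty i)"
  by (rule holdsI[where Hs = "[]" and
      t = "\<Lambda> X\<in>nU i. \<Lambda> h\<in>nIsProp X. \<Lambda> w\<in>nNinf.
     \<Lambda> f\<in>X \<leadsto> nOcc (nFst w). \<Lambda> g\<in>nOcc (nFst w) \<leadsto> X. \<lparr>w, nPropExt h (nSnd w) f g\<rparr>"],
    simp, simp_all add: nm eval cong: eval_cong)

text \<open>The sequence 1, 0, 0, ... witnesses that the unit type carries a Rosolini
  structure.\<close>

definition nDelta :: ntm where
  [nm]: "nDelta = (\<Lambda> n\<in>nNat. nNatE (\<lambda>_. nTwo) n1 (\<Lambda> _\<in>nNat. \<Lambda> _\<in>nTwo. n0) n)"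

definition deltaZero_ty :: ntm where
  [nm]: "deltaZero_ty = (\<Pi> n\<in>nNat. nDelta \<cdot> n \<simeq>\<^bsub>nTwo\<^esub> n1 \<leadsto> n \<simeq>\<^bsub>nNat\<^esub> nZero)"

lemma deltaZero: "holds deltaZero_ty"
  by (rule holdsI[where Hs = "[no01_ty]" and
      t = "\<Lambda> no\<in>no01_ty. \<Lambda> n\<in>nNat.
     nNatE (\<lambda>n. nDelta \<cdot> n \<simeq>\<^bsub>nTwo\<^esub> n1 \<leadsto> n \<simeq>\<^bsub>nNat\<^esub> nZero) (\<Lambda> _\<in>nDelta \<cdot> nZero \<simeq>\<^bsub>nTwo\<^esub> n1. nRefl nZero)
       (\<Lambda> n\<in>nNat. \<Lambda> _\<in>nDelta \<cdot> n \<simeq>\<^bsub>nTwo\<^esub> n1 \<leadsto> n \<simeq>\<^bsub>nNat\<^esub> nZero. \<Lambda> e\<in>nDelta \<cdot> nSucc n \<simeq>\<^bsub>nTwo\<^esub> n1.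
         nEmptyE (nSucc n \<simeq>\<^bsub>nNat\<^esub> nZero) (no \<cdot> e)) n"],
    simp add: no01, simp_all add: nm eval cong: eval_cong)

definition someOcc_ty :: ntm where [nm]: "someOcc_ty = (\<Sigma> u\<in>nNinf. nOcc (nFst u))"

lemma someOcc: "holds someOcc_ty"
  by (rule holdsI[where Hs = "[amoProp_ty, deltaZero_ty]" and
      t = "\<Lambda> ap\<in>amoProp_ty. \<Lambda> dz\<in>deltaZero_ty.
     \<lparr>\<lparr>nDelta, ap \<cdot> nDelta \<cdot> (\<Lambda> n\<in>nNat. \<Lambda> m\<in>nNat. \<Lambda> e\<in>nDelta \<cdot> n \<simeq>\<^bsub>nTwo\<^esub> n1. \<Lambda> d\<in>nDelta \<cdot> m \<simeq>\<^bsub>nTwo\<^esub> n1.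
       nTrans nNat n nZero (dz \<cdot> n \<cdot> e) (nSym nNat m (dz \<cdot> m \<cdot> d)))\<rparr>, \<lparr>nZero, nRefl n1\<rparr>\<rparr>"],
    simp add: amoProp deltaZero, simp_all add: nm eval cong: eval_cong)

definition rosOne_ty :: "nat \<Rightarrow> ntm" where [nm]: "rosOne_ty i = nRos i nOne"

lemma rosOne: "holds (rosOne_ty i)"
  by (rule holdsI[where Hs = "[ros_ty i, someOcc_ty]" and
      t = "\<Lambda> r\<in>ros_ty i. \<Lambda> d\<in>someOcc_ty.
     r \<cdot> nOne \<cdot> (\<Lambda> x\<in>nOne. \<Lambda> y\<in>nOne. nOneE (\<lambda>x. x \<simeq>\<^bsub>nOne\<^esub> y) (nOneE (\<lambda>y. nStar \<simeq>\<^bsub>nOne\<^esub> y) (nRefl nStar) y) x)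
       \<cdot> nFst d \<cdot> (\<Lambda> _\<in>nOne. nSnd d) \<cdot> (\<Lambda> _\<in>nOcc (nFst (nFst d)). nStar)"],
    simp add: ros someOcc, simp_all add: nm eval cong: eval_cong)

section \<open>Joining sequences\<close>

text \<open>The value for \<open>b = 1\<close> may depend on the proof of that equation, as the
  family to be joined does. The value is returned together with the equations that determine it in
  either case.\<close>

definition caseTwo_ty :: ntm where
  [nm]: "caseTwo_ty = (\<Pi> b\<in>nTwo. \<Pi> x\<in>nTwo. \<Pi> y\<in>(b \<simeq>\<^bsub>nTwo\<^esub> n1 \<leadsto> nTwo).
     \<Sigma> v\<in>nTwo. (\<Pi> e\<in>b \<simeq>\<^bsub>nTwo\<^esub> n1. v \<simeq>\<^bsub>nTwo\<^esub> y \<cdot> e) \<otimes> (b \<simeq>\<^bsub>nTwo\<^esub> n0 \<leadsto> v \<simeq>\<^bsub>nTwo\<^esub> x))"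

text \<open>\<open>F c\<close> waits for a proof of \<open>b = c\<close>, and \<open>v\<close> is
  \<open>F b\<close> at reflexivity. Path induction along \<open>e : b = c\<close> identifies
  \<open>v\<close> with \<open>F c e\<close>, which yields both equations at once.\<close>

lemma caseTwo: "holds caseTwo_ty"
  by (rule holdsI[where Hs = "[]" and
      t = "\<Lambda> b\<in>nTwo. \<Lambda> x\<in>nTwo. \<Lambda> y\<in>(b \<simeq>\<^bsub>nTwo\<^esub> n1 \<leadsto> nTwo).
     (let F = (\<lambda>c r. nTwoE (\<lambda>c. b \<simeq>\<^bsub>nTwo\<^esub> c \<leadsto> nTwo) (\<Lambda> _\<in>b \<simeq>\<^bsub>nTwo\<^esub> n0. x) y c \<cdot> r); v = F b (nRefl b);
          h = (\<lambda>e. nJ nTwo b (\<lambda>c r. v \<simeq>\<^bsub>nTwo\<^esub> F c r) (nRefl v) e)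
      in \<lparr>v, \<lparr>\<Lambda> e\<in>b \<simeq>\<^bsub>nTwo\<^esub> n1. h e, \<Lambda> e\<in>b \<simeq>\<^bsub>nTwo\<^esub> n0. h e\<rparr>\<rparr>)"],
    simp, simp_all add: nm eval cong: eval_cong)

definition nFam :: "ntm \<Rightarrow> ntm" where
  [nm]: "nFam \<alpha> = (\<Pi> n\<in>nNat. \<alpha> \<cdot> n \<simeq>\<^bsub>nTwo\<^esub> n1 \<leadsto> nNinf)"

text \<open>\<open>V k n\<close> is term \<open>k\<close> of the joined sequence when the search for a \<open>1\<close> of \<open>\<alpha>\<close> starts at \<open>n\<close>.\<close>

definition nJoin :: "ntm \<Rightarrow> ntm \<Rightarrow> ntm" where
  [nm]: "nJoin \<alpha> g = (\<Sigma> V\<in>nNat \<leadsto> nNat \<leadsto> nTwo.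
     (\<Pi> k\<in>nNat. \<Pi> n\<in>nNat. \<Pi> e\<in>\<alpha> \<cdot> n \<simeq>\<^bsub>nTwo\<^esub> n1. V \<cdot> k \<cdot> n \<simeq>\<^bsub>nTwo\<^esub> nFst (g \<cdot> n \<cdot> e) \<cdot> k) \<otimes>
     (\<Pi> n\<in>nNat. \<alpha> \<cdot> n \<simeq>\<^bsub>nTwo\<^esub> n0 \<leadsto> V \<cdot> nZero \<cdot> n \<simeq>\<^bsub>nTwo\<^esub> n0) \<otimes>
     (\<Pi> k\<in>nNat. \<Pi> n\<in>nNat. \<alpha> \<cdot> n \<simeq>\<^bsub>nTwo\<^esub> n0 \<leadsto> V \<cdot> nSucc k \<cdot> n \<simeq>\<^bsub>nTwo\<^esub> V \<cdot> k \<cdot> nSucc n))"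

text \<open>A single test of \<open>\<alpha> \<cdot> n\<close>. The value \<open>x\<close> for the
  outcome 0 is left open: \<open>join\<close> supplies 0 for entry zero and the recursive value for
  later entries.\<close>

definition nStep :: "ntm \<Rightarrow> ntm \<Rightarrow> ntm" where
  [nm]: "nStep \<alpha> g = (\<Pi> k\<in>nNat. \<Pi> n\<in>nNat. \<Pi> x\<in>nTwo. \<Sigma> v\<in>nTwo.
     (\<Pi> e\<in>\<alpha> \<cdot> n \<simeq>\<^bsub>nTwo\<^esub> n1. v \<simeq>\<^bsub>nTwo\<^esub> nFst (g \<cdot> n \<cdot> e) \<cdot> k) \<otimes> (\<alpha> \<cdot> n \<simeq>\<^bsub>nTwo\<^esub> n0 \<leadsto> v \<simeq>\<^bsub>nTwo\<^esub> x))"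

definition joinStep_ty :: ntm where
  [nm]: "joinStep_ty = (\<Pi> \<alpha>\<in>nSeq. \<Pi> g\<in>nFam \<alpha>. nStep \<alpha> g)"

lemma joinStep: "holds joinStep_ty"
  by (rule holdsI[where Hs = "[caseTwo_ty]" and
      t = "\<Lambda> ct\<in>caseTwo_ty. \<Lambda> \<alpha>\<in>nSeq. \<Lambda> g\<in>nFam \<alpha>. \<Lambda> k\<in>nNat. \<Lambda> n\<in>nNat. \<Lambda> x\<in>nTwo.
     ct \<cdot> (\<alpha> \<cdot> n) \<cdot> x \<cdot> (\<Lambda> e\<in>\<alpha> \<cdot> n \<simeq>\<^bsub>nTwo\<^esub> n1. nFst (g \<cdot> n \<cdot> e) \<cdot> k)"],
    simp add: caseTwo, simp_all add: nm eval cong: eval_cong)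

definition join_ty :: ntm where
  [nm]: "join_ty = (\<Pi> \<alpha>\<in>nSeq. \<Pi> g\<in>nFam \<alpha>. nStep \<alpha> g \<leadsto> nJoin \<alpha> g)"

text \<open>The recursion on \<open>k\<close> produces functions of \<open>n\<close>, since the
  recursive call moves the start to \<open>nSucc n\<close>. The first equation is proved by cases on
  \<open>k\<close>, with the induction hypothesis ignored, only to make the recursion unfold. With
  the equations packed next to \<open>V\<close>, later proofs need not look into the
  recursion.\<close>

lemma join: "holds join_ty"
  by (rule holdsI[where Hs = "[]" and
      t = "\<Lambda> \<alpha>\<in>nSeq. \<Lambda> g\<in>nFam \<alpha>. \<Lambda> c\<in>nStep \<alpha> g.
     (let V = (\<Lambda> k\<in>nNat. nNatE (\<lambda>_. nNat \<leadsto> nTwo) (\<Lambda> n\<in>nNat. nFst (c \<cdot> nZero \<cdot> n \<cdot> n0))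
            (\<Lambda> k\<in>nNat. \<Lambda> v\<in>nNat \<leadsto> nTwo. \<Lambda> n\<in>nNat. nFst (c \<cdot> nSucc k \<cdot> n \<cdot> (v \<cdot> nSucc n))) k);
          Q = (\<lambda>k. \<Pi> n\<in>nNat. \<Pi> e\<in>\<alpha> \<cdot> n \<simeq>\<^bsub>nTwo\<^esub> n1. V \<cdot> k \<cdot> n \<simeq>\<^bsub>nTwo\<^esub> nFst (g \<cdot> n \<cdot> e) \<cdot> k)
      in \<lparr>V, \<lparr>\<Lambda> k\<in>nNat. nNatE Q (\<Lambda> n\<in>nNat. nFst (nSnd (c \<cdot> nZero \<cdot> n \<cdot> n0)))
            (\<Lambda> k\<in>nNat. \<Lambda> _\<in>Q k. \<Lambda> n\<in>nNat. nFst (nSnd (c \<cdot> nSucc k \<cdot> n \<cdot> (V \<cdot> k \<cdot> nSucc n)))) k,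
          \<lparr>\<Lambda> n\<in>nNat. nSnd (nSnd (c \<cdot> nZero \<cdot> n \<cdot> n0)),
           \<Lambda> k\<in>nNat. \<Lambda> n\<in>nNat. nSnd (nSnd (c \<cdot> nSucc k \<cdot> n \<cdot> (V \<cdot> k \<cdot> nSucc n)))\<rparr>\<rparr>\<rparr>)"],
    simp, simp_all add: nm eval cong: eval_cong)

section \<open>Correctness of the joined sequence\<close>

definition nCase :: "ntm \<Rightarrow> ntm \<Rightarrow> (ntm \<Rightarrow> ntm) \<Rightarrow> (ntm \<Rightarrow> ntm) \<Rightarrow> ntm" where
  [nm]: "nCase a R c d =
     nTwoE (\<lambda>b. a \<simeq>\<^bsub>nTwo\<^esub> b \<leadsto> R) (\<Lambda> e\<in>a \<simeq>\<^bsub>nTwo\<^esub> n0. c e) (\<Lambda> e\<in>a \<simeq>\<^bsub>nTwo\<^esub> n1. d e) a \<cdot> nRefl a"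

text \<open>From \<open>p : a = b\<close> and \<open>q : a = c\<close> to \<open>b = c\<close>.\<close>

definition nVia :: "ntm \<Rightarrow> ntm \<Rightarrow> ntm \<Rightarrow> ntm \<Rightarrow> ntm \<Rightarrow> ntm" where
  [nm]: "nVia A a c p q = nJ A a (\<lambda>x _. x \<simeq>\<^bsub>A\<^esub> c) q p"

text \<open>Mediates between the joined sequence and the product: it is inhabited exactly when the
  joined sequence has a 1, and for the family pulled back from \<open>P\<close> exactly when
  \<open>P\<close> and \<open>Q\<close> hold. It lives in the lowest universe.\<close>

definition nHit :: "ntm \<Rightarrow> ntm \<Rightarrow> ntm" where
  [nm]: "nHit \<alpha> g = (\<Sigma> n\<in>nNat. \<Sigma> e\<in>\<alpha> \<cdot> n \<simeq>\<^bsub>nTwo\<^esub> n1. nOcc (nFst (g \<cdot> n \<cdot> e)))"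

definition joinFwd_ty :: ntm where
  [nm]: "joinFwd_ty = (\<Pi> \<alpha>\<in>nSeq. \<Pi> g\<in>nFam \<alpha>. \<Pi> w\<in>nJoin \<alpha> g.
     \<Pi> k\<in>nNat. \<Pi> n\<in>nNat. nFst w \<cdot> k \<cdot> n \<simeq>\<^bsub>nTwo\<^esub> n1 \<leadsto> nHit \<alpha> g)"

text \<open>Induction on \<open>k\<close> for all starts \<open>n\<close>. If
  \<open>\<alpha> \<cdot> n\<close> is 1, the hit is at \<open>n\<close> itself. If it is 0, entry
  zero would be 0, and a later entry is one of the search started one step further.\<close>

lemma joinFwd: "holds joinFwd_ty"
  by (rule holdsI[where Hs = "[no01_ty]" and
      t = "\<Lambda> no\<in>no01_ty. \<Lambda> \<alpha>\<in>nSeq. \<Lambda> g\<in>nFam \<alpha>. \<Lambda> w\<in>nJoin \<alpha> g.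
     (let V = nFst w; w1 = nFst (nSnd w); w2 = nFst (nSnd (nSnd w)); w3 = nSnd (nSnd (nSnd w)); H = nHit \<alpha> g;
          Q = (\<lambda>k. \<Pi> n\<in>nNat. V \<cdot> k \<cdot> n \<simeq>\<^bsub>nTwo\<^esub> n1 \<leadsto> H);
          now = (\<lambda>k n h e. \<lparr>n, \<lparr>e, \<lparr>k, nVia nTwo (V \<cdot> k \<cdot> n) n1 (w1 \<cdot> k \<cdot> n \<cdot> e) h\<rparr>\<rparr>\<rparr>)
      in \<Lambda> k\<in>nNat. nNatE Q
        (\<Lambda> n\<in>nNat. \<Lambda> h\<in>V \<cdot> nZero \<cdot> n \<simeq>\<^bsub>nTwo\<^esub> n1. nCase (\<alpha> \<cdot> n) H
          (\<lambda>d. nEmptyE H (no \<cdot> nVia nTwo (V \<cdot> nZero \<cdot> n) n1 (w2 \<cdot> n \<cdot> d) h)) (now nZero n h))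
        (\<Lambda> k\<in>nNat. \<Lambda> ih\<in>Q k. \<Lambda> n\<in>nNat. \<Lambda> h\<in>V \<cdot> nSucc k \<cdot> n \<simeq>\<^bsub>nTwo\<^esub> n1. nCase (\<alpha> \<cdot> n) H
          (\<lambda>d. ih \<cdot> nSucc n \<cdot> nVia nTwo (V \<cdot> nSucc k \<cdot> n) n1 (w3 \<cdot> k \<cdot> n \<cdot> d) h) (now (nSucc k) n h)) k)"],
    simp add: no01, simp_all add: nm eval cong: eval_cong)

definition moveHit_ty :: ntm where
  [nm]: "moveHit_ty = (\<Pi> \<alpha>\<in>nSeq. \<Pi> g\<in>nFam \<alpha>. nAmo \<alpha> \<leadsto> nHit \<alpha> g \<leadsto>
     (\<Pi> n\<in>nNat. \<Pi> e\<in>\<alpha> \<cdot> n \<simeq>\<^bsub>nTwo\<^esub> n1. nOcc (nFst (g \<cdot> n \<cdot> e))))"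

text \<open>The family depends on the position and on the proof that the entry there is 1, so two
  transports are needed: \<open>nAmo\<close> identifies the positions and \<open>twoSet\<close> the
  proofs.\<close>

lemma moveHit: "holds moveHit_ty"
  by (rule holdsI[where Hs = "[twoSet_ty]" and
      t = "\<Lambda> ts\<in>twoSet_ty. \<Lambda> \<alpha>\<in>nSeq. \<Lambda> g\<in>nFam \<alpha>. \<Lambda> m\<in>nAmo \<alpha>. \<Lambda> h\<in>nHit \<alpha> g.
     \<Lambda> n\<in>nNat. \<Lambda> e\<in>\<alpha> \<cdot> n \<simeq>\<^bsub>nTwo\<^esub> n1.
     (let l = nFst h; d = nFst (nSnd h)
      in nJ nNat l (\<lambda>x _. \<Pi> c\<in>\<alpha> \<cdot> x \<simeq>\<^bsub>nTwo\<^esub> n1. nOcc (nFst (g \<cdot> x \<cdot> c)))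
           (\<Lambda> c\<in>\<alpha> \<cdot> l \<simeq>\<^bsub>nTwo\<^esub> n1. nJ (\<alpha> \<cdot> l \<simeq>\<^bsub>nTwo\<^esub> n1) d (\<lambda>c _. nOcc (nFst (g \<cdot> l \<cdot> c))) (nSnd (nSnd h))
             (ts \<cdot> (\<alpha> \<cdot> l) \<cdot> n1 \<cdot> d \<cdot> c))
           (m \<cdot> l \<cdot> n \<cdot> d \<cdot> e) \<cdot> e)"],
    simp add: twoSet, simp_all add: nm eval cong: eval_cong)

definition nOn :: "ntm \<Rightarrow> ntm \<Rightarrow> ntm" where
  [nm]: "nOn w n = (\<Sigma> k\<in>nNat. nFst w \<cdot> k \<cdot> n \<simeq>\<^bsub>nTwo\<^esub> n1)"

definition joinNow_ty :: ntm where
  [nm]: "joinNow_ty = (\<Pi> \<alpha>\<in>nSeq. \<Pi> g\<in>nFam \<alpha>. \<Pi> w\<in>nJoin \<alpha> g. \<Pi> n\<in>nNat. \<Pi> e\<in>\<alpha> \<cdot> n \<simeq>\<^bsub>nTwo\<^esub> n1.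
     nOcc (nFst (g \<cdot> n \<cdot> e)) \<leadsto> nOn w n)"

lemma joinNow: "holds joinNow_ty"
  by (rule holdsI[where Hs = "[]" and
      t = "\<Lambda> \<alpha>\<in>nSeq. \<Lambda> g\<in>nFam \<alpha>. \<Lambda> w\<in>nJoin \<alpha> g. \<Lambda> n\<in>nNat. \<Lambda> e\<in>\<alpha> \<cdot> n \<simeq>\<^bsub>nTwo\<^esub> n1.
     \<Lambda> z\<in>nOcc (nFst (g \<cdot> n \<cdot> e)). \<lparr>nFst z,
       nTrans nTwo (nFst w \<cdot> nFst z \<cdot> n) (nFst (g \<cdot> n \<cdot> e) \<cdot> nFst z) (nFst (nSnd w) \<cdot> nFst z \<cdot> n \<cdot> e) (nSnd z)\<rparr>"],
    simp, simp_all add: nm eval cong: eval_cong)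

text \<open>If the sequence started after \<open>n\<close> has a \<open>1\<close> although \<open>\<alpha> n = 1\<close>, then by uniqueness that
  \<open>1\<close> already comes from the family at \<open>n\<close>.\<close>

definition joinBwd_ty :: ntm where
  [nm]: "joinBwd_ty = (\<Pi> \<alpha>\<in>nSeq. \<Pi> g\<in>nFam \<alpha>. \<Pi> w\<in>nJoin \<alpha> g. nAmo \<alpha> \<leadsto> (\<Pi> n\<in>nNat. nOn w n \<leadsto> nOn w nZero))"

text \<open>Induction on \<open>n\<close> moves the start back one step at a time. Passing a 0 of
  \<open>\<alpha>\<close> increases the position of the 1 by one, hence the \<open>nSucc\<close> in
  the witness.\<close>

lemma joinBwd: "holds joinBwd_ty"
  by (rule holdsI[where Hs = "[joinFwd_ty, moveHit_ty, joinNow_ty]" and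
      t = "\<Lambda> fw\<in>joinFwd_ty. \<Lambda> mv\<in>moveHit_ty. \<Lambda> nw\<in>joinNow_ty.
     \<Lambda> \<alpha>\<in>nSeq. \<Lambda> g\<in>nFam \<alpha>. \<Lambda> w\<in>nJoin \<alpha> g. \<Lambda> m\<in>nAmo \<alpha>. \<Lambda> n\<in>nNat.
     (let V = nFst w; w3 = nSnd (nSnd (nSnd w))
      in nNatE (\<lambda>n. nOn w n \<leadsto> nOn w nZero) (\<Lambda> r\<in>nOn w nZero. r)
        (\<Lambda> n\<in>nNat. \<Lambda> ih\<in>nOn w n \<leadsto> nOn w nZero. \<Lambda> r\<in>nOn w (nSucc n). ih \<cdot> nCase (\<alpha> \<cdot> n) (nOn w n)
          (\<lambda>d. \<lparr>nSucc (nFst r), nTrans nTwo (V \<cdot> nSucc (nFst r) \<cdot> n) (V \<cdot> nFst r \<cdot> nSucc n) (w3 \<cdot> nFst r \<cdot> n \<cdot> d) (nSnd r)\<rparr>)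
          (\<lambda>e. nw \<cdot> \<alpha> \<cdot> g \<cdot> w \<cdot> n \<cdot> e \<cdot> (mv \<cdot> \<alpha> \<cdot> g \<cdot> m \<cdot> (fw \<cdot> \<alpha> \<cdot> g \<cdot> w \<cdot> nFst r \<cdot> nSucc n \<cdot> nSnd r) \<cdot> n \<cdot> e))) n)"],
    simp add: joinFwd moveHit joinNow, simp_all add: nm eval cong: eval_cong)

definition joinAmo_ty :: ntm where
  [nm]: "joinAmo_ty = (\<Pi> \<alpha>\<in>nSeq. \<Pi> g\<in>nFam \<alpha>. \<Pi> w\<in>nJoin \<alpha> g. \<Pi> k\<in>nNat. \<Pi> l\<in>nNat. \<Pi> n\<in>nNat.
     nFst w \<cdot> k \<cdot> n \<simeq>\<^bsub>nTwo\<^esub> n1 \<leadsto> nFst w \<cdot> l \<cdot> n \<simeq>\<^bsub>nTwo\<^esub> n1 \<leadsto> k \<simeq>\<^bsub>nNat\<^esub> l)"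

text \<open>Double induction on \<open>k\<close> and \<open>l\<close> for all \<open>n\<close>.
  Where \<open>\<alpha> \<cdot> n\<close> is 1, both entries belong to one sequence of the family,
  which has at most one 1. Where it is 0, neither index can be zero, and two successors reduce to
  the predecessors with start \<open>nSucc n\<close>.\<close>

lemma joinAmo: "holds joinAmo_ty"
  by (rule holdsI[where Hs = "[no01_ty, propAmo_ty]" and
      t = "\<Lambda> no\<in>no01_ty. \<Lambda> pa\<in>propAmo_ty. \<Lambda> \<alpha>\<in>nSeq. \<Lambda> g\<in>nFam \<alpha>. \<Lambda> w\<in>nJoin \<alpha> g.
     (let V = nFst w; w1 = nFst (nSnd w); w2 = nFst (nSnd (nSnd w)); w3 = nSnd (nSnd (nSnd w));
          Q = (\<lambda>k l. \<Pi> n\<in>nNat. V \<cdot> k \<cdot> n \<simeq>\<^bsub>nTwo\<^esub> n1 \<leadsto> V \<cdot> l \<cdot> n \<simeq>\<^bsub>nTwo\<^esub> n1 \<leadsto> k \<simeq>\<^bsub>nNat\<^esub> l);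
          at1 = (\<lambda>k n h e. nVia nTwo (V \<cdot> k \<cdot> n) n1 (w1 \<cdot> k \<cdot> n \<cdot> e) h);
          abs = (\<lambda>k l n h d. nEmptyE (k \<simeq>\<^bsub>nNat\<^esub> l) (no \<cdot> nVia nTwo (V \<cdot> nZero \<cdot> n) n1 (w2 \<cdot> n \<cdot> d) h));
          step = (\<lambda>k l zero. \<Lambda> n\<in>nNat. \<Lambda> h\<in>V \<cdot> k \<cdot> n \<simeq>\<^bsub>nTwo\<^esub> n1. \<Lambda> h'\<in>V \<cdot> l \<cdot> n \<simeq>\<^bsub>nTwo\<^esub> n1.
            nCase (\<alpha> \<cdot> n) (k \<simeq>\<^bsub>nNat\<^esub> l) (zero n h h')
              (\<lambda>e. pa \<cdot> nFst (g \<cdot> n \<cdot> e) \<cdot> nSnd (g \<cdot> n \<cdot> e) \<cdot> k \<cdot> l \<cdot> at1 k n h e \<cdot> at1 l n h' e))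
      in \<Lambda> k\<in>nNat. nNatE (\<lambda>k. \<Pi> l\<in>nNat. Q k l)
        (\<Lambda> l\<in>nNat. step nZero l (\<lambda>n h h'. abs nZero l n h))
        (\<Lambda> k\<in>nNat. \<Lambda> ih\<in>(\<Pi> l\<in>nNat. Q k l). \<Lambda> l\<in>nNat. nNatE (\<lambda>l. Q (nSucc k) l)
          (step (nSucc k) nZero (\<lambda>n h h'. abs (nSucc k) nZero n h'))
          (\<Lambda> l\<in>nNat. \<Lambda> _\<in>Q (nSucc k) l. step (nSucc k) (nSucc l) (\<lambda>n h h' d.
            nJ nNat k (\<lambda>x _. nSucc k \<simeq>\<^bsub>nNat\<^esub> nSucc x) (nRefl (nSucc k))
              (ih \<cdot> l \<cdot> nSucc n \<cdot> nVia nTwo (V \<cdot> nSucc k \<cdot> n) n1 (w3 \<cdot> k \<cdot> n \<cdot> d) h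
                \<cdot> nVia nTwo (V \<cdot> nSucc l \<cdot> n) n1 (w3 \<cdot> l \<cdot> n \<cdot> d) h'))) l) k)"],
    simp add: no01 propAmo, simp_all add: nm eval cong: eval_cong)

definition joined_ty :: ntm where
  [nm]: "joined_ty = (\<Pi> \<alpha>\<in>nSeq. \<Pi> g\<in>nFam \<alpha>. \<Pi> w\<in>nJoin \<alpha> g. nAmo \<alpha> \<leadsto> (\<Sigma> u\<in>nNinf.
     (nOcc (nFst u) \<leadsto> nHit \<alpha> g) \<otimes> (nHit \<alpha> g \<leadsto> nOcc (nFst u))))"

lemma joined: "holds joined_ty"
  by (rule holdsI[where Hs = "[amoProp_ty, joinFwd_ty, joinNow_ty, joinBwd_ty, joinAmo_ty]" and
      t = "\<Lambda> ap\<in>amoProp_ty. \<Lambda> fw\<in>joinFwd_ty. \<Lambda> nw\<in>joinNow_ty. \<Lambda> bw\<in>joinBwd_ty. \<Lambda> ja\<in>joinAmo_ty.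
     \<Lambda> \<alpha>\<in>nSeq. \<Lambda> g\<in>nFam \<alpha>. \<Lambda> w\<in>nJoin \<alpha> g. \<Lambda> m\<in>nAmo \<alpha>.
     (let s = (\<Lambda> k\<in>nNat. nFst w \<cdot> k \<cdot> nZero)
      in \<lparr>\<lparr>s, ap \<cdot> s \<cdot> (\<Lambda> k\<in>nNat. \<Lambda> l\<in>nNat. ja \<cdot> \<alpha> \<cdot> g \<cdot> w \<cdot> k \<cdot> l \<cdot> nZero)\<rparr>,
          \<lparr>\<Lambda> z\<in>nOcc s. fw \<cdot> \<alpha> \<cdot> g \<cdot> w \<cdot> nFst z \<cdot> nZero \<cdot> nSnd z,
           \<Lambda> h\<in>nHit \<alpha> g. bw \<cdot> \<alpha> \<cdot> g \<cdot> w \<cdot> m \<cdot> nFst h \<cdot> (nw \<cdot> \<alpha> \<cdot> g \<cdot> w \<cdot> nFst h \<cdot> nFst (nSnd h) \<cdot> nSnd (nSnd h))\<rparr>\<rparr>)"],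
    simp add: amoProp joinFwd joinNow joinBwd joinAmo, simp_all add: nm eval cong: eval_cong)

definition joinInf_ty :: ntm where
  [nm]: "joinInf_ty = (\<Pi> \<alpha>\<in>nSeq. \<Pi> g\<in>nFam \<alpha>. nAmo \<alpha> \<leadsto> (\<Sigma> u\<in>nNinf.
     (nOcc (nFst u) \<leadsto> nHit \<alpha> g) \<otimes> (nHit \<alpha> g \<leadsto> nOcc (nFst u))))"

lemma joinInf: "holds joinInf_ty"
  by (rule holdsI[where Hs = "[joinStep_ty, join_ty, joined_ty]" and
      t = "\<Lambda> st\<in>joinStep_ty. \<Lambda> jn\<in>join_ty. \<Lambda> jd\<in>joined_ty. \<Lambda> \<alpha>\<in>nSeq. \<Lambda> g\<in>nFam \<alpha>.
     jd \<cdot> \<alpha> \<cdot> g \<cdot> (jn \<cdot> \<alpha> \<cdot> g \<cdot> (st \<cdot> \<alpha> \<cdot> g))"],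
    simp add: joinStep join joined, simp_all add: nm eval cong: eval_cong)

section \<open>Choice and dominance\<close>

text \<open>\<open>H\<close> stands for \<open>nHit\<close> and is kept a variable, so that
  composing the implications is checked without the body of \<open>nHit\<close>.\<close>

definition rosVia_ty :: "nat \<Rightarrow> ntm" where
  [nm]: "rosVia_ty i = (\<Pi> X\<in>nU i. nIsProp X \<leadsto> (\<Pi> H\<in>nU 0.
     (\<Sigma> u\<in>nNinf. (nOcc (nFst u) \<leadsto> H) \<otimes> (H \<leadsto> nOcc (nFst u))) \<leadsto> (X \<leadsto> H) \<leadsto> (H \<leadsto> X) \<leadsto> nRos i X))"

lemma rosVia: "holds (rosVia_ty i)"
  by (rule holdsI[where Hs = "[ros_ty i]" and
      t = "\<Lambda> r\<in>ros_ty i. \<Lambda> X\<in>nU i. \<Lambda> h\<in>nIsProp X. \<Lambda> H\<in>nU 0.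
     \<Lambda> u\<in>(\<Sigma> u\<in>nNinf. (nOcc (nFst u) \<leadsto> H) \<otimes> (H \<leadsto> nOcc (nFst u))). \<Lambda> f\<in>X \<leadsto> H. \<Lambda> g\<in>H \<leadsto> X.
     r \<cdot> X \<cdot> h \<cdot> nFst u \<cdot> (\<Lambda> x\<in>X. nSnd (nSnd u) \<cdot> (f \<cdot> x)) \<cdot> (\<Lambda> z\<in>nOcc (nFst (nFst u)). g \<cdot> (nFst (nSnd u) \<cdot> z))"],
    simp add: ros, simp_all add: nm eval cong: eval_cong)

section \<open>Structures on products\<close>

definition nTo :: "nat \<Rightarrow> ntm \<Rightarrow> ntm \<Rightarrow> ntm" where
  [nm]: "nTo i P e = nJ (nU i) P (\<lambda>Y _. P \<leadsto> Y) (\<Lambda> p\<in>P. p) e"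

definition nFrom :: "nat \<Rightarrow> ntm \<Rightarrow> ntm \<Rightarrow> ntm" where
  [nm]: "nFrom i P e = nJ (nU i) P (\<lambda>Y _. Y \<leadsto> P) (\<Lambda> p\<in>P. p) e"

text \<open>This is how a function on \<open>P\<close> becomes a family for the join: an occurrence
  of 1 in the sequence of \<open>P\<close> is transported to an element of \<open>P\<close>.\<close>

definition nPull :: "nat \<Rightarrow> ntm \<Rightarrow> ntm \<Rightarrow> ntm \<Rightarrow> ntm" where
  [nm]: "nPull i P s f = (\<Lambda> n\<in>nNat. \<Lambda> e\<in>nFst (nFst s) \<cdot> n \<simeq>\<^bsub>nTwo\<^esub> n1. nFst (f \<cdot> (nFrom i P (nSnd s) \<cdot> \<lparr>n, e\<rparr>)))"

definition prodProp_ty :: "nat \<Rightarrow> ntm" where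
  [nm]: "prodProp_ty i = (\<Pi> P\<in>nU i. \<Pi> Q\<in>nU i. nRos i P \<leadsto> (P \<leadsto> nRos i Q) \<leadsto> nIsProp (P \<otimes> Q))"

text \<open>That \<open>Q\<close> is a proposition is known only in the presence of an element of
  \<open>P\<close>, which is where \<open>f\<close> gives a structure on it. The fibre hypothesis of
  \<open>sigProp\<close> has such an element available.\<close>

lemma prodProp: "holds (prodProp_ty i)"
  by (rule holdsI[where Hs = "[sigProp_ty i, rosProp_ty i]" and
      t = "\<Lambda> sp\<in>sigProp_ty i. \<Lambda> rp\<in>rosProp_ty i. \<Lambda> P\<in>nU i. \<Lambda> Q\<in>nU i. \<Lambda> s\<in>nRos i P. \<Lambda> f\<in>P \<leadsto> nRos i Q.
     sp \<cdot> P \<cdot> (\<Lambda> _\<in>P. Q) \<cdot> (\<Lambda> x\<in>P. \<Lambda> y\<in>P. \<Lambda> _\<in>Q. \<Lambda> _\<in>Q. rp \<cdot> P \<cdot> s \<cdot> x \<cdot> y) \<cdot> (\<Lambda> x\<in>P. \<Lambda> _\<in>Q. rp \<cdot> Q \<cdot> (f \<cdot> x))"],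
    simp add: sigProp rosProp, simp_all add: nm eval cong: eval_cong)

definition prodHit_ty :: "nat \<Rightarrow> ntm" where
  [nm]: "prodHit_ty i = (\<Pi> P\<in>nU i. \<Pi> Q\<in>nU i. \<Pi> s\<in>nRos i P. \<Pi> f\<in>P \<leadsto> nRos i Q.
     P \<otimes> Q \<leadsto> nHit (nFst (nFst s)) (nPull i P s f))"

text \<open>The point \<open>p\<close> is \<open>nFst x\<close> sent to its occurrence and back.
  Since \<open>nPull\<close> evaluates \<open>f\<close> at exactly this point, the last component
  fits without comparing \<open>p\<close> with \<open>nFst x\<close>.\<close>

lemma prodHit: "holds (prodHit_ty i)"
  by (rule holdsI[where Hs = "[]" and
      t = "\<Lambda> P\<in>nU i. \<Lambda> Q\<in>nU i. \<Lambda> s\<in>nRos i P. \<Lambda> f\<in>P \<leadsto> nRos i Q. \<Lambda> x\<in>P \<otimes> Q.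
     (let z = nTo i P (nSnd s) \<cdot> nFst x; p = nFrom i P (nSnd s) \<cdot> \<lparr>nFst z, nSnd z\<rparr>
      in \<lparr>nFst z, \<lparr>nSnd z, nTo i Q (nSnd (f \<cdot> p)) \<cdot> nSnd x\<rparr>\<rparr>)"],
    simp, simp_all add: nm eval cong: eval_cong)

definition hitProd_ty :: "nat \<Rightarrow> ntm" where
  [nm]: "hitProd_ty i = (\<Pi> P\<in>nU i. \<Pi> Q\<in>nU i. \<Pi> s\<in>nRos i P. \<Pi> f\<in>P \<leadsto> nRos i Q.
     nHit (nFst (nFst s)) (nPull i P s f) \<leadsto> P \<otimes> Q)"

lemma hitProd: "holds (hitProd_ty i)"
  by (rule holdsI[where Hs = "[]" and
      t = "\<Lambda> P\<in>nU i. \<Lambda> Q\<in>nU i. \<Lambda> s\<in>nRos i P. \<Lambda> f\<in>P \<leadsto> nRos i Q.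
     \<Lambda> h\<in>nHit (nFst (nFst s)) (nPull i P s f).
     (let p = nFrom i P (nSnd s) \<cdot> \<lparr>nFst h, nFst (nSnd h)\<rparr>
      in \<lparr>p, nFrom i Q (nSnd (f \<cdot> p)) \<cdot> nSnd (nSnd h)\<rparr>)"],
    simp, simp_all add: nm eval cong: eval_cong)

definition rosProd_ty :: "nat \<Rightarrow> ntm" where
  [nm]: "rosProd_ty i = (\<Pi> P\<in>nU i. \<Pi> Q\<in>nU i. nRos i P \<leadsto> (P \<leadsto> nRos i Q) \<leadsto> nRos i (P \<otimes> Q))"

lemma rosProd: "holds (rosProd_ty i)"
  by (rule holdsI[where Hs = "[rosVia_ty i, prodProp_ty i, prodHit_ty i, hitProd_ty i, joinInf_ty, propAmo_ty]" and
      t = "\<Lambda> rv\<in>rosVia_ty i. \<Lambda> pp\<in>prodProp_ty i. \<Lambda> ph\<in>prodHit_ty i. \<Lambda> hp\<in>hitProd_ty i.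
     \<Lambda> ji\<in>joinInf_ty. \<Lambda> pa\<in>propAmo_ty. \<Lambda> P\<in>nU i. \<Lambda> Q\<in>nU i. \<Lambda> s\<in>nRos i P. \<Lambda> f\<in>P \<leadsto> nRos i Q.
     (let \<alpha> = nFst (nFst s); g = nPull i P s f
      in rv \<cdot> (P \<otimes> Q) \<cdot> (pp \<cdot> P \<cdot> Q \<cdot> s \<cdot> f) \<cdot> nHit \<alpha> g \<cdot> (ji \<cdot> \<alpha> \<cdot> g \<cdot> (pa \<cdot> \<alpha> \<cdot> nSnd (nFst s)))
        \<cdot> (ph \<cdot> P \<cdot> Q \<cdot> s \<cdot> f) \<cdot> (hp \<cdot> P \<cdot> Q \<cdot> s \<cdot> f))"],
    simp add: rosVia prodProp prodHit hitProd joinInf propAmo, simp_all add: nm eval cong: eval_cong)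

section \<open>The two implications\<close>

definition nChoice :: "nat \<Rightarrow> ntm" where
  [nm]: "nChoice i = (\<Pi> P\<in>nU i. \<Pi> Q\<in>nU i. nIsRos i \<cdot> P \<leadsto> (P \<leadsto> nTr (nRos i Q)) \<leadsto> nTr (P \<leadsto> nRos i Q))"

definition nDom :: "nat \<Rightarrow> ntm" where
  [nm]: "nDom i = (\<Pi> X\<in>nU i. nIsProp (nIsRos i \<cdot> X)) \<otimes> (\<Pi> X\<in>nU i. nIsRos i \<cdot> X \<leadsto> nIsProp X) \<otimes>
     nIsRos i \<cdot> nOne \<otimes> (\<Pi> P\<in>nU i. \<Pi> Q\<in>nU i. nIsRos i \<cdot> P \<leadsto> (P \<leadsto> nIsRos i \<cdot> Q) \<leadsto> nIsRos i \<cdot> (P \<otimes> Q))"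

definition nTrProp :: "ntm \<Rightarrow> ntm" where [nm]: "nTrProp A = (\<Lambda> s\<in>A. \<Lambda> t\<in>A. nTrP s t)"

text \<open>Truncations may be opened because each goal is a proposition: by
  \<open>isPropIsProp\<close> when \<open>X\<close> is shown to be a proposition, and by
  \<open>nTrP\<close> for closure under products. Choice is applied before opening, so that a
  genuine function \<open>f\<close> is in hand when \<open>rosProd\<close> is called.\<close>

lemma dominance_of_choice: "holds (nChoice i \<leadsto> nDom i)"
  by (rule holdsI[where Hs = "[isPropIsProp_ty i, rosProp_ty i, rosOne_ty i, rosProd_ty i]" and
      t = "\<Lambda> pp\<in>isPropIsProp_ty i. \<Lambda> rp\<in>rosProp_ty i. \<Lambda> ro\<in>rosOne_ty i. \<Lambda> rd\<in>rosProd_ty i. \<Lambda> ch\<in>nChoice i.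
     \<lparr>\<Lambda> X\<in>nU i. nTrProp (nIsRos i \<cdot> X),
      \<lparr>\<Lambda> X\<in>nU i. \<Lambda> t\<in>nIsRos i \<cdot> X. nTrE (pp \<cdot> X) (rp \<cdot> X) t,
       \<lparr>nTrI ro,
        \<Lambda> P\<in>nU i. \<Lambda> Q\<in>nU i. \<Lambda> hP\<in>nIsRos i \<cdot> P. \<Lambda> hQ\<in>P \<leadsto> nIsRos i \<cdot> Q.
          nTrE (nTrProp (nIsRos i \<cdot> (P \<otimes> Q))) (\<Lambda> f\<in>P \<leadsto> nRos i Q.
            nTrE (nTrProp (nIsRos i \<cdot> (P \<otimes> Q))) (\<Lambda> s\<in>nRos i P. nTrI (rd \<cdot> P \<cdot> Q \<cdot> s \<cdot> f)) hP)
          (ch \<cdot> P \<cdot> Q \<cdot> hP \<cdot> hQ)\<rparr>\<rparr>\<rparr>"],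
    simp add: isPropIsProp rosProp rosOne rosProd, simp_all add: nm eval cong: eval_cong)

text \<open>The truncation is opened outside the function space: the structure on
  \<open>P \<otimes> Q\<close> does not depend on \<open>p\<close>, so one choice serves all
  \<open>p\<close>. That \<open>Q\<close> is a proposition comes, given \<open>p\<close>, from the
  second clause of the dominance applied to \<open>hQ \<cdot> p\<close>.\<close>

lemma choice_of_dominance: "holds (nDom i \<leadsto> nChoice i)"
  by (rule holdsI[where Hs = "[ros_ty i]" and
      t = "\<Lambda> ro\<in>ros_ty i. \<Lambda> D\<in>nDom i. \<Lambda> P\<in>nU i. \<Lambda> Q\<in>nU i. \<Lambda> hP\<in>nIsRos i \<cdot> P. \<Lambda> hQ\<in>P \<leadsto> nTr (nRos i Q).
     nTrE (nTrProp (nTr (P \<leadsto> nRos i Q)))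
       (\<Lambda> s\<in>nRos i (P \<otimes> Q). nTrI (\<Lambda> p\<in>P. ro \<cdot> Q \<cdot> (nFst (nSnd D) \<cdot> Q \<cdot> (hQ \<cdot> p)) \<cdot> nFst s
          \<cdot> (\<Lambda> q\<in>Q. nTo i (P \<otimes> Q) (nSnd s) \<cdot> \<lparr>p, q\<rparr>)
          \<cdot> (\<Lambda> z\<in>nOcc (nFst (nFst s)). nSnd (nFrom i (P \<otimes> Q) (nSnd s) \<cdot> z))))
       (nSnd (nSnd (nSnd D)) \<cdot> P \<cdot> Q \<cdot> hP \<cdot> hQ)"],
    simp add: ros, simp_all add: nm eval cong: eval_cong)

definition nEquiv :: "nat \<Rightarrow> ntm" where
  [nm]: "nEquiv i = (nChoice i \<leadsto> nDom i) \<otimes> (nDom i \<leadsto> nChoice i)"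

lemma choice_iff_dominance: "holds (nEquiv i)"
  by (rule holdsI[where Hs = "[nChoice i \<leadsto> nDom i, nDom i \<leadsto> nChoice i]" and
      t = "\<Lambda> f\<in>nChoice i \<leadsto> nDom i. \<Lambda> g\<in>nDom i \<leadsto> nChoice i. \<lparr>f, g\<rparr>"],
    simp add: dominance_of_choice choice_of_dominance, simp_all add: nm eval cong: eval_cong)

lemma logEquiv_eq: "logEquiv (rosoliniChoice i) (isDominance i (isRosolini i)) = nEquiv i 0"
  by (simp add: nm logEquiv_def rosoliniChoice_def isDominance_def isRosolini_def rosoliniStructure_def
    Ninf_def occ_def times_def arrow_def isProp_def Let_def)

theorem theorem5p30:
  fixes i :: nat
  shows "inhabited (logEquiv (rosoliniChoice i) (isDominance i (isRosolini i)))"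
  using choice_iff_dominance[of i] by (simp add: logEquiv_eq holds_def)

end
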